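(* Let $\mathfrak g$ be a semisimple Lie algebra over $\Bbbk$ and $\vartheta\in\mathrm{Aut}(\mathfrak g)$ of finite order $m\ge2$. One has $\infty\in\mathbb P_{\sf reg}$ (that is, $\mathrm{ind}\,\mathfrak g_{(\infty)}=\mathrm{ind}\,\mathfrak g$) if and only if $\dim\mathfrak g_0=\mathrm{rk}\,\mathfrak g_0$, i.e., $\mathfrak g_0$ is an abelian subalgebra of $\mathfrak g$.
   Context: The ground field $\Bbbk$ is algebraically closed of characteristic $0$; Lie algebras are finite-dimensional. Fix a primitive $m$-th root of unity $\zeta$; for $j\in\{0,\dots,m-1\}$ let $\mathfrak g_j=\{x\in\mathfrak g\mid\vartheta(x)=\zeta^jx\}$; $\mathfrak g_0=\mathfrak g^\vartheta$ is reductive. For $x\in\mathfrak g_i$, $y\in\mathfrak g_j$ with $i,j\in\{0,\dots,m-1\}$ put $[x,y]_0=[x,y]$, $[x,y]_\infty=0$ if $i+j<m$, and $[x,y]_0=0$, $[x,y]_\infty=[x,y]$ if $i+j\ge m$; for $t\in\Bbbk$ put $[\,,\,]_t=[\,,\,]_0+t[\,,\,]_\infty$. For $t\in\mathbb P:=\Bbbk\cup\{\infty\}$, $\mathfrak g_{(t)}$ is the vector space $\mathfrak g$ with the Lie bracket $[\,,\,]_t$ (so $\mathfrak g_{(1)}=\mathfrak g$). The index of a Lie algebra $\mathfrak q$ is $\mathrm{ind}\,\mathfrak q=\min_{\xi\in\mathfrak q^*}\dim\mathfrak q^\xi$ ($\mathfrak q^\xi$ is the coadjoint stabiliser). $\mathbb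 P_{\sf reg}=\{t\in\mathbb P\mid \mathrm{ind}\,\mathfrak g_{(t)}=\mathrm{ind}\,\mathfrak g\}$. The rank of a reductive Lie algebra is the dimension of a Cartan subalgebra; $\mathrm{ind}\,\mathfrak g=\mathrm{rk}\,\mathfrak g$. *)

theory Defs
  imports "HOL-Computational_Algebra.Polynomial"
begin

section \<open>Lie algebras\<close>

text \<open>
  The underlying vector space is a whole type \<open>'v\<close> with scalar multiplication \<open>scale\<close>.  The
  bracket is a separate parameter, since one vector space will carry a family of brackets.
  Subalgebras and ideals are sets of vectors.
\<close>

definition bilinear_map ::
  "('k::field \<Rightarrow> 'v::ab_group_add \<Rightarrow> 'v) \<Rightarrow> ('v \<Rightarrow> 'v \<Rightarrow> 'v) \<Rightarrow> bool" where
  "bilinear_map scale B \<longleftrightarrow>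
     (\<forall>x. Vector_Spaces.linear scale scale (B x)) \<and>
     (\<forall>y. Vector_Spaces.linear scale scale (\<lambda>x. B x y))"

locale lie_algebra = vector_space scale
  for scale :: "'k::field \<Rightarrow> 'v::ab_group_add \<Rightarrow> 'v" +
  fixes br :: "'v \<Rightarrow> 'v \<Rightarrow> 'v"
  assumes bilinear: "bilinear_map scale br"
    and alternating: "br x x = 0"
    and jacobi: "br x (br y z) + br y (br z x) + br z (br x y) = 0"

definition bracket_span ::
  "('k::field \<Rightarrow> 'v::ab_group_add \<Rightarrow> 'v) \<Rightarrow> ('v \<Rightarrow> 'v \<Rightarrow> 'v) \<Rightarrow> 'v set \<Rightarrow> 'v set \<Rightarrow> 'v set" where
  "bracket_span scale br A B = module.span scale {br a b | a b. a \<in> A \<and> b \<in> B}"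

primrec derived_series ::
  "('k::field \<Rightarrow> 'v::ab_group_add \<Rightarrow> 'v) \<Rightarrow> ('v \<Rightarrow> 'v \<Rightarrow> 'v) \<Rightarrow> 'v set \<Rightarrow> nat \<Rightarrow> 'v set" where
  "derived_series scale br L 0 = L"
| "derived_series scale br L (Suc n) =
     bracket_span scale br (derived_series scale br L n) (derived_series scale br L n)"

primrec lower_central_series ::
  "('k::field \<Rightarrow> 'v::ab_group_add \<Rightarrow> 'v) \<Rightarrow> ('v \<Rightarrow> 'v \<Rightarrow> 'v) \<Rightarrow> 'v set \<Rightarrow> nat \<Rightarrow> 'v set" where
  "lower_central_series scale br L 0 = L"
| "lower_central_series scale br L (Suc n) =
     bracket_span scale br L (lower_central_series scale br L n)"

definition lie_solvable ::
  "('k::field \<Rightarrow> 'v::ab_group_add \<Rightarrow> 'v) \<Rightarrow> ('v \<Rightarrow> 'v \<Rightarrow> 'v) \<Rightarrow> 'v set \<Rightarrow> bool" where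
  "lie_solvable scale br L \<longleftrightarrow> (\<exists>n. derived_series scale br L n = {0})"

definition lie_nilpotent ::
  "('k::field \<Rightarrow> 'v::ab_group_add \<Rightarrow> 'v) \<Rightarrow> ('v \<Rightarrow> 'v \<Rightarrow> 'v) \<Rightarrow> 'v set \<Rightarrow> bool" where
  "lie_nilpotent scale br L \<longleftrightarrow> (\<exists>n. lower_central_series scale br L n = {0})"

definition lie_abelian :: "('v::ab_group_add \<Rightarrow> 'v \<Rightarrow> 'v) \<Rightarrow> 'v set \<Rightarrow> bool" where
  "lie_abelian br L \<longleftrightarrow> (\<forall>x\<in>L. \<forall>y\<in>L. br x y = 0)"

definition lie_subalgebra ::
  "('k::field \<Rightarrow> 'v::ab_group_add \<Rightarrow> 'v) \<Rightarrow> ('v \<Rightarrow> 'v \<Rightarrow> 'v) \<Rightarrow> 'v set \<Rightarrow> bool" where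
  "lie_subalgebra scale br L \<longleftrightarrow>
     module.subspace scale L \<and> (\<forall>x\<in>L. \<forall>y\<in>L. br x y \<in> L)"

definition lie_ideal ::
  "('k::field \<Rightarrow> 'v::ab_group_add \<Rightarrow> 'v) \<Rightarrow> ('v \<Rightarrow> 'v \<Rightarrow> 'v) \<Rightarrow> 'v set \<Rightarrow> bool" where
  "lie_ideal scale br I \<longleftrightarrow>
     module.subspace scale I \<and> (\<forall>x. \<forall>y\<in>I. br x y \<in> I)"

locale semisimple_lie_algebra = lie_algebra scale br
  for scale :: "'k::field \<Rightarrow> 'v::ab_group_add \<Rightarrow> 'v" and br +
  assumes solvable_ideal_trivial:
    "lie_ideal scale br I \<Longrightarrow> lie_solvable scale br I \<Longrightarrow> I = {0}"

definition cartan_subalgebra ::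
  "('k::field \<Rightarrow> 'v::ab_group_add \<Rightarrow> 'v) \<Rightarrow> ('v \<Rightarrow> 'v \<Rightarrow> 'v) \<Rightarrow> 'v set \<Rightarrow> 'v set \<Rightarrow> bool" where
  "cartan_subalgebra scale br L H \<longleftrightarrow>
     H \<subseteq> L \<and> lie_subalgebra scale br H \<and> lie_nilpotent scale br H \<and>
     {x \<in> L. \<forall>h\<in>H. br x h \<in> H} = H"

text \<open>
  Over an algebraically closed field of characteristic 0 every finite-dimensional Lie algebra has
  a Cartan subalgebra, and all of them are conjugate; so the choice does not affect the dimension.
\<close>

definition lie_rank ::
  "('k::field \<Rightarrow> 'v::ab_group_add \<Rightarrow> 'v) \<Rightarrow> ('v \<Rightarrow> 'v \<Rightarrow> 'v) \<Rightarrow> 'v set \<Rightarrow> nat" where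
  "lie_rank scale br L = vector_space.dim scale (SOME H. cartan_subalgebra scale br L H)"

text \<open>
  The coadjoint action is \<open>(x \<cdot> \<xi>) y = - \<xi> (br x y)\<close>, so \<open>x\<close> stabilises \<open>\<xi>\<close> iff \<open>\<xi> (br x y) = 0\<close>
  for all \<open>y\<close>.
\<close>

definition coadjoint_stabiliser ::
  "('v::ab_group_add \<Rightarrow> 'v \<Rightarrow> 'v) \<Rightarrow> ('v \<Rightarrow> 'k::field) \<Rightarrow> 'v set" where
  "coadjoint_stabiliser br \<xi> = {x. \<forall>y. \<xi> (br x y) = 0}"

definition lie_index ::
  "('k::field \<Rightarrow> 'v::ab_group_add \<Rightarrow> 'v) \<Rightarrow> ('v \<Rightarrow> 'v \<Rightarrow> 'v) \<Rightarrow> nat" where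
  "lie_index scale br =
     (LEAST d. \<exists>\<xi>. Vector_Spaces.linear scale (*) \<xi> \<and>
                   d = vector_space.dim scale (coadjoint_stabiliser br \<xi>))"


section \<open>The periodic contraction\<close>

definition lie_automorphism ::
  "('k::field \<Rightarrow> 'v::ab_group_add \<Rightarrow> 'v) \<Rightarrow> ('v \<Rightarrow> 'v \<Rightarrow> 'v) \<Rightarrow> ('v \<Rightarrow> 'v) \<Rightarrow> bool" where
  "lie_automorphism scale br \<theta> \<longleftrightarrow>
     Vector_Spaces.linear scale scale \<theta> \<and> bij \<theta> \<and> (\<forall>x y. \<theta> (br x y) = br (\<theta> x) (\<theta> y))"

definition has_order :: "('v \<Rightarrow> 'v) \<Rightarrow> nat \<Rightarrow> bool" where
  "has_order \<theta> m \<longleftrightarrow> 0 < m \<and> \<theta> ^^ m = id \<and> (\<forall>k. 0 < k \<and> k < m \<longrightarrow> \<theta> ^^ k \<noteq> id)"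

definition primitive_root_of_unity :: "nat \<Rightarrow> 'k::field \<Rightarrow> bool" where
  "primitive_root_of_unity m \<zeta> \<longleftrightarrow> 0 < m \<and> \<zeta> ^ m = 1 \<and> (\<forall>k. 0 < k \<and> k < m \<longrightarrow> \<zeta> ^ k \<noteq> 1)"

definition graded_part ::
  "('k::field \<Rightarrow> 'v::ab_group_add \<Rightarrow> 'v) \<Rightarrow> ('v \<Rightarrow> 'v) \<Rightarrow> 'k \<Rightarrow> nat \<Rightarrow> 'v set" where
  "graded_part scale \<theta> \<zeta> j = {x. \<theta> x = scale (\<zeta> ^ j) x}"

text \<open>
  \<open>is_truncated_bracket scale br \<theta> \<zeta> m P B\<close>: the bilinear map \<open>B\<close> agrees with \<open>br\<close> on the graded
  parts \<open>i\<close> and \<open>j\<close> if \<open>P (i + j)\<close> holds, and vanishes on them otherwise.  Here \<open>i\<close> and \<open>j\<close> are the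
  representatives below \<open>m\<close>, and \<open>i + j\<close> is not reduced modulo \<open>m\<close>.
\<close>

definition is_truncated_bracket ::
  "('k::field \<Rightarrow> 'v::ab_group_add \<Rightarrow> 'v) \<Rightarrow> ('v \<Rightarrow> 'v \<Rightarrow> 'v) \<Rightarrow> ('v \<Rightarrow> 'v) \<Rightarrow> 'k \<Rightarrow> nat
    \<Rightarrow> (nat \<Rightarrow> bool) \<Rightarrow> ('v \<Rightarrow> 'v \<Rightarrow> 'v) \<Rightarrow> bool" where
  "is_truncated_bracket scale br \<theta> \<zeta> m P B \<longleftrightarrow>
     bilinear_map scale B \<and>
     (\<forall>i<m. \<forall>j<m. \<forall>x\<in>graded_part scale \<theta> \<zeta> i. \<forall>y\<in>graded_part scale \<theta> \<zeta> j.
        B x y = (if P (i + j) then br x y else 0))"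

definition bracket_zero ::
  "('k::field \<Rightarrow> 'v::ab_group_add \<Rightarrow> 'v) \<Rightarrow> ('v \<Rightarrow> 'v \<Rightarrow> 'v) \<Rightarrow> ('v \<Rightarrow> 'v) \<Rightarrow> 'k \<Rightarrow> nat
    \<Rightarrow> 'v \<Rightarrow> 'v \<Rightarrow> 'v" where
  "bracket_zero scale br \<theta> \<zeta> m = (THE B. is_truncated_bracket scale br \<theta> \<zeta> m (\<lambda>s. s < m) B)"

definition bracket_infty ::
  "('k::field \<Rightarrow> 'v::ab_group_add \<Rightarrow> 'v) \<Rightarrow> ('v \<Rightarrow> 'v \<Rightarrow> 'v) \<Rightarrow> ('v \<Rightarrow> 'v) \<Rightarrow> 'k \<Rightarrow> nat
    \<Rightarrow> 'v \<Rightarrow> 'v \<Rightarrow> 'v" where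
  "bracket_infty scale br \<theta> \<zeta> m = (THE B. is_truncated_bracket scale br \<theta> \<zeta> m (\<lambda>s. s \<ge> m) B)"

datatype 'k projective_line = Finite 'k | Infty

primrec bracket_at ::
  "('k::field \<Rightarrow> 'v::ab_group_add \<Rightarrow> 'v) \<Rightarrow> ('v \<Rightarrow> 'v \<Rightarrow> 'v) \<Rightarrow> ('v \<Rightarrow> 'v) \<Rightarrow> 'k \<Rightarrow> nat
    \<Rightarrow> 'k projective_line \<Rightarrow> 'v \<Rightarrow> 'v \<Rightarrow> 'v" where
  "bracket_at scale br \<theta> \<zeta> m (Finite t) =
     (\<lambda>x y. bracket_zero scale br \<theta> \<zeta> m x y + scale t (bracket_infty scale br \<theta> \<zeta> m x y))"
| "bracket_at scale br \<theta> \<zeta> m Infty = bracket_infty scale br \<theta> \<zeta> m"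

definition P_reg ::
  "('k::field \<Rightarrow> 'v::ab_group_add \<Rightarrow> 'v) \<Rightarrow> ('v \<Rightarrow> 'v \<Rightarrow> 'v) \<Rightarrow> ('v \<Rightarrow> 'v) \<Rightarrow> 'k \<Rightarrow> nat
    \<Rightarrow> 'k projective_line set" where
  "P_reg scale br \<theta> \<zeta> m =
     {t. lie_index scale (bracket_at scale br \<theta> \<zeta> m t) = lie_index scale br}"


section \<open>The truncated brackets are well defined\<close>

context lie_algebra
begin

context
  fixes \<theta> :: "'v \<Rightarrow> 'v" and \<zeta> :: 'k and m :: nat
  assumes char: "(of_nat m :: 'k) \<noteq> 0"
    and lin: "Vector_Spaces.linear scale scale \<theta>"
    and period: "\<theta> ^^ m = id"
    and root: "primitive_root_of_unity m \<zeta>"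
begin

definition proj :: "nat \<Rightarrow> 'v \<Rightarrow> 'v" where
  "proj j x = scale (1 / of_nat m) (\<Sum>k<m. scale (inverse \<zeta> ^ (j * k)) ((\<theta> ^^ k) x))"

lemma m_pos: "0 < m" and zeta_m: "\<zeta> ^ m = 1" and zeta_nz: "\<zeta> \<noteq> 0"
  using root by (auto simp: primitive_root_of_unity_def power_0_left)

lemma zeta_inj:
  assumes "i < m" "j < m" "\<zeta> ^ i = \<zeta> ^ j"
  shows "i = j"
proof -
  have *: "i = j" if "i \<le> j" "j < m" "\<zeta> ^ i = \<zeta> ^ j" for i j
  proof -
    have "\<zeta> ^ j = \<zeta> ^ i * \<zeta> ^ (j - i)"
      using that(1) by (metis le_add_diff_inverse power_add)
    hence "\<zeta> ^ (j - i) = 1"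
      using that zeta_nz by simp
    thus ?thesis
      using that root unfolding primitive_root_of_unity_def
      by (metis diff_is_0_eq le_antisym less_imp_diff_less neq0_conv)
  qed
  show ?thesis
  proof (cases "i \<le> j")
    case True
    show ?thesis by (rule *[OF True assms(2,3)])
  next
    case False
    hence "j \<le> i" by simp
    from *[OF this assms(1) assms(3)[symmetric]] show ?thesis by simp
  qed
qed

lemma geometric_zero:
  assumes "w \<noteq> 1" "w ^ m = (1::'k)"
  shows "(\<Sum>k<m. w ^ k) = 0"
  using geometric_sum[of w m] assms by simp

lemma lin_pow: "Vector_Spaces.linear scale scale (\<theta> ^^ k)"
proof (induction k)
  case 0
  show ?case by (simp add: linear_id[unfolded id_def] id_def)
next
  case (Suc k)
  thus ?case
    using Vector_Spaces.linear_compose[OF Suc lin] by (simp add: o_def)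
qed

lemma lin_proj: "Vector_Spaces.linear scale scale (proj j)"
proof -
  interpret vector_space_pair scale scale ..
  show ?thesis
    unfolding proj_def
    by (intro linear_compose_scale_right linear_compose_sum ballI lin_pow[unfolded id_def])
qed

lemma proj_in: "proj j x \<in> graded_part scale \<theta> \<zeta> j"
proof -
  interpret L: Vector_Spaces.linear scale scale \<theta> by (rule lin)
  define f where "f k = scale (inverse \<zeta> ^ (j * k)) ((\<theta> ^^ k) x)" for k
  have "inverse \<zeta> ^ (j * m) = inverse ((\<zeta> ^ m) ^ j)"
    by (metis mult.commute power_inverse power_mult)
  hence fm: "f m = f 0"
    by (simp add: f_def period zeta_m)
  have "(\<Sum>k<m. f (Suc k)) + f 0 = (\<Sum>k<m. f k) + f m"
    by (metis sum.lessThan_Suc sum.lessThan_Suc_shift add.commute)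
  hence shift: "(\<Sum>k<m. f (Suc k)) = (\<Sum>k<m. f k)"
    by (simp add: fm)
  have step: "\<theta> (f k) = scale (\<zeta> ^ j) (f (Suc k))" for k
  proof -
    have "\<zeta> ^ j * inverse \<zeta> ^ (j * Suc k) = inverse \<zeta> ^ (j * k)"
      using zeta_nz by (simp add: power_add field_simps)
    thus ?thesis by (simp add: f_def L.scale)
  qed
  have "\<theta> (proj j x) = scale (1 / of_nat m) (\<Sum>k<m. scale (\<zeta> ^ j) (f (Suc k)))"
    unfolding proj_def f_def[symmetric] by (simp add: L.scale L.sum step)
  also have "\<dots> = scale (\<zeta> ^ j) (proj j x)"
    unfolding proj_def f_def[symmetric] scale_sum_right[symmetric] shift
    by (simp add: scale_left_commute)
  finally show ?thesis by (simp add: graded_part_def)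
qed

lemma sum_proj: "(\<Sum>j<m. proj j x) = x"
proof -
  have coef: "(\<Sum>j<m. inverse \<zeta> ^ (j * k)) = (if k = 0 then of_nat m else 0)" if "k < m" for k
  proof (cases "k = 0")
    case False
    hence "inverse \<zeta> ^ k \<noteq> 1"
      using that root unfolding primitive_root_of_unity_def
      by (simp add: power_inverse)
    moreover have "(inverse \<zeta> ^ k) ^ m = 1"
    proof -
      have "(inverse \<zeta> ^ k) ^ m = inverse ((\<zeta> ^ m) ^ k)"
        by (metis mult.commute power_inverse power_mult)
      thus ?thesis by (simp add: zeta_m)
    qed
    ultimately have "(\<Sum>j<m. (inverse \<zeta> ^ k) ^ j) = 0"
      by (rule geometric_zero)
    thus ?thesis
      using False by (simp only: power_mult[symmetric] mult.commute[of k] if_False)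
  qed simp
  have "(\<Sum>j<m. proj j x)
      = scale (1 / of_nat m) (\<Sum>k<m. scale (\<Sum>j<m. inverse \<zeta> ^ (j * k)) ((\<theta> ^^ k) x))"
    unfolding proj_def scale_sum_right[symmetric] scale_sum_left
    by (subst sum.swap) simp
  also have "(\<Sum>k<m. scale (\<Sum>j<m. inverse \<zeta> ^ (j * k)) ((\<theta> ^^ k) x))
      = (\<Sum>k<m. if k = 0 then scale (of_nat m) x else 0)"
    by (intro sum.cong refl) (auto simp: coef)
  also have "\<dots> = scale (of_nat m) x"
    using m_pos by simp
  finally show ?thesis
    using char by simp
qed

lemma proj_graded:
  assumes "x \<in> graded_part scale \<theta> \<zeta> i" "i < m" "j < m"
  shows "proj j x = (if i = j then x else 0)"
proof -
  interpret L: Vector_Spaces.linear scale scale \<theta> by (rule lin)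
  have pow: "(\<theta> ^^ k) x = scale (\<zeta> ^ (i * k)) x" for k
  proof (induction k)
    case (Suc k)
    have "\<theta> x = scale (\<zeta> ^ i) x"
      using assms(1) by (simp add: graded_part_def)
    thus ?case
      by (simp add: Suc L.scale power_add mult.commute[of "\<zeta> ^ i"])
  qed simp
  define w where "w = inverse \<zeta> ^ j * \<zeta> ^ i"
  have "inverse \<zeta> ^ (j * k) * \<zeta> ^ (i * k) = w ^ k" for k
    by (simp add: w_def power_mult power_mult_distrib)
  hence *: "proj j x = scale (1 / of_nat m) (scale (\<Sum>k<m. w ^ k) x)"
    by (simp add: proj_def pow scale_sum_left)
  show ?thesis
  proof (cases "i = j")
    case True
    hence "w = 1"
      using zeta_nz by (simp add: w_def power_inverse)
    thus ?thesis using * True char by simp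
  next
    case False
    hence "w \<noteq> 1"
      using zeta_inj[OF assms(2,3)] zeta_nz by (auto simp: w_def field_simps)
    moreover have "w ^ m = 1"
    proof -
      have "(inverse \<zeta> ^ j) ^ m = inverse ((\<zeta> ^ m) ^ j)" "(\<zeta> ^ i) ^ m = (\<zeta> ^ m) ^ i"
        by (metis mult.commute power_inverse power_mult)+
      thus ?thesis by (simp add: w_def power_mult_distrib zeta_m)
    qed
    ultimately show ?thesis
      using * False geometric_zero by simp
  qed
qed

lemma truncated_bracket_unique:
  assumes "is_truncated_bracket scale br \<theta> \<zeta> m P B" "is_truncated_bracket scale br \<theta> \<zeta> m P B'"
  shows "B = B'"
proof (intro ext)
  fix x y
  have expand: "C x y = (\<Sum>i<m. \<Sum>j<m. if P (i + j) then br (proj i x) (proj j y) else 0)"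
    if C: "is_truncated_bracket scale br \<theta> \<zeta> m P C" for C
  proof -
    have r: "Vector_Spaces.linear scale scale (C u)"
      and l: "Vector_Spaces.linear scale scale (\<lambda>u. C u v)" for u v
      using C by (auto simp: is_truncated_bracket_def bilinear_map_def)
    interpret vector_space_pair scale scale ..
    have "C x y = C (\<Sum>i<m. proj i x) (\<Sum>j<m. proj j y)"
      by (simp add: sum_proj)
    also have "\<dots> = (\<Sum>i<m. C (proj i x) (\<Sum>j<m. proj j y))"
      using linear_sum[OF l] .
    also have "\<dots> = (\<Sum>i<m. \<Sum>j<m. C (proj i x) (proj j y))"
      by (simp add: linear_sum[OF r])
    also have "\<dots> = (\<Sum>i<m. \<Sum>j<m. if P (i + j) then br (proj i x) (proj j y) else 0)"
      using C proj_in by (auto simp: is_truncated_bracket_def intro!: sum.cong)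
    finally show ?thesis .
  qed
  show "B x y = B' x y"
    by (simp only: expand[OF assms(1)] expand[OF assms(2)])
qed

lemma truncated_bracket_exists: "\<exists>B. is_truncated_bracket scale br \<theta> \<zeta> m P B"
proof -
  interpret vector_space_pair scale scale ..
  define B where
    "B x y = (\<Sum>i<m. \<Sum>j<m. if P (i + j) then br (proj i x) (proj j y) else 0)" for x y
  have br_r: "Vector_Spaces.linear scale scale (br u)"
    and br_l: "Vector_Spaces.linear scale scale (\<lambda>u. br u v)" for u v
    using bilinear by (auto simp: bilinear_map_def)
  have r: "Vector_Spaces.linear scale scale (\<lambda>y. br u (proj j y))"
    and l: "Vector_Spaces.linear scale scale (\<lambda>x. br (proj j x) v)" for u v j
    using Vector_Spaces.linear_compose[OF lin_proj br_r]
      Vector_Spaces.linear_compose[OF lin_proj br_l] by (auto simp: o_def)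
  have if_lin: "Vector_Spaces.linear scale scale (\<lambda>x. if b then f x else 0)"
    if "Vector_Spaces.linear scale scale f" for b and f :: "'v \<Rightarrow> 'v"
    using that by (cases b) (simp_all add: linear_zero)
  have "bilinear_map scale B"
    unfolding bilinear_map_def B_def
    by (intro conjI allI linear_compose_sum ballI if_lin l r)
  moreover have "B x y = (if P (i + j) then br x y else 0)"
    if ij: "i < m" "j < m" and x: "x \<in> graded_part scale \<theta> \<zeta> i"
      and y: "y \<in> graded_part scale \<theta> \<zeta> j" for i j x y
  proof -
    have z: "br 0 v = 0" "br u 0 = 0" for u v
      using linear_0[OF br_r[of u]] linear_0[OF br_l[of v]] by auto
    have "B x y = (\<Sum>i'<m. \<Sum>j'<m.
        if j' = j then (if i' = i then (if P (i + j) then br x y else 0) else 0) else 0)"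
      unfolding B_def
      by (intro sum.cong refl) (use ij proj_graded[OF x] proj_graded[OF y] z in auto)
    also have "\<dots> = (if P (i + j) then br x y else 0)"
      using ij by simp
    finally show ?thesis .
  qed
  ultimately show ?thesis
    unfolding is_truncated_bracket_def by blast
qed

lemma truncated_bracket_ex1: "\<exists>!B. is_truncated_bracket scale br \<theta> \<zeta> m P B"
  using truncated_bracket_exists truncated_bracket_unique by (rule ex_ex1I)

lemma bracket_zero_is_truncated:
    "is_truncated_bracket scale br \<theta> \<zeta> m (\<lambda>s. s < m) (bracket_zero scale br \<theta> \<zeta> m)"
  and bracket_infty_is_truncated:
    "is_truncated_bracket scale br \<theta> \<zeta> m (\<lambda>s. s \<ge> m) (bracket_infty scale br \<theta> \<zeta> m)"
  unfolding bracket_zero_def bracket_infty_def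
  by (rule theI'[OF truncated_bracket_ex1])+

lemma bracket_at_1: "bracket_at scale br \<theta> \<zeta> m (Finite 1) = br"
proof -
  interpret vector_space_pair scale scale ..
  have "is_truncated_bracket scale br \<theta> \<zeta> m (\<lambda>_. True) br"
    using bilinear by (simp add: is_truncated_bracket_def)
  moreover have
    "is_truncated_bracket scale br \<theta> \<zeta> m (\<lambda>_. True) (bracket_at scale br \<theta> \<zeta> m (Finite 1))"
    using bracket_zero_is_truncated bracket_infty_is_truncated
    by (auto simp: is_truncated_bracket_def bilinear_map_def intro: linear_compose_add)
  ultimately show ?thesis
    by (rule truncated_bracket_unique[OF _ _, symmetric])
qed

end

end

end

theory Submission
  imports Defs "HOL-Computational_Algebra.Formal_Power_Series"
begin

text \<open>
  Let \<open>\<gg>\<^sub>j\<close> be the graded parts and \<open>\<kappa>\<close> the Killing form.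

  Rescaling \<open>\<gg>\<^sub>j\<close> by \<open>a\<^sup>j\<close> turns the given bracket into \<open>[,]\<^sub>0 + a\<^sup>-\<^sup>m [,]\<^sub>\<infinity>\<close>, so up to a scalar every
  member \<open>[,]\<^sub>\<infinity> + c [,]\<^sub>0\<close> with \<open>c \<noteq> 0\<close> is a copy of \<open>\<gg>\<close>.  For a linear functional \<open>\<xi>\<close> the forms
  \<open>\<xi> \<circ> [,]\<^sub>\<infinity> + c (\<xi> \<circ> [,]\<^sub>0)\<close> are therefore a pencil whose kernel has dimension at least the index of
  \<open>\<gg>\<close> if \<open>c \<noteq> 0\<close>, while its kernel at \<open>c = 0\<close> is the stabiliser of \<open>\<xi>\<close> in the contraction.  For almost
  all \<open>c\<close> the kernel is not larger than at \<open>c = 0\<close>, so the index of the contraction is at least that of \<open>\<gg>\<close>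
  (\<open>index_le_index_infty\<close>).  It is strictly smaller for almost all \<open>c\<close> if the direction \<open>\<xi> \<circ> [,]\<^sub>0\<close> is not
  zero on the kernel at \<open>c = 0\<close>.  Since \<open>\<gg>\<^sub>0\<close> is central in the contraction, it lies in that kernel; if
  it is not abelian, some \<open>\<xi>\<close> with a stabiliser of minimal dimension has \<open>\<xi> [x, y] \<noteq> 0\<close> for two of its
  elements, and the two indices differ (\<open>index_less_if_nonabelian\<close>).

  Suppose that \<open>\<gg>\<^sub>0\<close> is abelian.  By Cartan's criterion (\<open>killing_nondegenerate\<close>) \<open>\<kappa>\<close> is nondegenerate.  Then
  it is so on \<open>\<gg>\<^sub>0\<close>, and all derivations are inner.  Hence the nilpotent part of an element of \<open>\<gg>\<^sub>0\<close> lies in \<open>\<gg>\<^sub>0\<close>, is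
  orthogonal to it and vanishes: \<open>\<gg>\<^sub>0\<close> acts semisimply (\<open>part_0_semisimple\<close>).  Choose \<open>z \<in> \<gg>\<^sub>0\<close> whose
  centralizer \<open>L\<close> has the smallest possible dimension.  Then all of \<open>\<gg>\<^sub>0\<close> centralizes \<open>L\<close>
  (\<open>minimal_engel_subalgebra\<close>), so \<open>L\<close> is a graded algebra with central degree zero part.  Such an
  algebra is solvable (\<open>kreknin\<close>), and as \<open>\<kappa>\<close> is nondegenerate on \<open>L\<close>, it is even abelian
  (\<open>solvable_nondegenerate_abelian\<close>).  A semisimple element with abelian centralizer has a centralizer
  of minimal dimension (\<open>abelian_centralizer_minimal\<close>), so \<open>dim L\<close> is the index of \<open>\<gg>\<close>.  The stabiliser
  of \<open>\<kappa> z\<close> in the contraction is contained in \<open>L\<close>, so the index of the contraction is at most \<open>dim L\<close>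
  (\<open>index_infty_le_if_abelian\<close>).

  For the rank: a Cartan subalgebra of \<open>\<gg>\<^sub>0\<close> exists (\<open>cartan_subalgebra_exists\<close>).  If the rank is \<open>dim \<gg>\<^sub>0\<close>,
  it is \<open>\<gg>\<^sub>0\<close> itself, which is then nilpotent and, by nondegeneracy of \<open>\<kappa>\<close>, abelian.
\<close>

section \<open>Rational functionals and linear equations\<close>

text \<open>
  A Hamel basis over the rationals that contains \<open>e\<close> gives the coordinate at \<open>e\<close>.
\<close>

lemma rational_functional_exists:
  fixes e :: "'k::field_char_0"
  assumes "e \<noteq> 0"
  shows "\<exists>\<psi> :: 'k \<Rightarrow> rat. (\<forall>x y. \<psi> (x + y) = \<psi> x + \<psi> y) \<and> (\<forall>q x. \<psi> (of_rat q * x) = q * \<psi> x) \<and> \<psi> e = 1"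
proof -
  interpret Q: vector_space "\<lambda>(q::rat) (x::'k). of_rat q * x"
    by unfold_locales (simp_all add: of_rat_add of_rat_mult algebra_simps)
  have ind: "Q.independent {e}" using assms by simp
  define B where "B = Q.extend_basis {e}"
  have B: "Q.independent B" "e \<in> B" "Q.span B = UNIV"
    unfolding B_def using Q.independent_extend_basis[OF ind] Q.extend_basis_superset[OF ind]
      Q.span_extend_basis[OF ind] by auto
  show ?thesis
    by (rule exI[of _ "\<lambda>x. Q.representation B x e"])
      (use B in \<open>simp_all add: Q.representation_add Q.representation_scale Q.representation_basis\<close>)
qed

text \<open>Fraction-free Gaussian elimination, so that it also applies to power series.\<close>

lemma homogeneous_solution:
  fixes M :: "'a \<Rightarrow> 'b \<Rightarrow> 'r::idom"
  assumes "finite I" "finite J" "card I < card J"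
  shows "\<exists>a. (\<exists>j\<in>J. a j \<noteq> 0) \<and> (\<forall>i\<in>I. (\<Sum>j\<in>J. M i j * a j) = 0)"
  using assms
proof (induction I arbitrary: J M rule: finite_induct)
  case empty
  then obtain j where "j \<in> J" by fastforce
  thus ?case by (intro exI[of _ "\<lambda>_. 1"]) auto
next
  case (insert i0 I)
  show ?case
  proof (cases "\<forall>j\<in>J. M i0 j = 0")
    case True
    have "card I < card J" using insert by simp
    from insert.IH[OF insert.prems(1) this, of M] True show ?thesis by auto
  next
    case False
    then obtain j0 where j0: "j0 \<in> J" "M i0 j0 \<noteq> 0" by blast
    define J' where "J' = J - {j0}"
    have J': "finite J'" "card I < card J'" "J = insert j0 J'" "j0 \<notin> J'"
      using insert j0 by (auto simp: J'_def)
    define M' where "M' i j = M i0 j0 * M i j - M i j0 * M i0 j" for i j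
    obtain a where a: "\<exists>j\<in>J'. a j \<noteq> 0" "\<forall>i\<in>I. (\<Sum>j\<in>J'. M' i j * a j) = 0"
      using insert.IH[OF J'(1,2), of M'] by blast
    define b where "b j = (if j = j0 then - (\<Sum>j\<in>J'. M i0 j * a j) else M i0 j0 * a j)" for j
    have sum_b: "(\<Sum>j\<in>J. M i j * b j)
        = (\<Sum>j\<in>J'. M i j * (M i0 j0 * a j)) - M i j0 * (\<Sum>j\<in>J'. M i0 j * a j)" for i
    proof -
      have "(\<Sum>j\<in>J'. M i j * b j) = (\<Sum>j\<in>J'. M i j * (M i0 j0 * a j))"
        using J'(4) by (intro sum.cong) (auto simp: b_def)
      thus ?thesis unfolding J'(3) using J'(1,4) by (simp add: b_def)
    qed
    have "(\<Sum>j\<in>J. M i j * b j) = 0" if "i \<in> I" for i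
    proof -
      have "(\<Sum>j\<in>J. M i j * b j) = (\<Sum>j\<in>J'. M' i j * a j)"
        unfolding sum_b M'_def
        by (simp add: sum_distrib_left sum_subtractf[symmetric] algebra_simps)
      thus ?thesis using a(2) that by simp
    qed
    moreover have "(\<Sum>j\<in>J. M i0 j * b j) = 0"
      unfolding sum_b by (simp add: sum_distrib_left algebra_simps)
    moreover have "\<exists>j\<in>J. b j \<noteq> 0"
      using a(1) j0 J'(3,4) by (auto simp: b_def)
    ultimately show ?thesis by auto
  qed
qed

lemma triangle_swap:
  fixes h :: "nat \<Rightarrow> nat \<Rightarrow> 'z::comm_monoid_add"
  shows "(\<Sum>a=0..n. \<Sum>b=0..n - a. h a b) = (\<Sum>b=0..n. \<Sum>a=0..n - b. h a b)"
proof -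
  have "(\<Sum>a=0..n. \<Sum>b=0..n - a. h a b) = (\<Sum>a\<in>{0..n}. \<Sum>b\<in>{b \<in> {0..n}. a + b \<le> n}. h a b)"
    by (intro sum.cong refl) auto
  also have "\<dots> = (\<Sum>b\<in>{0..n}. \<Sum>a\<in>{a \<in> {0..n}. a + b \<le> n}. h a b)"
    by (rule sum.swap_restrict) auto
  also have "\<dots> = (\<Sum>b=0..n. \<Sum>a=0..n - b. h a b)"
    by (intro sum.cong refl) auto
  finally show ?thesis .
qed

section \<open>Linear maps on a finite-dimensional space\<close>

locale alg_closed_space = finite_dimensional_vector_space scale Basis
  for scale :: "'k::{alg_closed_field, field_char_0} \<Rightarrow> 'v::ab_group_add \<Rightarrow> 'v"
    and Basis :: "'v set"
begin

abbreviation lin :: "('v \<Rightarrow> 'v) \<Rightarrow> bool" where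
  "lin \<equiv> Vector_Spaces.linear scale scale"

sublocale vp: vector_space_pair scale scale ..

sublocale fvp: finite_dimensional_vector_space_pair_1 scale Basis scale ..

lemma lin_iff:
  "lin f \<longleftrightarrow> (\<forall>x y. f (x + y) = f x + f y) \<and> (\<forall>c x. f (scale c x) = scale c (f x))"
  using vector_space_axioms by (auto simp: Vector_Spaces.linear_iff)

lemma linI:
  assumes "\<And>x y. f (x + y) = f x + f y" "\<And>c x. f (scale c x) = scale c (f x)"
  shows "lin f"
  using assms by (simp add: lin_iff)

lemma lin_add: "lin f \<Longrightarrow> f (x + y) = f x + f y"
  and lin_scale: "lin f \<Longrightarrow> f (scale c x) = scale c (f x)"
  by (simp_all add: lin_iff)

lemmas lin_0 = vp.linear_0 and lin_diff = vp.linear_diff and lin_neg = vp.linear_neg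
  and lin_sum = vp.linear_sum

lemma lin_id: "lin (\<lambda>x. x)"
  by (rule linI) auto

lemma lin_comp: "lin f \<Longrightarrow> lin g \<Longrightarrow> lin (\<lambda>x. f (g x))"
  by (simp add: lin_iff)

lemma lin_plus: "lin f \<Longrightarrow> lin g \<Longrightarrow> lin (\<lambda>x. f x + g x)"
  by (simp add: lin_iff algebra_simps)

lemma lin_minus: "lin f \<Longrightarrow> lin g \<Longrightarrow> lin (\<lambda>x. f x - g x)"
  by (simp add: lin_iff algebra_simps)

lemma lin_smult: "lin f \<Longrightarrow> lin (\<lambda>x. scale c (f x))"
  by (simp add: lin_iff algebra_simps)

lemma lin_homothety: "lin (\<lambda>x. scale c x)"
  by (simp add: lin_iff algebra_simps)

lemma lin_zero: "lin (\<lambda>x. 0)"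
  by (simp add: lin_iff)

lemma lin_funpow: "lin f \<Longrightarrow> lin (f ^^ n)"
  by (induction n) (simp_all add: lin_iff)

lemma lin_setsum: "(\<And>i. i \<in> I \<Longrightarrow> lin (f i)) \<Longrightarrow> lin (\<lambda>x. \<Sum>i\<in>I. f i x)"
  by (induction I rule: infinite_finite_induct) (auto intro: lin_plus lin_zero)

lemmas lin_intros = lin_id lin_plus lin_minus lin_smult lin_homothety lin_zero lin_funpow
  lin_setsum

abbreviation functional :: "('v \<Rightarrow> 'k) \<Rightarrow> bool" where
  "functional \<equiv> Vector_Spaces.linear scale (*)"

lemma linear_functional_iff:
  "functional \<xi> \<longleftrightarrow> (\<forall>x y. \<xi> (x + y) = \<xi> x + \<xi> y) \<and> (\<forall>c x. \<xi> (scale c x) = c * \<xi> x)"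
proof -
  have "vector_space ((*) :: 'k \<Rightarrow> 'k \<Rightarrow> 'k)" by unfold_locales (simp_all add: algebra_simps)
  thus ?thesis using vector_space_axioms by (auto simp: Vector_Spaces.linear_iff)
qed

lemma coord_lin: "functional (\<lambda>v. representation Basis v b)"
  by (rule linear_representation) (use independent_Basis span_Basis in auto)

lemma coord_add: "representation Basis (x + y) b = representation Basis x b + representation Basis y b"
  and coord_scale: "representation Basis (scale c x) b = c * representation Basis x b"
  using independent_Basis span_Basis
  by (simp_all add: representation_add representation_scale)

lemma coord_sum_eq: "(\<Sum>b\<in>Basis. scale (representation Basis v b) b) = v"
  by (rule sum_representation_eq) (use independent_Basis span_Basis finite_Basis in auto)

lemma coord_inject: "(\<And>b. b \<in> Basis \<Longrightarrow> representation Basis v b = representation Basis w b) \<Longrightarrow> v = w"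
  by (metis (no_types, lifting) coord_sum_eq sum.cong)

lemma coord_setsum: "representation Basis (\<Sum>i\<in>I. f i) b = (\<Sum>i\<in>I. representation Basis (f i) b)"
  using independent_Basis span_Basis by (simp add: representation_sum)

lemma coord_combination:
  assumes "c \<in> Basis" shows "representation Basis (\<Sum>b\<in>Basis. scale (a b) b) c = a c"
proof -
  have "representation Basis (\<Sum>b\<in>Basis. scale (a b) b) c
      = (\<Sum>b\<in>Basis. a b * representation Basis b c)"
    by (simp add: coord_setsum coord_scale)
  also have "\<dots> = (\<Sum>b\<in>Basis. if b = c then a c else 0)"
    by (intro sum.cong) (auto simp: representation_basis independent_Basis)
  finally show ?thesis using assms finite_Basis by simp
qed

lemma functional_expand:
  assumes \<xi>: "functional \<xi>"
  shows "\<xi> v = (\<Sum>b\<in>Basis. representation Basis v b * \<xi> b)"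
proof -
  interpret M: Vector_Spaces.linear scale "(*)" \<xi> by (rule \<xi>)
  have "\<xi> (\<Sum>b\<in>Basis. scale (representation Basis v b) b) = (\<Sum>b\<in>Basis. representation Basis v b * \<xi> b)"
    by (simp add: M.sum M.scale)
  thus ?thesis by (simp add: coord_sum_eq)
qed

lemma projection_exists:
  assumes "subspace W"
  obtains p where "lin p" "\<And>v. p v \<in> W" "\<And>w. w \<in> W \<Longrightarrow> p w = w"
  using vp.linear_exists_left_inverse_on[OF lin_id assms] by fastforce

text \<open>
  The hypothesis says that \<open>A\<close> maps \<open>U\<close> injectively onto a complement of \<open>W\<close> in \<open>A U + W\<close>.
\<close>

lemma left_inverse_exists:
  assumes A: "lin A" and U: "subspace U" and W: "subspace W"
    and inj: "\<forall>u\<in>U. A u \<in> W \<longrightarrow> u = 0"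
  shows "\<exists>T. lin T \<and> (\<forall>v. T v \<in> U) \<and> (\<forall>u\<in>U. T (A u) = u) \<and> (\<forall>w\<in>W. T w = 0)"
proof -
  obtain p where p: "lin p" "\<And>v. p v \<in> W" "\<And>w. w \<in> W \<Longrightarrow> p w = w"
    using projection_exists[OF W] by blast
  define q where "q = (\<lambda>v. A v - p (A v))"
  have q: "lin q" unfolding q_def by (intro lin_intros A lin_comp[OF p(1) A])
  have "inj_on q U"
  proof (rule inj_onI)
    fix x y assume xy: "x \<in> U" "y \<in> U" "q x = q y"
    have "A (x - y) - p (A (x - y)) = 0"
      using xy(3) A p(1) by (simp add: q_def lin_diff algebra_simps)
    hence "A (x - y) \<in> W" using p(2) by (metis eq_iff_diff_eq_0)
    hence "x - y = 0" using inj subspace_diff[OF U xy(1,2)] by blast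
    thus "x = y" by simp
  qed
  from vp.linear_exists_left_inverse_on[OF q U this]
  obtain g where g: "range g \<subseteq> U" "lin g" "\<And>v. v \<in> U \<Longrightarrow> g (q v) = v" by blast
  show ?thesis
  proof (intro exI[of _ "\<lambda>v. g (v - p v)"] conjI ballI allI)
    show "lin (\<lambda>v. g (v - p v))"
      by (rule lin_comp[OF g(2)]) (intro lin_intros p(1))
  qed (use g p lin_0[OF g(2)] in \<open>auto simp: q_def\<close>)
qed

lemma complement_exists:
  assumes W: "subspace W" and S: "subspace S" and "W \<subseteq> S"
  shows "\<exists>U. subspace U \<and> U \<subseteq> S \<and> U \<inter> W = {0} \<and> (\<forall>s\<in>S. \<exists>u\<in>U. \<exists>w\<in>W. s = u + w) \<and>
    dim U + dim W = dim S"
proof -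
  obtain p where p: "lin p" "\<And>v. p v \<in> W" "\<And>w. w \<in> W \<Longrightarrow> p w = w"
    using projection_exists[OF W] by blast
  define U where "U = {s \<in> S. p s = 0}"
  have U: "subspace U"
    unfolding U_def subspace_def using p(1) S
    by (auto simp: lin_0 lin_add lin_scale subspace_0 subspace_add subspace_scale)
  have int: "U \<inter> W = {0}" using p subspace_0[OF W] subspace_0[OF U] by (auto simp: U_def)
  have dec: "\<exists>u\<in>U. \<exists>w\<in>W. s = u + w" if "s \<in> S" for s
  proof (intro bexI)
    show "s = (s - p s) + p s" by simp
    show "s - p s \<in> U" using that p assms(3) by (auto simp: U_def lin_diff intro!: subspace_diff[OF S])
  qed (use p in auto)
  have "{x + y |x y. x \<in> U \<and> y \<in> W} = S"
    using dec assms(3) by (fastforce simp: U_def intro: subspace_add[OF S])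
  with dim_sums_Int[OF U W] int have "dim U + dim W = dim S" by simp
  with U int dec show ?thesis unfolding U_def by blast
qed

lemma basis_of_subspace:
  assumes "subspace S"
  obtains B where "B \<subseteq> S" "independent B" "S \<subseteq> span B" "S = span B" "finite B" "card B = dim S"
proof -
  obtain B where B: "B \<subseteq> S" "independent B" "S \<subseteq> span B" "card B = dim S"
    using basis_exists[of S] by blast
  moreover have "S = span B" using B assms by (auto simp: span_subspace)
  moreover have "finite B" using finiteI_independent B by auto
  ultimately show ?thesis using that by blast
qed

lemma dim_span_insert:
  assumes "subspace W" "x \<notin> W"
  shows "dim (span (insert x W)) = Suc (dim W)"
  using dim_insert[of x W] assms by (simp add: span_eq_iff[THEN iffD2])

lemma dim_psubset_subspace:
  assumes "subspace S" "subspace T" "S \<subseteq> T" "S \<noteq> T" shows "dim S < dim T"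
  using subspace_dim_equal[OF assms(1,2,3)] assms(4) by linarith

lemma dim_0_subspace: "subspace S \<Longrightarrow> dim S = 0 \<longleftrightarrow> S = {0}"
  using subspace_0 by (auto simp: dim_eq_0)

lemma dim_UNIV_dimension: "dim UNIV = dimension"
  by (simp add: dimension_def)

lemma dim_disjoint:
  assumes "subspace S" "subspace U" "S \<inter> U \<subseteq> {0}" shows "dim S + dim U \<le> dimension"
proof -
  have "dim (S \<inter> U) = 0" using assms(3) by simp
  moreover have "dim {x + y |x y. x \<in> S \<and> y \<in> U} \<le> dimension" by (rule dim_subset_UNIV)
  ultimately show ?thesis using dim_sums_Int[OF assms(1,2)] by linarith
qed

lemma subspace_maximal_exists:
  assumes "P W0" shows "\<exists>W. P W \<and> (\<forall>W'. P W' \<longrightarrow> dim W' \<le> dim W)"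
  using ex_has_greatest_nat[of P W0 dim "Suc dimension"] assms dim_subset_UNIV
  by (simp add: less_Suc_eq_le)

text \<open>The dimension drops at each step.\<close>

lemma descending_chain_reaches_zero:
  assumes sub: "\<And>n. subspace (F n)" and dec: "\<And>n. F (Suc n) \<subseteq> F n"
    and proper: "\<And>n. F n \<noteq> {0} \<Longrightarrow> F (Suc n) \<noteq> F n"
  shows "\<exists>n. F n = {0}"
proof (rule ccontr)
  assume *: "\<nexists>n. F n = {0}"
  have "dim (F n) + n \<le> dim (F 0)" for n
  proof (induction n)
    case (Suc n)
    have "dim (F (Suc n)) < dim (F n)"
      using * proper by (intro dim_psubset_subspace sub dec) auto
    thus ?case using Suc by simp
  qed simp
  from this[of "Suc (dim (F 0))"] show False by simp
qed

lemma subspace_image_lin: "lin f \<Longrightarrow> subspace S \<Longrightarrow> subspace (f ` S)"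
  by (rule vp.linear_subspace_image)

lemma span_Union_decompose:
  assumes "finite C" "\<And>c. c \<in> C \<Longrightarrow> subspace (G c)" "u \<in> span (\<Union>c\<in>C. G c)"
  shows "\<exists>v. (\<forall>c\<in>C. v c \<in> G c) \<and> u = (\<Sum>c\<in>C. v c)"
  using assms(3)
proof (induction rule: span_induct)
  case (step x)
  then obtain c where c: "c \<in> C" "x \<in> G c" by blast
  show ?case
    by (rule exI[of _ "\<lambda>d. if d = c then x else 0"])
      (use c assms(1,2) subspace_0 in auto)
next
  case base
  show ?case
  proof (rule subspaceI, goal_cases)
    case 1
    show ?case by (auto intro!: exI[of _ "\<lambda>_. 0"] subspace_0 assms(2))
  next
    case (2 x y)
    then obtain v w where *: "\<forall>c\<in>C. v c \<in> G c" "x = sum v C" "\<forall>c\<in>C. w c \<in> G c" "y = sum w C"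
      by blast
    thus ?case unfolding mem_Collect_eq
      by (intro exI[of _ "\<lambda>c. v c + w c"]) (auto simp: sum.distrib intro!: subspace_add assms(2))
  next
    case (3 a x)
    then obtain v where *: "\<forall>c\<in>C. v c \<in> G c" "x = sum v C" by blast
    thus ?case unfolding mem_Collect_eq
      by (intro exI[of _ "\<lambda>c. scale a (v c)"]) (auto simp: scale_sum_right intro!: subspace_scale assms(2))
  qed
qed

section \<open>Eigenvalues and pencils of operators\<close>

text \<open>
  The product of the operators \<open>f - c\<close>, with \<open>c\<close> running through a list.
\<close>

definition root_op :: "('v \<Rightarrow> 'v) \<Rightarrow> 'k list \<Rightarrow> 'v \<Rightarrow> 'v" where
  "root_op f cs = fold (\<lambda>c v. f v - scale c v) cs"

lemma root_op_simps [simp]: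
  "root_op f [] v = v"
  "root_op f (c # cs) v = root_op f cs (f v - scale c v)"
  by (simp_all add: root_op_def)

lemma root_op_append: "root_op f (cs @ ds) v = root_op f ds (root_op f cs v)"
  by (simp add: root_op_def)

lemma lin_root_op: "lin f \<Longrightarrow> lin (root_op f cs)"
proof (induction cs)
  case Nil thus ?case by (simp add: lin_iff)
next
  case (Cons c cs)
  have "lin (\<lambda>v. root_op f cs (f v - scale c v))"
    by (rule lin_comp[OF Cons.IH[OF Cons.prems]]) (intro lin_minus lin_homothety Cons.prems)
  thus ?case by simp
qed

lemma root_op_shift:
  assumes "lin f" shows "root_op f cs (f v - scale c v) = f (root_op f cs v) - scale c (root_op f cs v)"
proof (induction cs arbitrary: v)
  case (Cons d cs)
  have "f (f v - scale c v) - scale d (f v - scale c v) = f (f v - scale d v) - scale c (f v - scale d v)"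
    using assms by (simp add: lin_diff lin_scale scale_right_diff_distrib scale_left_commute algebra_simps)
  thus ?case using Cons.IH[of "f v - scale d v"] by simp
qed simp

text \<open>
  A polynomial relation \<open>p(f) v = 0\<close> becomes a product of linear factors, since \<open>p\<close> splits.  The bound
  \<open>N\<close> gives all polynomials that occur in the induction the same summation range.
\<close>

lemma root_op_of_polynomial:
  assumes f: "lin f" and "p \<noteq> 0" "degree p < N"
    and "(\<Sum>i\<le>N. scale (coeff p i) ((f ^^ i) v)) = 0"
  shows "\<exists>cs. root_op f cs v = 0"
  using assms(2-)
proof (induction "degree p" arbitrary: p v rule: less_induct)
  case (less p)
  show ?case
  proof (cases "degree p = 0")
    case True
    then obtain a where a: "p = [:a:]" by (rule degree_eq_zeroE)
    have "(\<Sum>i\<le>N. scale (coeff p i) ((f ^^ i) v)) = (\<Sum>i\<le>N. if i = 0 then scale a v else 0)"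
      by (intro sum.cong) (auto simp: a coeff_pCons split: nat.splits)
    hence "v = 0" using less.prems a by simp
    thus ?thesis by (intro exI[of _ "[]"]) simp
  next
    case False
    then obtain c where "poly p c = 0" using alg_closed_imp_poly_has_root by blast
    then obtain q where q: "p = [:- c, 1:] * q" using poly_eq_0_iff_dvd by (metis dvdE)
    have q0: "q \<noteq> 0" using q less.prems by auto
    hence deg: "degree p = Suc (degree q)" unfolding q by (subst degree_mult_eq) (use q0 in auto)
    have coeff_p: "coeff p i = coeff (pCons 0 q) i - c * coeff q i" for i
      by (simp add: q)
    have "(\<Sum>i\<le>N. scale (coeff (pCons 0 q) i) ((f ^^ i) v)) = (\<Sum>i\<le>N. scale (coeff q i) ((f ^^ i) (f v)))"
    proof -
      obtain M where M: "N = Suc M" using less.prems(2) by (cases N) auto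
      have "coeff q N = 0" using less.prems(2) deg by (intro coeff_eq_0) simp
      hence "(\<Sum>i\<le>N. scale (coeff q i) ((f ^^ i) (f v))) = (\<Sum>i\<le>M. scale (coeff q i) ((f ^^ i) (f v)))"
        by (simp add: M)
      also have "\<dots> = (\<Sum>i\<le>M. scale (coeff (pCons 0 q) (Suc i)) ((f ^^ Suc i) v))"
        by (simp add: funpow_swap1)
      finally show ?thesis unfolding M sum.atMost_Suc_shift by simp
    qed
    moreover have "(f ^^ i) (f v - scale c v) = (f ^^ i) (f v) - scale c ((f ^^ i) v)" for i
      using lin_funpow[OF f, of i] by (simp add: lin_diff lin_scale)
    ultimately have "(\<Sum>i\<le>N. scale (coeff q i) ((f ^^ i) (f v - scale c v))) =
        (\<Sum>i\<le>N. scale (coeff p i) ((f ^^ i) v))"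
      by (simp add: coeff_p scale_right_diff_distrib scale_left_diff_distrib sum_subtractf mult.commute)
    with less.hyps[of q "f v - scale c v"] deg q0 less.prems
    obtain cs where "root_op f cs (f v - scale c v) = 0" by auto
    thus ?thesis by (intro exI[of _ "c # cs"]) simp
  qed
qed

text \<open>
  More than \<open>dimension\<close> iterates of \<open>v\<close> are linearly dependent.
\<close>

lemma root_op_vanishes_at:
  assumes f: "lin f" shows "\<exists>cs. root_op f cs v = 0"
proof -
  define n where "n = card Basis"
  have "\<exists>a. (\<exists>j\<in>{..n}. a j \<noteq> 0) \<and>
      (\<forall>b\<in>Basis. (\<Sum>j\<in>{..n}. representation Basis ((f ^^ j) v) b * a j) = 0)"
    by (rule homogeneous_solution) (simp_all add: finite_Basis n_def)
  then obtain a where a: "\<exists>j\<le>n. a j \<noteq> 0"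
    "\<And>b. b \<in> Basis \<Longrightarrow> (\<Sum>j\<le>n. representation Basis ((f ^^ j) v) b * a j) = 0" by auto
  have 0: "(\<Sum>j\<le>n. scale (a j) ((f ^^ j) v)) = 0"
    using a(2) independent_Basis by (intro coord_inject) (auto simp: coord_setsum coord_scale mult.commute representation_zero)
  define p where "p = Poly (map a [0..<Suc n])"
  have cp: "coeff p i = (if i \<le> n then a i else 0)" for i
    by (auto simp: p_def nth_default_def simp del: upt_Suc)
  have "degree p < Suc n" using cp by (simp add: le_imp_less_Suc degree_le)
  moreover have "p \<noteq> 0" using a(1) cp by (metis coeff_0)
  moreover have "(\<Sum>i\<le>Suc n. scale (coeff p i) ((f ^^ i) v)) = 0"
    using 0 by (simp add: cp)
  ultimately show ?thesis using root_op_of_polynomial[OF f] by blast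
qed

lemma root_op_commute:
  assumes f: "lin f" shows "root_op f cs (root_op f ds v) = root_op f ds (root_op f cs v)"
  by (induction cs arbitrary: v) (simp_all add: root_op_shift[OF f, symmetric])

lemma root_op_vanishes:
  assumes f: "lin f" shows "\<exists>cs. \<forall>v. root_op f cs v = 0"
proof -
  have "\<exists>cs. \<forall>v\<in>B. root_op f cs v = 0" if "finite B" for B
    using that
  proof (induction B rule: finite_induct)
    case (insert b B)
    then obtain cs where cs: "\<forall>v\<in>B. root_op f cs v = 0" by blast
    obtain ds where ds: "root_op f ds b = 0" using root_op_vanishes_at[OF f] by blast
    have "root_op f (cs @ ds) b = 0"
      using ds lin_0[OF lin_root_op[OF f, of cs]] root_op_commute[OF f, of ds cs b]
      by (simp add: root_op_append)
    moreover have "root_op f (cs @ ds) v = 0" if "v \<in> B" for v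
      using cs that lin_0[OF lin_root_op[OF f, of ds]] by (simp add: root_op_append)
    ultimately show ?case by blast
  qed auto
  from this[OF finite_Basis] obtain cs where cs: "\<forall>v\<in>Basis. root_op f cs v = 0" by blast
  have "root_op f cs v = 0" for v
  proof -
    have "root_op f cs (\<Sum>b\<in>Basis. scale (representation Basis v b) b) = 0"
      using cs lin_root_op[OF f] by (simp add: lin_sum lin_scale)
    thus ?thesis by (simp add: coord_sum_eq)
  qed
  thus ?thesis by blast
qed

text \<open>Every eigenvalue is among the roots of an annihilating product.\<close>

lemma finite_eigenvalues:
  assumes f: "lin f" shows "finite {c. \<exists>v. v \<noteq> 0 \<and> f v = scale c v}"
proof -
  obtain cs where cs: "\<forall>v. root_op f cs v = 0" using root_op_vanishes[OF f] by blast
  have "c \<in> set cs" if v: "v \<noteq> 0" "f v = scale c v" for c v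
  proof (rule ccontr)
    assume "c \<notin> set cs"
    moreover have "\<exists>a. root_op f ds v = scale a v \<and> (c \<notin> set ds \<longrightarrow> a \<noteq> 0)" for ds
    proof (induction ds)
      case (Cons d ds)
      then obtain a where a: "root_op f ds v = scale a v" "c \<notin> set ds \<longrightarrow> a \<noteq> 0" by blast
      have "root_op f (d # ds) v = scale ((c - d) * a) v"
        using a lin_root_op[OF f, of ds] by (simp add: v lin_scale scale_left_diff_distrib[symmetric])
      thus ?case using a by (intro exI[of _ "(c - d) * a"]) auto
    qed (auto intro: exI[of _ 1])
    ultimately show False using cs v by (metis scale_eq_0_iff)
  qed
  thus ?thesis by (intro finite_subset[OF _ finite_set[of cs]]) blast
qed

text \<open>
  Injectivity modulo a subspace is an open condition along a pencil of operators: if \<open>T\<close> inverts \<open>A\<close>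
  on \<open>U\<close> and kills \<open>W\<close>, it fails for \<open>A + c B\<close> only if \<open>- 1 / c\<close> is an eigenvalue of \<open>T B\<close>.
\<close>

lemma pencil_injective:
  assumes A: "lin A" and B: "lin B" and U: "subspace U" and W: "subspace W"
    and inj: "\<forall>u\<in>U. A u \<in> W \<longrightarrow> u = 0"
  shows "finite {c. \<exists>u\<in>U. u \<noteq> 0 \<and> A u + scale c (B u) \<in> W}"
proof -
  obtain T where T: "lin T" "\<And>u. u \<in> U \<Longrightarrow> T (A u) = u" "\<And>w. w \<in> W \<Longrightarrow> T w = 0"
    using left_inverse_exists[OF A U W inj] by blast
  have "finite {c. \<exists>v. v \<noteq> 0 \<and> T (B v) = scale c v}"
    by (rule finite_eigenvalues[OF lin_comp[OF T(1) B]])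
  hence "finite ((\<lambda>e. - inverse e) ` {c. \<exists>v. v \<noteq> 0 \<and> T (B v) = scale c v})" by simp
  moreover have "{c. \<exists>u\<in>U. u \<noteq> 0 \<and> A u + scale c (B u) \<in> W}
      \<subseteq> (\<lambda>e. - inverse e) ` {c. \<exists>v. v \<noteq> 0 \<and> T (B v) = scale c v}"
  proof clarify
    fix c u assume u: "u \<in> U" "u \<noteq> 0" "A u + scale c (B u) \<in> W"
    have "0 = T (A u + scale c (B u))" using T(3) u(3) by simp
    also have "\<dots> = u + scale c (T (B u))" using T u by (simp add: lin_add lin_scale)
    finally have *: "scale c (T (B u)) = - u" by (simp add: eq_neg_iff_add_eq_0 add.commute)
    have c: "c \<noteq> 0" using * u(2) by auto
    have "T (B u) = scale (inverse c) (scale c (T (B u)))" using c by simp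
    also have "\<dots> = scale (- inverse c) u" by (simp add: *)
    finally show "c \<in> (\<lambda>e. - inverse e) ` {c. \<exists>v. v \<noteq> 0 \<and> T (B v) = scale c v}"
      using u c by (intro image_eqI[of _ _ "- inverse c"]) auto
  qed
  ultimately show ?thesis by (rule finite_subset[rotated])
qed

text \<open>Each coordinate is a polynomial with infinitely many roots.\<close>

lemma vector_polynomial_zero:
  assumes S: "infinite S" "\<And>c. c \<in> S \<Longrightarrow> (\<Sum>j\<le>N. scale (c ^ j) (w j)) = 0" and "j \<le> N"
  shows "w j = 0"
proof (rule coord_inject)
  fix b assume "b \<in> Basis"
  define p where "p = Poly (map (\<lambda>j. representation Basis (w j) b) [0..<Suc N])"
  have cp: "coeff p i = (if i \<le> N then representation Basis (w i) b else 0)" for i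
    by (auto simp: p_def nth_default_def simp del: upt_Suc)
  have deg: "degree p \<le> N" using cp by (simp add: degree_le)
  have "poly p c = 0" if "c \<in> S" for c
  proof -
    have "poly p c = (\<Sum>i\<le>N. coeff p i * c ^ i)"
      unfolding poly_altdef using deg
      by (intro sum.mono_neutral_left) (auto simp: coeff_eq_0)
    also have "\<dots> = representation Basis (\<Sum>j\<le>N. scale (c ^ j) (w j)) b"
      by (simp add: coord_setsum coord_scale cp mult.commute)
    finally show ?thesis using S(2)[OF that] by (simp add: representation_zero)
  qed
  hence "S \<subseteq> {c. poly p c = 0}" by blast
  hence "p = 0" using S(1) poly_roots_finite finite_subset by blast
  thus "representation Basis (w j) b = representation Basis 0 b"
    using cp[of j] assms(3) by (simp add: representation_zero)
qed

lemma pencil_power: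
  assumes A: "lin A" and B: "lin B"
  shows "\<exists>w. (\<forall>c. ((\<lambda>v. A v + scale c (B v)) ^^ N) v = (\<Sum>j\<le>N. scale (c ^ j) (w j))) \<and>
    w N = (B ^^ N) v"
proof (induction N)
  case 0
  show ?case by (intro exI[of _ "\<lambda>_. v"]) simp
next
  case (Suc N)
  then obtain w where w: "\<And>c. ((\<lambda>v. A v + scale c (B v)) ^^ N) v = (\<Sum>j\<le>N. scale (c ^ j) (w j))"
    "w N = (B ^^ N) v" by blast
  define w' where "w' j = (if j \<le> N then A (w j) else 0) + (if j = 0 then 0 else B (w (j - 1)))" for j
  have "((\<lambda>v. A v + scale c (B v)) ^^ Suc N) v = (\<Sum>j\<le>Suc N. scale (c ^ j) (w' j))" for c
  proof -
    have "(\<Sum>j\<le>Suc N. scale (c ^ j) (w' j)) =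
        (\<Sum>j\<le>Suc N. scale (c ^ j) (if j \<le> N then A (w j) else 0)) +
        (\<Sum>j\<le>Suc N. scale (c ^ j) (if j = 0 then 0 else B (w (j - 1))))"
      unfolding w'_def scale_right_distrib by (rule sum.distrib)
    also have "(\<Sum>j\<le>Suc N. scale (c ^ j) (if j \<le> N then A (w j) else 0)) = A (\<Sum>j\<le>N. scale (c ^ j) (w j))"
      by (simp add: lin_sum[OF A] lin_scale[OF A])
    also have "(\<Sum>j\<le>Suc N. scale (c ^ j) (if j = 0 then 0 else B (w (j - 1)))) =
        scale c (B (\<Sum>j\<le>N. scale (c ^ j) (w j)))"
      unfolding sum.atMost_Suc_shift by (simp add: lin_sum[OF B] lin_scale[OF B] scale_sum_right)
    finally show ?thesis by (simp add: w(1))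
  qed
  moreover have "w' (Suc N) = (B ^^ Suc N) v" by (simp add: w'_def w(2))
  ultimately show ?case by blast
qed

section \<open>Generalised eigenspaces\<close>

definition geigenspace :: "('v \<Rightarrow> 'v) \<Rightarrow> 'k \<Rightarrow> 'v set" where
  "geigenspace f c = {v. \<exists>n. ((\<lambda>v. f v - scale c v) ^^ n) v = 0}"

lemma lin_shift: "lin f \<Longrightarrow> lin (\<lambda>v. f v - scale c v)"
  by (rule lin_minus[OF _ lin_homothety])

lemma gen_0_iff: "v \<in> geigenspace f 0 \<longleftrightarrow> (\<exists>n. (f ^^ n) v = 0)"
  by (simp add: geigenspace_def)

lemma funpow_zero_mono:
  assumes "lin f" "(f ^^ n) v = 0" "n \<le> k" shows "(f ^^ k) v = 0"
proof -
  have "(f ^^ k) v = (f ^^ (k - n)) ((f ^^ n) v)"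
    using assms(3) by (metis comp_apply funpow_add le_add_diff_inverse2)
  thus ?thesis using assms lin_0[OF lin_funpow] by simp
qed

lemma gen_subspace: assumes f: "lin f" shows "subspace (geigenspace f c)"
proof (rule subspaceI)
  let ?g = "\<lambda>v. f v - scale c v"
  have g: "lin ?g" by (rule lin_shift[OF f])
  show "0 \<in> geigenspace f c" unfolding geigenspace_def by (auto intro!: exI[of _ 0])
  fix x y assume "x \<in> geigenspace f c" "y \<in> geigenspace f c"
  then obtain n k where nk: "(?g ^^ n) x = 0" "(?g ^^ k) y = 0" by (auto simp: geigenspace_def)
  have "(?g ^^ max n k) (x + y) = 0"
    using funpow_zero_mono[OF g nk(1), of "max n k"] funpow_zero_mono[OF g nk(2), of "max n k"]
    by (simp add: lin_add[OF lin_funpow[OF g]])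
  thus "x + y \<in> geigenspace f c" by (auto simp: geigenspace_def)
  have "(?g ^^ n) (scale a x) = 0" for a
    using nk(1) by (simp add: lin_scale[OF lin_funpow[OF g]])
  thus "scale a x \<in> geigenspace f c" for a by (auto simp: geigenspace_def)
qed

lemma gen_shiftI: "f v - scale c v \<in> geigenspace f c \<Longrightarrow> v \<in> geigenspace f c"
  unfolding geigenspace_def
proof clarify
  fix n assume "((\<lambda>v. f v - scale c v) ^^ n) (f v - scale c v) = 0"
  thus "\<exists>n. ((\<lambda>v. f v - scale c v) ^^ n) v = 0"
    by (intro exI[of _ "Suc n"]) (simp add: funpow_Suc_right del: funpow.simps)
qed

lemma gen_shiftD:
  assumes "lin f" "v \<in> geigenspace f c" shows "f v - scale c v \<in> geigenspace f c"
proof -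
  let ?g = "\<lambda>v. f v - scale c v"
  obtain n where n: "(?g ^^ n) v = 0" using assms(2) by (auto simp: geigenspace_def)
  have "(?g ^^ n) (?g v) = ?g ((?g ^^ n) v)" by (rule funpow_swap1[symmetric])
  also have "\<dots> = 0" using n lin_0[OF assms(1)] by simp
  finally show ?thesis by (auto simp: geigenspace_def)
qed

lemma gen_closed:
  assumes "lin f" "v \<in> geigenspace f c" shows "f v \<in> geigenspace f c"
  using subspace_add[OF gen_subspace[OF assms(1)] gen_shiftD[OF assms]
      subspace_scale[OF gen_subspace[OF assms(1)] assms(2), of c]] by simp

text \<open>Induction on the exponent of \<open>f - c\<close> that annihilates the vector.\<close>

lemma gen_induct [consumes 1, case_names zero shift]:
  assumes "v \<in> geigenspace f c" "P 0" "\<And>v. v \<in> geigenspace f c \<Longrightarrow> P (f v - scale c v) \<Longrightarrow> P v"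
  shows "P v"
proof -
  obtain n where "((\<lambda>v. f v - scale c v) ^^ n) v = 0" using assms(1) by (auto simp: geigenspace_def)
  thus ?thesis
  proof (induction n arbitrary: v)
    case (Suc n)
    have "((\<lambda>v. f v - scale c v) ^^ n) (f v - scale c v) = 0"
      using Suc.prems funpow_swap1[of "\<lambda>v. f v - scale c v" n v] by simp
    moreover have "v \<in> geigenspace f c" using Suc.prems unfolding geigenspace_def by blast
    ultimately show ?case using assms(3) Suc.IH by blast
  qed (use assms(2) in simp)
qed

lemma gen_commute:
  assumes f: "lin f" and g: "lin g" "\<And>v. f (g v) = g (f v)" and "v \<in> geigenspace f c"
  shows "g v \<in> geigenspace f c"
  using assms(4)
proof (induction rule: gen_induct)
  case zero
  show ?case using subspace_0[OF gen_subspace[OF f]] lin_0[OF g(1)] by simp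
next
  case (shift v)
  have "f (g v) - scale c (g v) = g (f v - scale c v)"
    by (simp add: g(2) lin_diff[OF g(1)] lin_scale[OF g(1)])
  hence "f (g v) - scale c (g v) \<in> geigenspace f c" using shift.IH by simp
  thus ?case by (rule gen_shiftI)
qed

lemma eigenvector_in_gen: "f v = scale c v \<Longrightarrow> v \<in> geigenspace f c"
  unfolding geigenspace_def by (auto intro!: exI[of _ 1])

lemma gen_eigenvector:
  assumes f: "lin f" and "v \<in> geigenspace f d" "f v = scale c v" "c \<noteq> d" shows "v = 0"
  using assms(2,3)
proof (induction rule: gen_induct)
  case (shift v)
  have e: "f v - scale d v = scale (c - d) v" by (simp add: shift scale_left_diff_distrib)
  have "f (scale (c - d) v) = scale c (scale (c - d) v)"
    using shift.prems f by (simp add: lin_scale scale_left_commute)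
  hence "scale (c - d) v = 0" using shift.IH e by simp
  thus ?case using assms(4) by simp
qed simp

text \<open>
  On the eigenspace itself \<open>f - c\<close> is the scalar \<open>d - c\<close>; the induction corrects for the nilpotent part
  without leaving \<open>U\<close>.
\<close>

lemma gen_shift_surj:
  assumes f: "lin f" and U: "subspace U" "f ` U \<subseteq> U" and "c \<noteq> d"
    and v: "v \<in> geigenspace f d" "v \<in> U"
  shows "\<exists>w \<in> geigenspace f d \<inter> U. f w - scale c w = v"
  using v
proof (induction rule: gen_induct)
  case zero
  show ?case using subspace_0[OF gen_subspace[OF f]] subspace_0[OF U(1)] lin_0[OF f]
    by (intro bexI[of _ 0]) auto
next
  case (shift v)
  have "f v - scale d v \<in> U" using shift U by (intro subspace_diff subspace_scale) auto
  then obtain w where w: "w \<in> geigenspace f d \<inter> U" "f w - scale c w = f v - scale d v"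
    using shift.IH by blast
  let ?u = "scale (inverse (d - c)) (v - w)"
  have "f ?u - scale c ?u = scale (inverse (d - c)) ((f v - scale c v) - (f w - scale c w))"
    using f by (simp add: lin_scale lin_diff scale_right_diff_distrib scale_left_commute algebra_simps)
  also have "(f v - scale c v) - (f w - scale c w) = scale (d - c) v"
    unfolding w(2) by (simp add: scale_left_diff_distrib)
  finally have "f ?u - scale c ?u = v" using assms(4) by simp
  moreover have "?u \<in> geigenspace f d \<inter> U"
    using w(1) shift by (auto intro!: subspace_scale subspace_diff gen_subspace f U(1))
  ultimately show ?case by blast
qed

text \<open>
  Remove one factor \<open>f - c\<close>: the vector \<open>(f - c) u\<close> decomposes by induction, its components for
  eigenvalues other than \<open>c\<close> lie in the image of \<open>f - c\<close>, and what remains of \<open>u\<close> after subtracting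
  preimages is a generalised eigenvector for \<open>c\<close>.
\<close>

lemma gen_span_of_roots:
  assumes f: "lin f" and U: "subspace U" "f ` U \<subseteq> U"
    and "u \<in> U" "root_op f cs u = 0"
  shows "u \<in> span (\<Union>c\<in>set cs. geigenspace f c \<inter> U)"
  using assms(4,5)
proof (induction cs arbitrary: u)
  case (Cons c cs)
  let ?S = "span (\<Union>c\<in>set (c # cs). geigenspace f c \<inter> U)"
  have SU: "?S \<subseteq> U" by (rule span_minimal[OF _ U(1)]) auto
  have "f u - scale c u \<in> U" using Cons.prems U by (intro subspace_diff subspace_scale) auto
  with Cons have "f u - scale c u \<in> span (\<Union>c\<in>set cs. geigenspace f c \<inter> U)" by simp
  moreover have "span (\<Union>c\<in>set cs. geigenspace f c \<inter> U) \<subseteq>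
      {x + y |x y. x \<in> (\<lambda>v. f v - scale c v) ` ?S \<and> y \<in> geigenspace f c \<inter> U}"
  proof (rule span_minimal, rule subsetI)
    fix x assume "x \<in> (\<Union>c\<in>set cs. geigenspace f c \<inter> U)"
    then obtain d where d: "d \<in> set cs" "x \<in> geigenspace f d" "x \<in> U" by auto
    have "\<exists>v\<in>?S. \<exists>r\<in>geigenspace f c \<inter> U. x = (f v - scale c v) + r"
    proof (cases "c = d")
      case True
      thus ?thesis using d span_zero lin_0[OF f] by (intro bexI[of _ 0] bexI[of _ x]) auto
    next
      case False
      from gen_shift_surj[OF f U this d(2,3)] obtain w
        where w: "w \<in> geigenspace f d \<inter> U" "f w - scale c w = x" by blast
      have "w \<in> ?S" using w(1) d(1) by (intro span_base) auto
      thus ?thesis using w subspace_0[OF gen_subspace[OF f]] subspace_0[OF U(1)]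
        by (intro bexI[of _ w] bexI[of _ 0]) auto
    qed
    thus "x \<in> {x + y |x y. x \<in> (\<lambda>v. f v - scale c v) ` ?S \<and> y \<in> geigenspace f c \<inter> U}" by blast
  qed (intro subspace_sums subspace_image_lin lin_shift subspace_span subspace_inter gen_subspace f U(1))
  ultimately have "\<exists>v\<in>?S. \<exists>r\<in>geigenspace f c \<inter> U. f u - scale c u = (f v - scale c v) + r" by blast
  then obtain v r where v: "v \<in> ?S" "r \<in> geigenspace f c \<inter> U" "f u - scale c u = (f v - scale c v) + r"
    by blast
  have "f (u - v) - scale c (u - v) = r"
    using v(3) by (simp add: lin_diff[OF f] scale_right_diff_distrib algebra_simps)
  hence "f (u - v) - scale c (u - v) \<in> geigenspace f c" using v(2) by simp
  hence "u - v \<in> geigenspace f c" by (rule gen_shiftI)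
  moreover have "u - v \<in> U" using Cons.prems v(1) SU by (intro subspace_diff[OF U(1)]) auto
  ultimately have "u - v \<in> ?S" by (intro span_base) auto
  from span_add[OF this v(1)] show ?case by simp
qed simp

lemma gen_decomposition:
  assumes f: "lin f"
  shows "\<exists>C. finite C \<and> (\<forall>U u. subspace U \<longrightarrow> f ` U \<subseteq> U \<longrightarrow> u \<in> U \<longrightarrow>
    u \<in> span (\<Union>c\<in>C. geigenspace f c \<inter> U))"
proof -
  obtain cs where cs: "\<forall>v. root_op f cs v = 0" using root_op_vanishes[OF f] by blast
  show ?thesis
  proof (intro exI[of _ "set cs"] conjI allI impI)
    fix U u assume "subspace U" "f ` U \<subseteq> U" "u \<in> U"
    thus "u \<in> span (\<Union>c\<in>set cs. geigenspace f c \<inter> U)"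
      using cs by (intro gen_span_of_roots[OF f]) simp_all
  qed simp
qed

lemma gen_independent:
  assumes f: "lin f" and "finite C" "\<forall>c\<in>C. v c \<in> geigenspace f c" "(\<Sum>c\<in>C. v c) = 0"
  shows "\<forall>c\<in>C. v c = 0"
  using assms(2-)
proof (induction C arbitrary: v rule: finite_induct)
  case (insert d C)
  have "\<forall>v. (\<forall>c\<in>C. v c \<in> geigenspace f c) \<longrightarrow> w + (\<Sum>c\<in>C. v c) = 0 \<longrightarrow> w = 0 \<and> (\<forall>c\<in>C. v c = 0)"
    if "w \<in> geigenspace f d" for w
    using that
  proof (induction rule: gen_induct)
    case zero
    then show ?case using insert.IH by auto
  next
    case (shift w)
    show ?case
    proof (intro allI impI)
      fix v assume v: "\<forall>c\<in>C. v c \<in> geigenspace f c" "w + (\<Sum>c\<in>C. v c) = 0"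
      have "(f w - scale d w) + (\<Sum>c\<in>C. f (v c) - scale d (v c)) =
          f (w + (\<Sum>c\<in>C. v c)) - scale d (w + (\<Sum>c\<in>C. v c))"
        by (simp add: lin_add[OF f] lin_sum[OF f] scale_right_distrib scale_sum_right sum_subtractf)
      also have "\<dots> = 0" using v(2) lin_0[OF f] by simp
      finally have "f w - scale d w = 0 \<and> (\<forall>c\<in>C. f (v c) - scale d (v c) = 0)"
        using shift.IH[rule_format, of "\<lambda>c. f (v c) - scale d (v c)"] v(1)
        by (auto intro!: subspace_diff subspace_scale gen_subspace gen_closed f)
      hence "v c = 0" if "c \<in> C" for c
        using gen_eigenvector[OF f, of "v c" c d] that v(1) insert.hyps(2) by auto
      thus "w = 0 \<and> (\<forall>c\<in>C. v c = 0)" using v(2) by simp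
    qed
  qed
  from this[of "v d"] insert.prems have "\<forall>u. (\<forall>c\<in>C. u c \<in> geigenspace f c) \<longrightarrow> v d + (\<Sum>c\<in>C. u c) = 0 \<longrightarrow>
      v d = 0 \<and> (\<forall>c\<in>C. u c = 0)" by blast
  moreover have "\<forall>c\<in>C. v c \<in> geigenspace f c" "v d + (\<Sum>c\<in>C. v c) = 0"
    using insert.prems insert.hyps by simp_all
  ultimately have "v d = 0 \<and> (\<forall>c\<in>C. v c = 0)" by blast
  thus ?case by blast
qed simp

text \<open>
  A function of the eigenvalues extends to a linear operator that acts as a scalar on every generalised
  eigenspace; for the identity function this is the semisimple part of \<open>f\<close>.
\<close>

lemma eigenvalue_calculus:
  assumes f: "lin f" shows "\<exists>D. lin D \<and> (\<forall>c. \<forall>v\<in>geigenspace f c. D v = scale (\<phi> c) v)"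
proof -
  obtain C where C: "finite C" "\<And>u. u \<in> span (\<Union>c\<in>C. geigenspace f c \<inter> UNIV)"
    using gen_decomposition[OF f] by (meson UNIV_I subset_UNIV subspace_UNIV)
  have "\<forall>u. \<exists>v. (\<forall>c\<in>C. v c \<in> geigenspace f c) \<and> u = (\<Sum>c\<in>C. v c)"
    using span_Union_decompose[OF C(1), of "geigenspace f"] C(2) gen_subspace[OF f] by simp
  then obtain p where p: "\<And>u c. c \<in> C \<Longrightarrow> p u c \<in> geigenspace f c" "\<And>u. (\<Sum>c\<in>C. p u c) = u" by metis
  have uniq: "p u c = v c" if "\<forall>c\<in>C. v c \<in> geigenspace f c" "u = (\<Sum>c\<in>C. v c)" "c \<in> C" for u v c
  proof -
    have "\<forall>c\<in>C. p u c - v c = 0"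
      by (rule gen_independent[OF f C(1)])
        (use that p in \<open>auto simp: sum_subtractf intro!: subspace_diff gen_subspace f\<close>)
    thus ?thesis using that by simp
  qed
  define D where "D u = (\<Sum>c\<in>C. scale (\<phi> c) (p u c))" for u
  have "lin D"
  proof (rule linI)
    fix x y
    have "p (x + y) c = p x c + p y c" if "c \<in> C" for c
      by (rule uniq[OF _ _ that]) (auto simp: p sum.distrib intro!: subspace_add gen_subspace f)
    thus "D (x + y) = D x + D y"
      by (simp add: D_def sum.distrib[symmetric] scale_right_distrib)
  next
    fix a x
    have "p (scale a x) c = scale a (p x c)" if "c \<in> C" for c
      by (rule uniq[OF _ _ that]) (auto simp: p scale_sum_right[symmetric] intro!: subspace_scale gen_subspace f)
    thus "D (scale a x) = scale a (D x)"
      by (simp add: D_def scale_sum_right mult.commute)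
  qed
  moreover have "D v = scale (\<phi> d) v" if v: "v \<in> geigenspace f d" for v d
  proof (cases "d \<in> C")
    case True
    have "p v c = (if c = d then v else 0)" if "c \<in> C" for c
      by (rule uniq[OF _ _ that]) (use v C(1) True subspace_0[OF gen_subspace[OF f]] in auto)
    hence "D v = (\<Sum>c\<in>C. if c = d then scale (\<phi> d) v else 0)"
      unfolding D_def by (intro sum.cong) auto
    thus ?thesis using True C(1) by simp
  next
    case False
    let ?w = "\<lambda>c. if c = d then - v else p v c"
    have "(\<Sum>c\<in>insert d C. ?w c) = - v + (\<Sum>c\<in>C. p v c)"
      using False C(1) by (simp, intro sum.cong) auto
    hence "(\<Sum>c\<in>insert d C. ?w c) = 0" by (simp only: p(2) add.left_inverse)
    moreover have "\<forall>c\<in>insert d C. ?w c \<in> geigenspace f c"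
      using v p(1) subspace_neg[OF gen_subspace[OF f]] by simp
    ultimately have "\<forall>c\<in>insert d C. ?w c = 0"
      using C(1) by (intro gen_independent[OF f]) auto
    hence "v = 0" by simp
    moreover have "D 0 = 0" using lin_0[OF \<open>lin D\<close>] .
    ultimately show ?thesis by simp
  qed
  ultimately show ?thesis by blast
qed

text \<open>
  The generalised eigenspaces for nonzero eigenvalues lie in the image of \<open>f\<close>, and the
  one for \<open>0\<close> is the kernel.
\<close>

lemma semisimple_splitting:
  assumes f: "lin f" and ss: "\<And>v. v \<in> geigenspace f 0 \<Longrightarrow> f v = 0"
  shows "\<exists>w c. y = f w + c \<and> f c = 0"
proof -
  let ?S = "{x + y |x y. x \<in> range f \<and> y \<in> {c. f c = 0}}"
  obtain C where C: "finite C" "\<forall>U u. subspace U \<longrightarrow> f ` U \<subseteq> U \<longrightarrow> u \<in> U \<longrightarrow>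
    u \<in> span (\<Union>c\<in>C. geigenspace f c \<inter> U)" using gen_decomposition[OF f] by blast
  have "y \<in> span (\<Union>c\<in>C. geigenspace f c \<inter> UNIV)" using C(2) subspace_UNIV by blast
  moreover have "span (\<Union>c\<in>C. geigenspace f c \<inter> UNIV) \<subseteq> ?S"
  proof (rule span_minimal, rule subsetI)
    fix v assume "v \<in> (\<Union>c\<in>C. geigenspace f c \<inter> UNIV)"
    then obtain d where d: "v \<in> geigenspace f d" by blast
    have "\<exists>w c. v = f w + c \<and> f c = 0"
    proof (cases "d = 0")
      case True
      hence "v = f 0 + v" "f v = 0" using ss d lin_0[OF f] by auto
      thus ?thesis by blast
    next
      case False
      obtain w where "f w - scale 0 w = v"
        using gen_shift_surj[OF f subspace_UNIV subset_UNIV _ d UNIV_I, of 0] False by blast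
      hence "v = f w + 0" "f 0 = 0" using lin_0[OF f] by auto
      thus ?thesis by blast
    qed
    thus "v \<in> ?S" by blast
  qed (intro subspace_sums subspace_image_lin f subspace_UNIV vp.linear_subspace_kernel)
  ultimately show ?thesis by blast
qed

lemma nilpotent_if_eigenvalues_0:
  assumes f: "lin f" and sp: "\<forall>v. v \<in> span (\<Union>c\<in>C. geigenspace f c)"
    and "\<And>c. c \<in> C \<Longrightarrow> c \<noteq> 0 \<Longrightarrow> geigenspace f c = {0}"
  shows "geigenspace f 0 = UNIV"
proof -
  have "geigenspace f c \<subseteq> geigenspace f 0" if "c \<in> C" for c
    using assms(3)[OF that] subspace_0[OF gen_subspace[OF f], of 0] by (cases "c = 0") auto
  hence "span (\<Union>c\<in>C. geigenspace f c) \<subseteq> geigenspace f 0" by (intro span_minimal gen_subspace f) blast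
  thus ?thesis using sp by blast
qed

lemma nilpotent_image_proper:
  assumes f: "lin f" and S: "subspace S" "S \<subseteq> geigenspace f 0" "S \<noteq> {0}"
  shows "f ` S \<noteq> S"
proof
  assume eq: "f ` S = S"
  obtain B where B: "B \<subseteq> S" "S = span B" "finite B" using basis_of_subspace[OF S(1)] by metis
  have nil: "\<exists>n. (f ^^ n) s = 0" if "s \<in> S" for s using S(2) that gen_0_iff by blast
  have "\<exists>N. \<forall>b\<in>B. (f ^^ N) b = 0"
    using B(3,1)
  proof (induction B rule: finite_induct)
    case (insert b B)
    then obtain N n where "\<forall>b\<in>B. (f ^^ N) b = 0" "(f ^^ n) b = 0" using nil by blast
    hence "\<forall>b\<in>insert b B. (f ^^ max N n) b = 0" using funpow_zero_mono[OF f] by auto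
    thus ?case by blast
  qed auto
  then obtain N where N: "\<forall>b\<in>B. (f ^^ N) b = 0" by blast
  have "(f ^^ N) s = 0" if "s \<in> S" for s
    by (rule vp.linear_eq_0_on_span[OF lin_funpow[OF f], of B N]) (use N that B in auto)
  hence "(f ^^ N) ` S \<subseteq> {0}" by blast
  moreover have "(f ^^ N) ` S = S"
  proof (induction N)
    case (Suc N)
    have "(f ^^ Suc N) ` S = f ` ((f ^^ N) ` S)" by (simp add: image_image)
    thus ?case by (simp add: Suc eq)
  qed simp
  ultimately show False using S(3) subspace_0[OF S(1)] by auto
qed

text \<open>
  The images of \<open>S\<close> under the powers of \<open>f\<close> lose dimension until they vanish, so an exponent that
  works for all of \<open>S\<close> is bounded by the dimension.
\<close>

lemma nilpotent_bound:
  assumes f: "lin f"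
    and "subspace S" "f ` S \<subseteq> S" "S \<subseteq> geigenspace f 0" "dim S \<le> n" "s \<in> S"
  shows "(f ^^ n) s = 0"
  using assms(2-)
proof (induction n arbitrary: S s)
  case 0
  hence "S \<subseteq> {0}" by (simp only: dim_eq_0[symmetric])
  thus ?case using 0 by auto
next
  case (Suc n)
  show ?case
  proof (cases "S = {0}")
    case True
    thus ?thesis using Suc.prems(5) lin_0[OF lin_funpow[OF f], of "Suc n"] by simp
  next
    case False
    have "dim (f ` S) < dim S"
      using nilpotent_image_proper[OF f Suc.prems(1,3) False] Suc.prems(1,2)
      by (intro dim_psubset_subspace subspace_image_lin f) auto
    hence "(f ^^ n) (f s) = 0"
      using Suc.prems by (intro Suc.IH[of "f ` S"] subspace_image_lin f) auto
    thus ?thesis by (simp add: funpow_swap1)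
  qed
qed

text \<open>
  Suppose that \<open>A + s B\<close> has a formal kernel over the power series in \<open>s\<close>: solutions
  \<open>\<Sum>\<^sub>n U b n s\<^sup>n\<close> with linearly independent constant terms \<open>b\<close>.  Then the kernel at \<open>s = 1\<close> is at least as
  large.  Otherwise a combination of the formal solutions with power series as coefficients has no
  component in the kernel \<open>K\<close> at \<open>s = 1\<close>.  Up to the projection to \<open>K\<close>, the pencil is \<open>1 + (s - 1) E\<close>
  for an operator \<open>E\<close>; so this combination is a formal solution of \<open>(1 + (s - 1) E) u = 0\<close>, and such a
  \<open>u\<close> vanishes.
\<close>

lemma pencil_formal_kernel:
  assumes A: "lin A" and B: "lin B" and J: "finite J" "independent J"
    and U0: "\<And>b. b \<in> J \<Longrightarrow> U b 0 = b" "\<And>b. b \<in> J \<Longrightarrow> A (U b 0) = 0"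
    and US: "\<And>b n. b \<in> J \<Longrightarrow> A (U b (Suc n)) + B (U b n) = 0"
  shows "card J \<le> dim {v. A v + B v = 0}"
proof (rule ccontr)
  define K where "K = {v. A v + B v = 0}"
  assume "\<not> card J \<le> dim {v. A v + B v = 0}"
  hence less: "dim K < card J" by (simp add: K_def)
  have AB: "lin (\<lambda>v. A v + B v)" by (rule lin_plus[OF A B])
  have sK: "subspace K" unfolding K_def by (rule vp.linear_subspace_kernel[OF AB])
  obtain V where V: "subspace V" "V \<inter> K = {0}" "\<forall>s\<in>UNIV. \<exists>u\<in>V. \<exists>w\<in>K. s = u + w"
    using complement_exists[OF sK subspace_UNIV] by blast
  obtain T where T: "lin T" "\<forall>u\<in>V. T (A u + B u) = u"
    using left_inverse_exists[OF AB V(1) subspace_single_0] V(2) by (auto simp: K_def)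
  obtain p where p: "lin p" "\<forall>v. p v \<in> K" "\<forall>k\<in>K. p k = k" "\<forall>u\<in>V. p u = 0"
    using left_inverse_exists[OF lin_id sK V(1)] V(2) by auto
  \<comment> \<open>Here \<open>p\<close> projects to \<open>K\<close> along \<open>V\<close>, and \<open>T\<close> inverts \<open>A + B\<close> on \<open>V\<close>.\<close>
  have id: "T (A v + B v) + p v = v" for v
  proof -
    obtain u k where uk: "u \<in> V" "k \<in> K" "v = u + k" using V(3) by blast
    have "A v + B v = A u + B u"
      using uk(2) by (simp add: uk(3) lin_add[OF A] lin_add[OF B] K_def algebra_simps)
    thus ?thesis using T(2) p uk by (simp add: lin_add[OF p(1)])
  qed
  obtain C where C: "C \<subseteq> K" "independent C" "K = span C" "finite C" "card C = dim K"
    using basis_of_subspace[OF sK] by metis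
  \<comment> \<open>There are fewer coordinates on \<open>K\<close> than formal solutions.\<close>
  define M where "M i j = Abs_fps (\<lambda>n. representation C (p (U j n)) i)" for i j
  obtain a where a: "\<exists>j\<in>J. a j \<noteq> 0" "\<forall>i\<in>C. (\<Sum>j\<in>J. M i j * a j) = 0"
    using homogeneous_solution[OF C(4) J(1), of M] less C(5) by auto
  define u where "u n = (\<Sum>j\<in>J. \<Sum>k=0..n. scale (fps_nth (a j) k) (U j (n - k)))" for n
  have pu: "p (u n) = 0" for n
  proof -
    have "representation C (p (u n)) i = 0" if "i \<in> C" for i
    proof -
      have "p (u n) = (\<Sum>j\<in>J. \<Sum>k=0..n. scale (fps_nth (a j) k) (p (U j (n - k))))"
        by (simp add: u_def lin_sum[OF p(1)] lin_scale[OF p(1)])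
      also have "representation C \<dots> i =
          (\<Sum>j\<in>J. \<Sum>k=0..n. fps_nth (a j) k * representation C (p (U j (n - k))) i)"
        using C p(2) by (simp add: representation_sum representation_scale span_sum span_scale)
      also have "\<dots> = fps_nth (\<Sum>j\<in>J. a j * M i j) n"
        by (simp add: fps_sum_nth fps_mult_nth M_def)
      also have "(\<Sum>j\<in>J. a j * M i j) = 0" using a(2) that by (simp add: mult.commute)
      finally show ?thesis by simp
    qed
    moreover have "p (u n) = (\<Sum>i\<in>C. scale (representation C (p (u n)) i) i)"
      using C p(2) by (intro sum_representation_eq[symmetric]) auto
    ultimately show ?thesis by simp
  qed
  have Au0: "A (u 0) = 0" using U0 by (simp add: u_def lin_sum[OF A] lin_scale[OF A])
  have AuS: "A (u (Suc n)) = - B (u n)" for n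
  proof -
    have "A (u (Suc n)) = (\<Sum>j\<in>J. \<Sum>k=0..Suc n. scale (fps_nth (a j) k) (A (U j (Suc n - k))))"
      by (simp only: u_def lin_sum[OF A] lin_scale[OF A])
    also have "\<dots> = (\<Sum>j\<in>J. \<Sum>k=0..n. scale (fps_nth (a j) k) (- B (U j (n - k))))"
    proof (rule sum.cong[OF refl])
      fix j assume j: "j \<in> J"
      have "A (U j (Suc n - k)) = - B (U j (n - k))" if "k \<le> n" for k
        using US[OF j, of "n - k"] that by (simp add: Suc_diff_le eq_neg_iff_add_eq_0)
      thus "(\<Sum>k=0..Suc n. scale (fps_nth (a j) k) (A (U j (Suc n - k)))) =
          (\<Sum>k=0..n. scale (fps_nth (a j) k) (- B (U j (n - k))))"
        using U0(2)[OF j] by (simp add: sum.atLeast0_atMost_Suc)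
    qed
    also have "\<dots> = - B (u n)"
      by (simp add: u_def lin_sum[OF B] lin_scale[OF B] sum_negf)
    finally show ?thesis .
  qed
  \<comment> \<open>The first nonzero coefficient of the series \<open>a j\<close> survives in \<open>u\<close>.\<close>
  have u_nz: "\<exists>n. u n \<noteq> 0"
  proof -
    define N where "N = (LEAST n. \<exists>j\<in>J. fps_nth (a j) n \<noteq> 0)"
    have ex: "\<exists>n. \<exists>j\<in>J. fps_nth (a j) n \<noteq> 0" using a(1) by (metis fps_ext fps_zero_nth)
    have N: "\<exists>j\<in>J. fps_nth (a j) N \<noteq> 0" unfolding N_def by (rule LeastI_ex[OF ex])
    have low: "fps_nth (a j) k = 0" if "j \<in> J" "k < N" for j k
      using not_less_Least[of k "\<lambda>n. \<exists>j\<in>J. fps_nth (a j) n \<noteq> 0"] that N_def by blast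
    have "u N = (\<Sum>j\<in>J. scale (fps_nth (a j) N) j)"
      unfolding u_def
    proof (rule sum.cong[OF refl])
      fix j assume j: "j \<in> J"
      have "(\<Sum>k=0..N. scale (fps_nth (a j) k) (U j (N - k))) =
          (\<Sum>k\<in>{N}. scale (fps_nth (a j) k) (U j (N - k)))"
        by (rule sum.mono_neutral_right) (use low[OF j] in auto)
      thus "(\<Sum>k=0..N. scale (fps_nth (a j) k) (U j (N - k))) = scale (fps_nth (a j) N) j"
        using U0(1)[OF j] by simp
    qed
    moreover have "fps_nth (a j) N = 0" if "(\<Sum>j\<in>J. scale (fps_nth (a j) N) j) = 0" "j \<in> J" for j
      by (rule independentD[OF J(2,1) subset_refl that])
    ultimately have "u N \<noteq> 0" using N by auto
    thus ?thesis by blast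
  qed
  \<comment> \<open>All coefficients of \<open>u\<close> lie where \<open>F = 1 - E\<close> is nilpotent; there \<open>E\<close> is injective.\<close>
  define E where "E v = T (B v)" for v
  define F where "F v = v - E v" for v
  have E: "lin E" unfolding E_def by (rule lin_comp[OF T(1) B])
  have F: "lin F" unfolding F_def by (rule lin_minus[OF lin_id E])
  have FuA: "F (u n) = T (A (u n))" for n
    using id[of "u n"] pu[of n] by (simp add: F_def E_def lin_add[OF T(1)] algebra_simps)
  have Fu0: "F (u 0) = 0" using FuA Au0 lin_0[OF T(1)] by simp
  have FuS: "F (u (Suc n)) = - E (u n)" for n
    using FuA AuS by (simp add: E_def lin_neg[OF T(1)])
  note sG = gen_subspace[OF F, of 0]
  have EG: "E v \<in> geigenspace F 0" if "v \<in> geigenspace F 0" for v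
    using subspace_diff[OF sG that gen_closed[OF F that]] by (simp add: F_def)
  have uG: "u n \<in> geigenspace F 0" for n
  proof (induction n)
    case 0
    have "F (u 0) - scale 0 (u 0) \<in> geigenspace F 0" using Fu0 subspace_0[OF sG] by simp
    thus ?case by (rule gen_shiftI)
  next
    case (Suc n)
    have "F (u (Suc n)) - scale 0 (u (Suc n)) \<in> geigenspace F 0"
      using FuS EG[OF Suc] subspace_neg[OF sG] by simp
    thus ?case by (rule gen_shiftI)
  qed
  have Einj: "v = 0" if "v \<in> geigenspace F 0" "E v = 0" for v
    using gen_eigenvector[OF F that(1), of 1] that(2) by (simp add: F_def)
  have FE: "(F ^^ j) (E v) = E ((F ^^ j) v)" for j v
    by (induction j) (simp_all add: F_def lin_diff[OF E])
  have FG: "(F ^^ j) v \<in> geigenspace F 0" if "v \<in> geigenspace F 0" for j v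
    using that gen_closed[OF F] by (induction j) auto
  have zero: "(F ^^ j) (u (n + j)) = 0 \<Longrightarrow> u n = 0" for j n
  proof (induction j)
    case (Suc j)
    have "E ((F ^^ j) (u (n + j))) = - (F ^^ j) (F (u (Suc (n + j))))"
      by (simp add: FuS FE[symmetric] lin_neg[OF lin_funpow[OF F]])
    also have "\<dots> = 0" using Suc.prems by (simp add: funpow_swap1)
    finally have "(F ^^ j) (u (n + j)) = 0" by (rule Einj[OF FG[OF uG]])
    thus ?case by (rule Suc.IH)
  qed simp
  have "(F ^^ dimension) v = 0" if "v \<in> geigenspace F 0" for v
    by (rule nilpotent_bound[OF F sG _ _ dim_subset_UNIV that]) (use gen_closed[OF F] in auto)
  hence "u n = 0" for n using zero[of dimension n] uG by blast
  thus False using u_nz by blast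
qed

section \<open>Traces\<close>

text \<open>
  Meaningful for linear maps that preserve the subspace: then the choice of the basis does not matter.
\<close>

definition trace_on :: "'v set \<Rightarrow> ('v \<Rightarrow> 'v) \<Rightarrow> 'k" where
  "trace_on S f = (let B = (SOME B. B \<subseteq> S \<and> independent B \<and> S \<subseteq> span B) in
     \<Sum>b\<in>B. representation B (f b) b)"

abbreviation trace :: "('v \<Rightarrow> 'v) \<Rightarrow> 'k" where
  "trace \<equiv> trace_on UNIV"

lemma representation_sum_scale:
  assumes "independent B" "\<And>i. i \<in> I \<Longrightarrow> v i \<in> span B"
  shows "representation B (\<Sum>i\<in>I. scale (a i) (v i)) b = (\<Sum>i\<in>I. a i * representation B (v i) b)"
  using assms by (simp add: representation_sum representation_scale span_scale)

lemma representation_lin: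
  assumes B: "independent B" "finite B" and C: "independent C" "finite C"
    and "S = span B" "S = span C" and g: "lin g" "g ` S \<subseteq> S" and "s \<in> S"
  shows "representation B (g s) b = (\<Sum>c\<in>C. representation C s c * representation B (g c) b)"
proof -
  have s: "(\<Sum>c\<in>C. scale (representation C s c) c) = s"
    using assms by (intro sum_representation_eq) auto
  have "g s = (\<Sum>c\<in>C. scale (representation C s c) (g c))"
    by (subst (1) s[symmetric]) (simp only: lin_sum[OF g(1)] lin_scale[OF g(1)])
  moreover have "g c \<in> span B" if "c \<in> C" for c
    using that assms span_base by blast
  ultimately show ?thesis
    using representation_sum_scale[OF B(1), of C g "representation C s" b] by simp
qed

text \<open>Expand \<open>f b\<close> in a second basis and exchange the sums.\<close>

lemma trace_on_basis:
  assumes S: "subspace S" and B: "B \<subseteq> S" "independent B" "S \<subseteq> span B"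
    and f: "lin f" "f ` S \<subseteq> S"
  shows "trace_on S f = (\<Sum>b\<in>B. representation B (f b) b)"
proof -
  define C where "C = (SOME B. B \<subseteq> S \<and> independent B \<and> S \<subseteq> span B)"
  have C: "C \<subseteq> S \<and> independent C \<and> S \<subseteq> span C"
    unfolding C_def by (rule someI_ex) (use B in blast)
  have fin: "finite B" "finite C" using B C finiteI_independent by auto
  have sp: "S = span B" "S = span C" using B C S by (auto simp: span_subspace)
  have "(\<Sum>b\<in>B. representation B (f b) b) = (\<Sum>b\<in>B. \<Sum>c\<in>C. representation C (f b) c * representation B c b)"
    by (intro sum.cong refl representation_lin[where S = S, of B C "\<lambda>x. x"])
      (use B C fin sp f lin_id in auto)
  also have "\<dots> = (\<Sum>c\<in>C. \<Sum>b\<in>B. representation B c b * representation C (f b) c)"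
    by (subst sum.swap) (simp add: mult.commute)
  also have "\<dots> = (\<Sum>c\<in>C. representation C (f c) c)"
    by (intro sum.cong refl representation_lin[where S = S, of C B f, symmetric])
      (use B C fin sp f in auto)
  finally show ?thesis unfolding trace_on_def Let_def C_def by simp
qed

lemma trace_on_cong:
  assumes S: "subspace S" and f: "lin f" "f ` S \<subseteq> S" and g: "lin g"
    and eq: "\<And>s. s \<in> S \<Longrightarrow> f s = g s"
  shows "trace_on S f = trace_on S g"
proof -
  obtain B where B: "B \<subseteq> S" "independent B" "S \<subseteq> span B" using basis_of_subspace[OF S] by metis
  have "trace_on S g = (\<Sum>b\<in>B. representation B (g b) b)"
    by (rule trace_on_basis[OF S B g]) (use f eq in force)
  also have "\<dots> = trace_on S f"
    unfolding trace_on_basis[OF S B f] by (intro sum.cong) (use eq B in auto)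
  finally show ?thesis by simp
qed

lemma trace_on_add:
  assumes S: "subspace S" and f: "lin f" "f ` S \<subseteq> S"
    and g: "lin g" "g ` S \<subseteq> S"
  shows "trace_on S (\<lambda>v. f v + g v) = trace_on S f + trace_on S g"
proof -
  obtain B where B: "B \<subseteq> S" "independent B" "S \<subseteq> span B" using basis_of_subspace[OF S] by metis
  have "trace_on S (\<lambda>v. f v + g v) = (\<Sum>b\<in>B. representation B (f b + g b) b)"
    by (rule trace_on_basis[OF S B]) (use f g S in \<open>auto intro: lin_plus subspace_add\<close>)
  also have "\<dots> = trace_on S f + trace_on S g"
    unfolding trace_on_basis[OF S B f] trace_on_basis[OF S B g] sum.distrib[symmetric]
    by (intro sum.cong refl, subst representation_add) (use B f g in blast)+
  finally show ?thesis .
qed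

lemma trace_on_scale:
  assumes S: "subspace S" and f: "lin f" "f ` S \<subseteq> S"
  shows "trace_on S (\<lambda>v. scale a (f v)) = a * trace_on S f"
proof -
  obtain B where B: "B \<subseteq> S" "independent B" "S \<subseteq> span B" using basis_of_subspace[OF S] by metis
  have "trace_on S (\<lambda>v. scale a (f v)) = (\<Sum>b\<in>B. representation B (scale a (f b)) b)"
    by (rule trace_on_basis[OF S B]) (use f S in \<open>auto intro: lin_smult subspace_scale\<close>)
  also have "\<dots> = a * trace_on S f"
    unfolding trace_on_basis[OF S B f] sum_distrib_left
    by (intro sum.cong refl, subst representation_scale) (use B f in blast)+
  finally show ?thesis .
qed

lemma trace_on_diff:
  assumes S: "subspace S" and f: "lin f" "f ` S \<subseteq> S"
    and g: "lin g" "g ` S \<subseteq> S"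
  shows "trace_on S (\<lambda>v. f v - g v) = trace_on S f - trace_on S g"
proof -
  have "trace_on S (\<lambda>v. f v + scale (-1) (g v)) = trace_on S f + (-1) * trace_on S g"
    by (subst trace_on_add[OF S f]) (use trace_on_scale[OF S g, of "-1"] g S in
      \<open>auto intro!: vp.linear_compose_neg subspace_neg\<close>)
  thus ?thesis by simp
qed

lemma trace_on_commute:
  assumes S: "subspace S" and f: "lin f" "f ` S \<subseteq> S"
    and g: "lin g" "g ` S \<subseteq> S"
  shows "trace_on S (\<lambda>v. f (g v)) = trace_on S (\<lambda>v. g (f v))"
proof -
  obtain B where B: "B \<subseteq> S" "independent B" "S \<subseteq> span B" "S = span B" "finite B"
    using basis_of_subspace[OF S] by metis
  have 1: "trace_on S (\<lambda>v. f (g v)) = (\<Sum>b\<in>B. representation B (f (g b)) b)"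
    by (rule trace_on_basis[OF S B(1-3) lin_comp[OF f(1) g(1)]]) (use f g in auto)
  have 2: "trace_on S (\<lambda>v. g (f v)) = (\<Sum>b\<in>B. representation B (g (f b)) b)"
    by (rule trace_on_basis[OF S B(1-3) lin_comp[OF g(1) f(1)]]) (use f g in auto)
  have rep: "representation B (h (s)) b = (\<Sum>c\<in>B. representation B s c * representation B (h c) b)"
    if "lin h" "h ` S \<subseteq> S" "s \<in> S" for h s b
    by (rule representation_lin[where S = S]) (use that B in auto)
  have gB: "g b \<in> S" "f b \<in> S" if "b \<in> B" for b using that f g B by blast+
  have "(\<Sum>b\<in>B. representation B (f (g b)) b) =
      (\<Sum>b\<in>B. \<Sum>c\<in>B. representation B (g b) c * representation B (f c) b)"
    by (intro sum.cong refl rep f gB)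
  also have "\<dots> = (\<Sum>c\<in>B. \<Sum>b\<in>B. representation B (f c) b * representation B (g b) c)"
    by (subst sum.swap) (simp add: mult.commute)
  also have "\<dots> = (\<Sum>c\<in>B. representation B (g (f c)) c)"
    by (intro sum.cong refl rep[symmetric] g gB)
  finally show ?thesis using 1 2 by simp
qed

text \<open>
  In a basis that extends one of \<open>W\<close>, the other basis vectors do not contribute.
\<close>

lemma trace_on_image:
  assumes S: "subspace S" and W: "subspace W" "W \<subseteq> S"
    and f: "lin f" "f ` S \<subseteq> W"
  shows "trace_on S f = trace_on W f"
proof -
  obtain A where A: "A \<subseteq> W" "independent A" "W \<subseteq> span A" "W = span A"
    using basis_of_subspace[OF W(1)] by metis
  obtain B where B: "A \<subseteq> B" "B \<subseteq> S" "independent B" "S \<subseteq> span B"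
    using maximal_independent_subset_extend[of A S] A W by blast
  have fin: "finite B" using B finiteI_independent by auto
  have rep: "representation B (f b) b = (if b \<in> A then representation A (f b) b else 0)"
    if "b \<in> B" for b
  proof -
    have "f b \<in> span A" using that B f A by blast
    hence "representation B (f b) = representation A (f b)"
      by (rule representation_extend[OF B(3) _ B(1)])
    thus ?thesis using representation_ne_zero[of A "f b" b] by auto
  qed
  have "trace_on S f = (\<Sum>b\<in>B. representation B (f b) b)"
    by (rule trace_on_basis[OF S B(2-4) f(1)]) (use f W in auto)
  also have "\<dots> = (\<Sum>b\<in>A. representation A (f b) b)"
  proof -
    have "(\<Sum>b\<in>B. representation B (f b) b)
        = (\<Sum>b\<in>B. if b \<in> A then representation A (f b) b else 0)"
      by (intro sum.cong refl rep)
    thus ?thesis using B(1) fin by (simp add: sum.If_cases Int_absorb1)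
  qed
  also have "\<dots> = trace_on W f"
    by (rule trace_on_basis[OF W(1) A(1-3) f(1), symmetric]) (use f W in auto)
  finally show ?thesis .
qed

lemma trace_on_scalar:
  assumes S: "subspace S"
  shows "trace_on S (\<lambda>v. scale a v) = a * of_nat (dim S)"
proof -
  obtain B where B: "B \<subseteq> S" "independent B" "S \<subseteq> span B" "finite B" "card B = dim S"
    using basis_of_subspace[OF S] by metis
  have "trace_on S (\<lambda>v. scale a v) = (\<Sum>b\<in>B. representation B (scale a b) b)"
    by (rule trace_on_basis[OF S B(1-3) lin_homothety]) (use S subspace_scale in auto)
  also have "\<dots> = (\<Sum>b\<in>B. a)"
    by (intro sum.cong refl) (use B in \<open>auto simp: representation_scale span_base representation_basis\<close>)
  finally show ?thesis using B by simp
qed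

lemma trace_on_0: "trace_on {0} f = 0"
proof -
  define C where "C = (SOME B. B \<subseteq> {0::'v} \<and> independent B \<and> {0} \<subseteq> span B)"
  have C: "C \<subseteq> {0} \<and> independent C \<and> {0} \<subseteq> span C"
    unfolding C_def by (rule someI[of _ "{}"]) (simp add: independent_empty)
  hence "C = {}" using dependent_zero by (metis subset_singletonD insertI1)
  thus ?thesis unfolding trace_on_def Let_def C_def[symmetric] by simp
qed

lemma trace_on_setsum:
  assumes S: "subspace S" and f: "\<And>i. i \<in> I \<Longrightarrow> lin (f i)" "\<And>i. i \<in> I \<Longrightarrow> f i ` S \<subseteq> S"
  shows "trace_on S (\<lambda>v. \<Sum>i\<in>I. f i v) = (\<Sum>i\<in>I. trace_on S (f i))"
proof (cases "finite I")
  case True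
  thus ?thesis using f
  proof (induction I rule: finite_induct)
    case empty
    show ?case using trace_on_scalar[OF S, of 0] by simp
  next
    case (insert i I)
    have "trace_on S (\<lambda>v. f i v + (\<Sum>i\<in>I. f i v)) = trace_on S (f i) + trace_on S (\<lambda>v. \<Sum>i\<in>I. f i v)"
      using insert.prems by (intro trace_on_add[OF S] lin_setsum) (auto intro!: subspace_sum[OF S])
    thus ?case using insert by simp
  qed
next
  case False
  thus ?thesis using trace_on_scalar[OF S, of 0] by simp
qed

lemma trace_on_nilpotent:
  assumes f: "lin f"
    and "subspace S" "f ` S \<subseteq> S" "S \<subseteq> geigenspace f 0"
  shows "trace_on S f = 0"
  using assms(2-)
proof (induction "dim S" arbitrary: S rule: less_induct)
  case less
  show ?case
  proof (cases "S = {0}")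
    case False
    have "dim (f ` S) < dim S"
      using nilpotent_image_proper[OF f less.prems(1,3) False] less.prems(1,2)
      by (intro dim_psubset_subspace subspace_image_lin f) auto
    hence "trace_on (f ` S) f = 0"
      using less.prems by (intro less.hyps[of "f ` S"] subspace_image_lin f) auto
    moreover have "trace_on S f = trace_on (f ` S) f"
      using less.prems by (intro trace_on_image subspace_image_lin f) auto
    ultimately show ?thesis by simp
  qed (simp add: trace_on_0)
qed

lemma trace_on_gen:
  assumes f: "lin f" and W: "subspace W" "W \<subseteq> geigenspace f c" "f ` W \<subseteq> W"
  shows "trace_on W f = c * of_nat (dim W)"
proof -
  let ?g = "\<lambda>v. f v - scale c v"
  have st: "?g ` W \<subseteq> W" using W by (auto intro!: subspace_diff subspace_scale)
  have "trace_on W ?g = 0"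
    by (rule trace_on_nilpotent[OF lin_shift[OF f] W(1) st]) (use W(2) in \<open>auto simp: geigenspace_def\<close>)
  moreover have "trace_on W ?g = trace_on W f - trace_on W (\<lambda>v. scale c v)"
    by (rule trace_on_diff[OF W(1) f W(3) lin_homothety]) (use subspace_scale[OF W(1)] in auto)
  ultimately show ?thesis using trace_on_scalar[OF W(1)] by simp
qed

text \<open>
  On a generalised eigenspace \<open>D\<close> is the scalar \<open>\<phi> c\<close>, and \<open>f\<close> has trace \<open>c\<close> times the dimension.
\<close>

lemma trace_eigenvalue_calculus:
  assumes f: "lin f"
  shows "\<exists>C. finite C \<and> (\<forall>v. v \<in> span (\<Union>c\<in>C. geigenspace f c)) \<and>
    (\<forall>\<phi> D. lin D \<longrightarrow> (\<forall>c. \<forall>v\<in>geigenspace f c. D v = scale (\<phi> c) v) \<longrightarrow>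
      trace (\<lambda>v. f (D v)) = (\<Sum>c\<in>C. of_nat (dim (geigenspace f c)) * c * \<phi> c))"
proof -
  obtain C where C: "finite C" "\<forall>U u. subspace U \<longrightarrow> f ` U \<subseteq> U \<longrightarrow> u \<in> U \<longrightarrow>
    u \<in> span (\<Union>c\<in>C. geigenspace f c \<inter> U)" using gen_decomposition[OF f] by blast
  have sp: "v \<in> span (\<Union>c\<in>C. geigenspace f c)" for v
    using C(2)[rule_format, of UNIV v] by simp
  \<comment> \<open>The operators \<open>p c\<close> are the projections to the generalised eigenspaces.\<close>
  have "\<forall>c. \<exists>p. lin p \<and> (\<forall>d. \<forall>v\<in>geigenspace f d. p v = scale (if d = c then 1 else 0) v)"
    by (intro allI eigenvalue_calculus[OF f])
  then obtain p where p: "\<And>c. lin (p c)"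
    "\<And>c d v. v \<in> geigenspace f d \<Longrightarrow> p c v = scale (if d = c then 1 else 0) v" by metis
  have id: "(\<Sum>c\<in>C. p c v) = v" for v
  proof (rule vp.linear_eq_on[of "\<lambda>v. \<Sum>c\<in>C. p c v" "\<lambda>v. v" v "\<Union>c\<in>C. geigenspace f c"])
    show "lin (\<lambda>v. \<Sum>c\<in>C. p c v)" by (intro lin_setsum p(1))
    fix v assume "v \<in> (\<Union>c\<in>C. geigenspace f c)"
    then obtain d where d: "d \<in> C" "v \<in> geigenspace f d" by blast
    have "(\<Sum>c\<in>C. p c v) = (\<Sum>c\<in>C. if d = c then v else 0)"
      by (intro sum.cong) (auto simp: p(2)[OF d(2)])
    thus "(\<Sum>c\<in>C. p c v) = v" using d(1) C(1) by simp
  qed (use lin_id sp in auto)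
  have range: "p c v \<in> geigenspace f c" for c v
  proof -
    have "span (\<Union>c\<in>C. geigenspace f c) \<subseteq> {v. p c v \<in> geigenspace f c}"
    proof (rule span_minimal)
      show "subspace {v. p c v \<in> geigenspace f c}"
        by (rule vp.linear_subspace_linear_preimage[OF p(1) gen_subspace[OF f]])
    qed (auto simp: p(2) intro: subspace_0[OF gen_subspace[OF f]])
    thus ?thesis using sp by blast
  qed
  have "trace (\<lambda>v. f (D v)) = (\<Sum>c\<in>C. of_nat (dim (geigenspace f c)) * c * \<phi> c)"
    if D: "lin D" "\<And>c v. v \<in> geigenspace f c \<Longrightarrow> D v = scale (\<phi> c) v" for \<phi> D
  proof -
    have lfD: "lin (\<lambda>v. f (D (p c v)))" for c by (rule lin_comp[OF f lin_comp[OF D(1) p(1)]])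
    have "f (D (\<Sum>c\<in>C. p c v)) = (\<Sum>c\<in>C. f (D (p c v)))" for v
      by (simp only: lin_sum[OF D(1)] lin_sum[OF f])
    hence "trace (\<lambda>v. f (D v)) = trace (\<lambda>v. \<Sum>c\<in>C. f (D (p c v)))"
      unfolding id by (rule arg_cong[OF ext])
    also have "\<dots> = (\<Sum>c\<in>C. trace (\<lambda>v. f (D (p c v))))"
      by (rule trace_on_setsum) (auto simp: lfD)
    also have "\<dots> = (\<Sum>c\<in>C. of_nat (dim (geigenspace f c)) * c * \<phi> c)"
    proof (intro sum.cong refl)
      fix c
      have Dp: "D (p c v) = scale (\<phi> c) (p c v)" for v by (rule D(2)[OF range])
      have mem: "f (D (p c v)) \<in> geigenspace f c" for v
        unfolding Dp by (intro gen_closed f subspace_scale gen_subspace range)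
      have "trace (\<lambda>v. f (D (p c v))) = trace_on (geigenspace f c) (\<lambda>v. f (D (p c v)))"
        by (intro trace_on_image gen_subspace f lfD) (use mem in auto)
      also have "\<dots> = trace_on (geigenspace f c) (\<lambda>v. scale (\<phi> c) (f v))"
      proof (rule trace_on_cong[OF gen_subspace[OF f] lfD])
        show "lin (\<lambda>v. scale (\<phi> c) (f v))" by (rule lin_smult[OF f])
        show "f (D (p c s)) = scale (\<phi> c) (f s)" if "s \<in> geigenspace f c" for s
          unfolding Dp using p(2)[OF that, of c] by (simp add: lin_scale[OF f])
      qed (use mem in auto)
      also have "\<dots> = \<phi> c * trace_on (geigenspace f c) f"
        by (rule trace_on_scale[OF gen_subspace[OF f] f]) (use gen_closed[OF f] in auto)
      also have "trace_on (geigenspace f c) f = c * of_nat (dim (geigenspace f c))"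
        by (rule trace_on_gen[OF f gen_subspace[OF f]]) (use gen_closed[OF f] in auto)
      finally show "trace (\<lambda>v. f (D (p c v))) = of_nat (dim (geigenspace f c)) * c * \<phi> c"
        by (simp add: mult_ac)
    qed
    finally show ?thesis .
  qed
  with C(1) sp show ?thesis by (intro exI[of _ C]) simp
qed

text \<open>
  If \<open>d\<^sub>c\<close> are the multiplicities of the eigenvalues and \<open>\<psi>\<close> is a functional to the rationals, the
  hypothesis is \<open>\<Sum> d\<^sub>c c \<psi>(c) = 0\<close>.  Applying \<open>\<psi>\<close> once more gives \<open>\<Sum> d\<^sub>c \<psi>(c)\<^sup>2 = 0\<close>, a sum of nonnegative
  rationals.  Hence \<open>\<psi>(c) = 0\<close> for all such \<open>\<psi>\<close> and every eigenvalue is \<open>0\<close>.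
\<close>

lemma nilpotent_by_rational_traces:
  assumes f: "lin f"
    and tr: "\<And>\<psi> D. (\<And>x y. \<psi> (x + y) = \<psi> x + \<psi> y) \<Longrightarrow> lin D \<Longrightarrow>
      (\<And>c v. v \<in> geigenspace f c \<Longrightarrow> D v = scale (of_rat (\<psi> c)) v) \<Longrightarrow> trace (\<lambda>v. f (D v)) = 0"
  shows "geigenspace f 0 = UNIV"
proof -
  obtain C where C: "finite C" "\<forall>v. v \<in> span (\<Union>c\<in>C. geigenspace f c)"
    "\<forall>\<phi> D. lin D \<longrightarrow> (\<forall>c. \<forall>v\<in>geigenspace f c. D v = scale (\<phi> c) v) \<longrightarrow>
      trace (\<lambda>v. f (D v)) = (\<Sum>c\<in>C. of_nat (dim (geigenspace f c)) * c * \<phi> c)"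
    using trace_eigenvalue_calculus[OF f] by blast
  have "geigenspace f e = {0}" if e: "e \<in> C" "e \<noteq> 0" for e
  proof -
    obtain \<psi> :: "'k \<Rightarrow> rat" where \<psi>: "\<And>x y. \<psi> (x + y) = \<psi> x + \<psi> y"
      "\<And>q x. \<psi> (of_rat q * x) = q * \<psi> x" "\<psi> e = 1"
      using rational_functional_exists[OF e(2)] by blast
    obtain D where D: "lin D" "\<And>c v. v \<in> geigenspace f c \<Longrightarrow> D v = scale (of_rat (\<psi> c)) v"
      using eigenvalue_calculus[OF f, of "\<lambda>c. of_rat (\<psi> c)"] by blast
    have \<psi>0: "\<psi> 0 = 0" using \<psi>(1)[of 0 0] by simp
    have \<psi>sum: "\<psi> (\<Sum>c\<in>C. g c) = (\<Sum>c\<in>C. \<psi> (g c))" for g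
      by (induction C rule: infinite_finite_induct) (simp_all add: \<psi> \<psi>0)
    \<comment> \<open>The rational value \<open>\<psi> c\<close> is moved out of the argument of \<open>\<psi>\<close>.\<close>
    have "0 = \<psi> (\<Sum>c\<in>C. of_nat (dim (geigenspace f c)) * c * of_rat (\<psi> c))"
      using tr[OF \<psi>(1) D] C(3)[rule_format, of D "\<lambda>c. of_rat (\<psi> c)"] D \<psi>0 by simp
    also have "\<dots> = (\<Sum>c\<in>C. \<psi> (of_rat (of_nat (dim (geigenspace f c)) * \<psi> c) * c))"
      unfolding \<psi>sum by (intro sum.cong refl arg_cong[of _ _ \<psi>]) (simp add: of_rat_mult)
    also have "\<dots> = (\<Sum>c\<in>C. of_nat (dim (geigenspace f c)) * (\<psi> c)\<^sup>2)"
      by (simp only: \<psi>(2)) (simp add: power2_eq_square mult_ac)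
    finally have "\<forall>c\<in>C. of_nat (dim (geigenspace f c)) * (\<psi> c)\<^sup>2 = 0"
      by (subst (asm) eq_commute, subst (asm) sum_nonneg_eq_0_iff) (use C(1) in auto)
    hence "dim (geigenspace f e) = 0" using e(1) \<psi>(3) by force
    thus ?thesis by (simp add: dim_0_subspace gen_subspace f del: dim_eq_0)
  qed
  thus ?thesis by (rule nilpotent_if_eigenvalues_0[OF f C(2)])
qed

section \<open>Pencils of bilinear forms and the index\<close>

definition bilinear_form :: "('v \<Rightarrow> 'v \<Rightarrow> 'k) \<Rightarrow> bool" where
  "bilinear_form \<beta> \<longleftrightarrow> (\<forall>u v w c. \<beta> (u + v) w = \<beta> u w + \<beta> v w \<and> \<beta> (scale c u) w = c * \<beta> u w \<and>
    \<beta> w (u + v) = \<beta> w u + \<beta> w v \<and> \<beta> w (scale c u) = c * \<beta> w u)"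

definition form_kernel :: "('v \<Rightarrow> 'v \<Rightarrow> 'k) \<Rightarrow> 'v set" where
  "form_kernel \<beta> = {u. \<forall>v. \<beta> u v = 0}"

text \<open>
  The operator \<open>u \<mapsto> \<beta> u \<cdot>\<close>, with the dual space identified with \<open>'v\<close> by coordinates.
\<close>

definition form_op :: "('v \<Rightarrow> 'v \<Rightarrow> 'k) \<Rightarrow> 'v \<Rightarrow> 'v" where
  "form_op \<beta> u = (\<Sum>b\<in>Basis. scale (\<beta> u b) b)"

lemma form_op_lin: "bilinear_form \<beta> \<Longrightarrow> lin (form_op \<beta>)"
  by (rule linI) (simp_all add: form_op_def bilinear_form_def scale_left_distrib sum.distrib scale_sum_right)

lemma form_expand:
  assumes "bilinear_form \<beta>"
  shows "\<beta> u v = (\<Sum>b\<in>Basis. representation Basis v b * \<beta> u b)"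
  by (rule functional_expand) (use assms in \<open>auto simp: linear_functional_iff bilinear_form_def\<close>)

lemma form_kernel_op:
  assumes "bilinear_form \<beta>" shows "form_kernel \<beta> = {u. form_op \<beta> u = 0}"
proof (intro equalityI subsetI CollectI)
  fix u assume "u \<in> {u. form_op \<beta> u = 0}"
  hence "\<beta> u b = 0" if "b \<in> Basis" for b
    using coord_combination[OF that, of "\<beta> u"] independent_Basis by (simp add: form_op_def representation_zero)
  hence "(\<Sum>b\<in>Basis. representation Basis v b * \<beta> u b) = 0" for v by simp
  hence "\<beta> u v = 0" for v by (rule trans[OF form_expand[OF assms]])
  thus "u \<in> form_kernel \<beta>" unfolding form_kernel_def by blast
qed (simp add: form_kernel_def form_op_def)

lemma form_kernel_subspace: "bilinear_form \<beta> \<Longrightarrow> subspace (form_kernel \<beta>)"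
  using vp.linear_subspace_kernel[OF form_op_lin] by (simp add: form_kernel_op)

lemma bilinear_form_pencil:
  "bilinear_form \<beta> \<Longrightarrow> bilinear_form \<gamma> \<Longrightarrow> bilinear_form (\<lambda>u v. \<beta> u v + c * \<gamma> u v)"
  by (simp add: bilinear_form_def algebra_simps)

lemma form_op_pencil:
  "form_op (\<lambda>u v. \<beta> u v + c * \<gamma> u v) u = form_op \<beta> u + scale c (form_op \<gamma> u)"
  by (simp add: form_op_def scale_left_distrib sum.distrib scale_sum_right)

text \<open>
  On a complement of the kernel of \<open>\<beta>\<close> the pencil stays injective.
\<close>

lemma form_kernel_semicontinuous:
  assumes \<beta>: "bilinear_form \<beta>" and \<gamma>: "bilinear_form \<gamma>"
  shows "finite {c. \<not> dim (form_kernel (\<lambda>u v. \<beta> u v + c * \<gamma> u v)) \<le> dim (form_kernel \<beta>)}"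
proof -
  let ?K = "form_kernel \<beta>" and ?A = "form_op \<beta>" and ?B = "form_op \<gamma>"
  note A = form_op_lin[OF \<beta>] and B = form_op_lin[OF \<gamma>] and sK = form_kernel_subspace[OF \<beta>]
  obtain U where U: "subspace U" "U \<inter> ?K = {0}" "dim U + dim ?K = dimension"
    using complement_exists[OF sK subspace_UNIV subset_UNIV] unfolding dim_UNIV_dimension by blast
  have "\<forall>u\<in>U. ?A u \<in> {0} \<longrightarrow> u = 0" using U(2) by (auto simp: form_kernel_op[OF \<beta>])
  from pencil_injective[OF A B U(1) subspace_single_0 this]
  have fin: "finite {c. \<exists>u\<in>U. u \<noteq> 0 \<and> ?A u + scale c (?B u) \<in> {0}}" .
  have "dim (form_kernel (\<lambda>u v. \<beta> u v + c * \<gamma> u v)) \<le> dim ?K"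
    if c: "c \<notin> {c. \<exists>u\<in>U. u \<noteq> 0 \<and> ?A u + scale c (?B u) \<in> {0}}" for c
  proof -
    note bf = bilinear_form_pencil[OF \<beta> \<gamma>, of c]
    have "form_kernel (\<lambda>u v. \<beta> u v + c * \<gamma> u v) \<inter> U \<subseteq> {0}"
      using c by (auto simp: form_kernel_op[OF bf] form_op_pencil)
    from dim_disjoint[OF form_kernel_subspace[OF bf] U(1) this] show ?thesis using U(3) by simp
  qed
  thus ?thesis by (intro finite_subset[OF _ fin]) blast
qed

text \<open>
  At \<open>c = 0\<close> the vector \<open>x\<close> is in the left kernel and \<open>y\<close> in the right one.  The image of \<open>\<beta>\<close> is
  orthogonal to \<open>y\<close>, but the image of \<open>x\<close> under \<open>\<gamma>\<close> is not; hence for almost all \<open>c\<close> the image of the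
  pencil gains a dimension.
\<close>

lemma form_kernel_drops:
  assumes \<beta>: "bilinear_form \<beta>" and \<gamma>: "bilinear_form \<gamma>"
    and x: "\<And>v. \<beta> x v = 0" and y: "\<And>u. \<beta> u y = 0" and xy: "\<gamma> x y \<noteq> 0"
  shows "finite {c. \<not> dim (form_kernel (\<lambda>u v. \<beta> u v + c * \<gamma> u v)) < dim (form_kernel \<beta>)}"
proof -
  let ?K = "form_kernel \<beta>" and ?A = "form_op \<beta>" and ?B = "form_op \<gamma>"
  note A = form_op_lin[OF \<beta>] and B = form_op_lin[OF \<gamma>] and sK = form_kernel_subspace[OF \<beta>]
  obtain U where U: "subspace U" "U \<inter> ?K = {0}" "dim U + dim ?K = dimension"
    using complement_exists[OF sK subspace_UNIV subset_UNIV] unfolding dim_UNIV_dimension by blast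
  have Ax: "?A x = 0" by (simp add: form_op_def x)
  have xK: "x \<in> ?K" using x by (simp add: form_kernel_def)
  have x0: "x \<noteq> 0"
  proof
    assume "x = 0"
    hence "\<gamma> x y = \<gamma> (scale 0 x) y" by simp
    also have "\<dots> = 0 * \<gamma> x y" using \<gamma> unfolding bilinear_form_def by blast
    finally show False using xy by simp
  qed
  have xU: "x \<notin> U" using xK x0 U(2) by blast
  define V where "V = span (insert x U)"
  have V_iff: "v \<in> V \<longleftrightarrow> (\<exists>a. v - scale a x \<in> U)" for v
    unfolding V_def span_insert using U(1) by (simp add: span_eq_iff[THEN iffD2])
  have V: "subspace V" "dim V = Suc (dim U)"
    unfolding V_def using dim_span_insert[OF U(1) xU] by auto
  obtain p where p: "lin p" "\<forall>u\<in>span {x}. p u = u" "\<forall>u\<in>U. p u = 0"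
  proof -
    have "\<forall>u\<in>span {x}. u \<in> U \<longrightarrow> u = 0"
    proof (intro ballI impI)
      fix u assume u: "u \<in> span {x}" "u \<in> U"
      have "span {x} \<subseteq> ?K" using xK by (intro span_minimal sK) auto
      thus "u = 0" using u U(2) by blast
    qed
    from left_inverse_exists[OF lin_id subspace_span U(1) this] that show ?thesis by blast
  qed
  have px: "p x = x" using p(2) by (simp add: span_base)
  \<comment> \<open>The pencil is rescaled along \<open>x\<close>, where its leading part vanishes.\<close>
  let ?A' = "\<lambda>v. ?A v + ?B (p v)" and ?B' = "\<lambda>v. ?B v - ?B (p v)"
  have A': "lin ?A'" and B': "lin ?B'" by (intro lin_plus lin_minus A B lin_comp[OF B p(1)])+
  have "\<forall>v\<in>V. ?A' v \<in> {0} \<longrightarrow> v = 0"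
  proof (intro ballI impI)
    fix v assume "v \<in> V" "?A' v \<in> {0}"
    then obtain a where a: "v - scale a x \<in> U" and Av: "?A' v = 0" using V_iff by blast
    define u where "u = v - scale a x"
    have u: "u \<in> U" "v = u + scale a x" using a by (auto simp: u_def)
    have eq: "?A u + scale a (?B x) = 0"
      using Av p(3) u(1) px Ax by (simp add: u(2) lin_add[OF A] lin_add[OF p(1)] lin_scale[OF p(1)]
          lin_scale[OF A] lin_scale[OF B])
    \<comment> \<open>In coordinates, the image is paired with \<open>y\<close>.\<close>
    have "0 = (\<Sum>b\<in>Basis. representation Basis y b * representation Basis (?A u + scale a (?B x)) b)"
      using eq independent_Basis by (simp add: representation_zero)
    also have "\<dots> = (\<Sum>b\<in>Basis. representation Basis y b * (\<beta> u b + a * \<gamma> x b))"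
      by (intro sum.cong refl) (simp add: coord_add coord_scale form_op_def coord_combination)
    also have "\<dots> = \<beta> u y + a * \<gamma> x y"
      unfolding form_expand[OF \<beta>, of u y] form_expand[OF \<gamma>, of x y]
      by (simp add: sum_distrib_left sum.distrib algebra_simps)
    finally have "a = 0" using y xy by simp
    hence "?A u = 0" "v = u" using eq u(2) by auto
    thus "v = 0" using u(1) U(2) by (auto simp: form_kernel_op[OF \<beta>])
  qed
  from pencil_injective[OF A' B' V(1) subspace_single_0 this]
  have fin: "finite ({0} \<union> {c. \<exists>u\<in>V. u \<noteq> 0 \<and> ?A' u + scale c (?B' u) \<in> {0}})" by simp
  have "dim (form_kernel (\<lambda>u v. \<beta> u v + c * \<gamma> u v)) < dim ?K"
    if c: "c \<notin> {0} \<union> {c. \<exists>u\<in>V. u \<noteq> 0 \<and> ?A' u + scale c (?B' u) \<in> {0}}" for c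
  proof -
    note bf = bilinear_form_pencil[OF \<beta> \<gamma>, of c]
    have "form_kernel (\<lambda>u v. \<beta> u v + c * \<gamma> u v) \<inter> V \<subseteq> {0}"
    proof
      fix v assume v: "v \<in> form_kernel (\<lambda>u v. \<beta> u v + c * \<gamma> u v) \<inter> V"
      then obtain a where a: "v - scale a x \<in> U" using V_iff by blast
      define u where "u = v - scale a x"
      have u: "u \<in> U" "v = u + scale a x" using a by (auto simp: u_def)
      define v' where "v' = u + scale (c * a) x"
      have "v' \<in> V" using u(1) by (auto simp: V_iff v'_def intro!: exI[of _ "c * a"])
      have "?A v + scale c (?B v) = 0" using v by (simp add: form_kernel_op[OF bf] form_op_pencil)
      moreover have "?A' v' + scale c (?B' v') = ?A v + scale c (?B v)"
        using p(3) u(1) px Ax by (simp add: u(2) v'_def lin_add[OF A] lin_add[OF B] lin_add[OF p(1)]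
            lin_scale[OF p(1)] lin_scale[OF A] lin_scale[OF B] scale_right_distrib)
      ultimately have "v' = 0" using c \<open>v' \<in> V\<close> by auto
      hence "scale (c * a) x \<in> U" using u(1) subspace_neg[OF U(1)]
        by (metis add_eq_0_iff v'_def)
      from subspace_scale[OF U(1) this, of "inverse (c * a)"] have "c * a = 0"
        using xU by (cases "c * a = 0") (simp_all only: scale_scale left_inverse scale_one simp_thms)
      hence "a = 0" using c by simp
      thus "v \<in> {0}" using \<open>v' = 0\<close> u(2) by (simp add: v'_def)
    qed
    from dim_disjoint[OF form_kernel_subspace[OF bf] V(1) this] show ?thesis using U(3) V(2) by simp
  qed
  thus ?thesis by (intro finite_subset[OF _ fin]) blast
qed

lemma coadjoint_form:
  assumes "bilinear_map scale B" "functional \<xi>"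
  shows "bilinear_form (\<lambda>u v. \<xi> (B u v))"
  using assms unfolding bilinear_map_def bilinear_form_def linear_functional_iff lin_iff by simp

lemma coadjoint_stabiliser_form: "coadjoint_stabiliser B \<xi> = form_kernel (\<lambda>u v. \<xi> (B u v))"
  by (simp add: coadjoint_stabiliser_def form_kernel_def)

lemma lie_index_le:
  "functional \<xi> \<Longrightarrow> lie_index scale B \<le> dim (coadjoint_stabiliser B \<xi>)"
  unfolding lie_index_def by (rule Least_le) blast

lemma lie_index_attained:
  "\<exists>\<xi>. functional \<xi> \<and> lie_index scale B = dim (coadjoint_stabiliser B \<xi>)"
proof -
  have "functional (\<lambda>v. 0 :: 'k)" by (simp add: linear_functional_iff)
  hence "\<exists>d \<xi>. functional \<xi> \<and> d = dim (coadjoint_stabiliser B \<xi>)" by blast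
  from LeastI_ex[OF this] show ?thesis unfolding lie_index_def .
qed

end

section \<open>Brackets and derivations\<close>

locale closed_lie_algebra = alg_closed_space scale Basis + lie_algebra scale br
  for scale :: "'k::{alg_closed_field, field_char_0} \<Rightarrow> 'v::ab_group_add \<Rightarrow> 'v"
    and Basis :: "'v set" and br :: "'v \<Rightarrow> 'v \<Rightarrow> 'v"
begin

lemma br_lin: "lin (br x)" and br_lin_left: "lin (\<lambda>x. br x y)"
  using bilinear by (auto simp: bilinear_map_def)

lemmas br_add_right = lin_add[OF br_lin] and br_add_left = lin_add[OF br_lin_left]
  and br_scale_right = lin_scale[OF br_lin] and br_scale_left = lin_scale[OF br_lin_left]
  and br_diff_right = lin_diff[OF br_lin] and br_diff_left = lin_diff[OF br_lin_left]
  and br_neg_right = lin_neg[OF br_lin] and br_neg_left = lin_neg[OF br_lin_left]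
  and br_sum_right = lin_sum[OF br_lin] and br_sum_left = lin_sum[OF br_lin_left]

lemma br_0_right [simp]: "br x 0 = 0" and br_0_left [simp]: "br 0 x = 0"
  using lin_0[OF br_lin] lin_0[OF br_lin_left] by auto

lemma br_anti: "br x y = - br y x"
proof -
  have "0 = br (x + y) (x + y)" by (rule alternating[symmetric])
  also have "\<dots> = br x (x + y) + br y (x + y)" by (rule br_add_left)
  also have "\<dots> = br x y + br y x"
    by (simp only: br_add_right) (simp add: alternating)
  finally have "br x y + br y x = 0" by (rule sym)
  thus ?thesis by (simp add: eq_neg_iff_add_eq_0)
qed

lemma br_self [simp]: "br x x = 0" by (rule alternating)

lemma br_leibniz: "br x (br y z) = br (br x y) z + br y (br x z)"
proof -
  have "br x (br y z) + br y (br z x) + br z (br x y) = 0" by (rule jacobi)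
  moreover have "br y (br z x) = - br y (br x z)"
    by (subst br_anti[of z x]) (simp add: br_neg_right)
  moreover have "br z (br x y) = - br (br x y) z" by (rule br_anti)
  ultimately show ?thesis by (simp add: algebra_simps)
qed

lemma br_br: "br (br x y) z = br x (br y z) - br y (br x z)"
  by (simp add: br_leibniz[of x y z])

lemma lin_br_br: "lin (\<lambda>v. br x (br y v))"
  by (rule lin_comp[OF br_lin br_lin])

lemma gen_br_subspace: "subspace (geigenspace (br x) c)"
  by (rule gen_subspace[OF br_lin])

definition derivation :: "('v \<Rightarrow> 'v) \<Rightarrow> bool" where
  "derivation D \<longleftrightarrow> lin D \<and> (\<forall>x y. D (br x y) = br (D x) y + br x (D y))"

lemma derivation_br: "derivation (br x)"
  unfolding derivation_def using br_lin br_leibniz by blast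

lemma bracket_gen:
  assumes f: "derivation f" and "u \<in> geigenspace f c" "v \<in> geigenspace f d"
  shows "br u v \<in> geigenspace f (c + d)"
proof -
  have lf: "lin f" using f by (simp add: derivation_def)
  note sg = gen_subspace[OF lf]
  have "\<forall>v\<in>geigenspace f d. br u v \<in> geigenspace f (c + d)"
    using assms(2)
  proof (induction rule: gen_induct)
    case zero
    show ?case using subspace_0[OF sg] by simp
  next
    case u: (shift u)
    show ?case
    proof
      fix v assume "v \<in> geigenspace f d"
      thus "br u v \<in> geigenspace f (c + d)"
      proof (induction rule: gen_induct)
        case zero
        show ?case using subspace_0[OF sg] by simp
      next
        case v: (shift v)
        have "f (br u v) - scale (c + d) (br u v) = br (f u - scale c u) v + br u (f v - scale d v)"
          using f by (simp add: derivation_def br_diff_left br_diff_right br_scale_left br_scale_right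
              scale_left_distrib algebra_simps)
        also have "\<dots> \<in> geigenspace f (c + d)" using u v by (intro subspace_add[OF sg]) auto
        finally show ?case by (rule gen_shiftI)
      qed
    qed
  qed
  thus ?thesis using assms(3) by blast
qed

text \<open>
  An additive function of the eigenvalues of a derivation is again a derivation, because brackets add
  the eigenvalues.
\<close>

lemma additive_calculus_derivation:
  assumes f: "derivation f" and D: "lin D" "\<And>c v. v \<in> geigenspace f c \<Longrightarrow> D v = scale (\<phi> c) v"
    and add: "\<And>c d. \<phi> (c + d) = \<phi> c + \<phi> d"
  shows "derivation D"
proof -
  have lf: "lin f" using f by (simp add: derivation_def)
  obtain C where C: "finite C" "\<And>v. v \<in> span (\<Union>c\<in>C. geigenspace f c)"
    using trace_eigenvalue_calculus[OF lf] by blast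
  have "D (br x y) = br (D x) y + br x (D y)" for x y
  proof -
    let ?G = "\<Union>c\<in>C. geigenspace f c"
    have 1: "D (br u v) = br (D u) v + br u (D v)" if uv: "u \<in> ?G" "v \<in> ?G" for u v
    proof -
      obtain c d where "u \<in> geigenspace f c" "v \<in> geigenspace f d" using uv by blast
      thus ?thesis using bracket_gen[OF f, of u c v d]
        by (simp add: D(2) add br_scale_left br_scale_right scale_left_distrib)
    qed
    have lin1: "lin (\<lambda>v. D (br u v))" "lin (\<lambda>v. br (D u) v + br u (D v))" for u
      by (auto intro!: lin_plus lin_comp[OF D(1) br_lin] lin_comp[OF br_lin D(1)] br_lin)
    have 2: "D (br u v) = br (D u) v + br u (D v)" if "u \<in> ?G" for u v
      by (rule vp.linear_eq_on[OF lin1 C(2)]) (rule 1[OF that])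
    have lin2: "lin (\<lambda>u. D (br u v))" "lin (\<lambda>u. br (D u) v + br u (D v))" for v
      by (auto intro!: lin_plus lin_comp[OF D(1) br_lin_left] lin_comp[OF br_lin_left D(1)] br_lin_left)
    show ?thesis by (rule vp.linear_eq_on[OF lin2 C(2)]) (rule 2)
  qed
  thus ?thesis using D(1) by (simp add: derivation_def)
qed

lemma subalgebra_subspace: "lie_subalgebra scale br L \<Longrightarrow> subspace L"
  and subalgebra_closed: "lie_subalgebra scale br L \<Longrightarrow> x \<in> L \<Longrightarrow> y \<in> L \<Longrightarrow> br x y \<in> L"
  by (auto simp: lie_subalgebra_def)

lemma bracket_span_subspace: "subspace (bracket_span scale br A B)"
  by (simp add: bracket_span_def)

lemma bracket_in_span: "a \<in> A \<Longrightarrow> b \<in> B \<Longrightarrow> br a b \<in> bracket_span scale br A B"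
  unfolding bracket_span_def by (rule span_base) blast

lemma bracket_span_subset:
  assumes "subspace S" "\<And>a b. a \<in> A \<Longrightarrow> b \<in> B \<Longrightarrow> br a b \<in> S"
  shows "bracket_span scale br A B \<subseteq> S"
  unfolding bracket_span_def using assms by (intro span_minimal) auto

lemma bracket_span_mono:
  "A \<subseteq> A' \<Longrightarrow> B \<subseteq> B' \<Longrightarrow> bracket_span scale br A B \<subseteq> bracket_span scale br A' B'"
  by (intro bracket_span_subset bracket_span_subspace bracket_in_span) auto

definition generated :: "'v set \<Rightarrow> 'v set" where
  "generated X = \<Inter>{S. lie_subalgebra scale br S \<and> X \<subseteq> S}"

lemma generated_subalgebra: "lie_subalgebra scale br (generated X)"
  unfolding lie_subalgebra_def
proof
  show "subspace (generated X)"
    unfolding generated_def by (rule subspace_Inter) (auto simp: lie_subalgebra_def)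
qed (auto simp: generated_def lie_subalgebra_def)

lemma generated_base: "x \<in> X \<Longrightarrow> x \<in> generated X"
  by (auto simp: generated_def)

lemma generated_minimal: "lie_subalgebra scale br S \<Longrightarrow> X \<subseteq> S \<Longrightarrow> generated X \<subseteq> S"
  by (auto simp: generated_def)

section \<open>Engel's theorem\<close>

text \<open>
  Engel's theorem, relative to a pair \<open>W \<subset> U\<close> instead of on the quotient \<open>U / W\<close>.  Applied to the action
  of a maximal proper subalgebra \<open>K\<close> on the pair \<open>K \<subset> L\<close>, the induction hypothesis shows that \<open>K\<close> has
  codimension one, \<open>L = K + \<langle>x\<rangle>\<close>, with \<open>[K, x] \<subseteq> K\<close>.  Then \<open>x\<close> acts on the vectors of \<open>U\<close> that \<open>K\<close> maps to
  \<open>W\<close>, and the last iterate of such a vector under \<open>x\<close> outside \<open>W\<close> is the one sought.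
\<close>

lemma engel_vector:
  assumes "lie_subalgebra scale br L" "\<forall>x\<in>L. L \<subseteq> geigenspace (br x) 0"
    and "subspace U" "subspace W" "W \<subseteq> U" "W \<noteq> U"
    and "\<forall>x\<in>L. \<forall>y\<in>U. br x y \<in> U" "\<forall>x\<in>L. \<forall>y\<in>W. br x y \<in> W"
    and "\<forall>x\<in>L. \<forall>u\<in>U. \<exists>n. (br x ^^ n) u \<in> W"
  shows "\<exists>v\<in>U - W. \<forall>x\<in>L. br x v \<in> W"
  using assms
proof (induction "dim L" arbitrary: L U W rule: less_induct)
  case less
  note L = less.prems(1) and nil = less.prems(2) and U = less.prems(3) and W = less.prems(4)
    and st = less.prems(7,8) and nilU = less.prems(9)
  have sL: "subspace L" by (rule subalgebra_subspace[OF L])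
  show ?case
  proof (cases "L = {0}")
    case True
    obtain v where "v \<in> U - W" using less.prems(5,6) by blast
    thus ?thesis using True subspace_0[OF W] by auto
  next
    case False
    have "lie_subalgebra scale br {0}" by (simp add: lie_subalgebra_def)
    moreover have "{0} \<subset> L" using False subspace_0[OF sL] by auto
    ultimately obtain K where K: "lie_subalgebra scale br K" "K \<subset> L"
      and max: "\<And>K'. lie_subalgebra scale br K' \<Longrightarrow> K' \<subset> L \<Longrightarrow> dim K' \<le> dim K"
      using subspace_maximal_exists[of "\<lambda>K. lie_subalgebra scale br K \<and> K \<subset> L" "{0}"] by blast
    have sK: "subspace K" by (rule subalgebra_subspace[OF K(1)])
    have dK: "dim K < dim L" using K by (intro dim_psubset_subspace sK sL) auto
    have nilK: "\<forall>x\<in>K. K \<subseteq> geigenspace (br x) 0" using nil K by blast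
    have "\<exists>x\<in>L - K. \<forall>k\<in>K. br k x \<in> K"
    proof (rule less.hyps[OF dK K(1) nilK sL sK])
      show "\<forall>x\<in>K. \<forall>u\<in>L. \<exists>n. (br x ^^ n) u \<in> K"
      proof (intro ballI)
        fix x u assume "x \<in> K" "u \<in> L"
        hence "u \<in> geigenspace (br x) 0" using nil K by blast
        then obtain n where "(br x ^^ n) u = 0" by (auto simp: gen_0_iff)
        thus "\<exists>n. (br x ^^ n) u \<in> K" using subspace_0[OF sK] by (intro exI[of _ n]) simp
      qed
      show "\<forall>x\<in>K. \<forall>y\<in>L. br x y \<in> L" using subalgebra_closed[OF L] K by blast
      show "\<forall>x\<in>K. \<forall>y\<in>K. br x y \<in> K" using subalgebra_closed[OF K(1)] by blast
    qed (use K in auto)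
    then obtain x where x: "x \<in> L" "x \<notin> K" "\<forall>k\<in>K. br k x \<in> K" by blast
    \<comment> \<open>The span of \<open>K\<close> and \<open>x\<close> is a subalgebra, so it is \<open>L\<close> by maximality of \<open>K\<close>.\<close>
    define M where "M = span (insert x K)"
    have M_iff: "y \<in> M \<longleftrightarrow> (\<exists>c. y - scale c x \<in> K)" for y
      unfolding M_def span_insert using sK by (simp add: span_eq_iff[THEN iffD2])
    have "lie_subalgebra scale br M"
      unfolding lie_subalgebra_def
    proof (intro conjI ballI)
      fix y z assume "y \<in> M" "z \<in> M"
      then obtain c d where cd: "y - scale c x \<in> K" "z - scale d x \<in> K" by (auto simp: M_iff)
      let ?k = "y - scale c x" and ?l = "z - scale d x"
      have "br y z = br (?k + scale c x) (?l + scale d x)" by simp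
      also have "\<dots> = br ?k ?l + scale d (br ?k x) - scale c (br ?l x)"
        by (simp only: br_add_left br_add_right br_scale_left br_scale_right br_self br_anti[of x ?l])
          (simp add: algebra_simps)
      also have "\<dots> \<in> K" using cd x(3) subalgebra_closed[OF K(1)]
        by (intro subspace_add subspace_diff subspace_scale sK) auto
      finally show "br y z \<in> M" unfolding M_def
        using span_superset[of "insert x K"] by blast
    qed (simp add: M_def)
    moreover have "M \<subseteq> L" unfolding M_def using K x(1) by (intro span_minimal sL) auto
    moreover have "dim M = Suc (dim K)" unfolding M_def by (rule dim_span_insert[OF sK x(2)])
    ultimately have MeqL: "M = L" using max[of M] by fastforce
    have "\<exists>v\<in>U - W. \<forall>k\<in>K. br k v \<in> W"
      by (rule less.hyps[OF dK K(1) nilK U W less.prems(5,6)]) (use st nilU K in blast)+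
    then obtain v0 where v0: "v0 \<in> U" "v0 \<notin> W" "\<forall>k\<in>K. br k v0 \<in> W" by blast
    have pow: "(br x ^^ n) v0 \<in> U \<and> (\<forall>k\<in>K. br k ((br x ^^ n) v0) \<in> W)" for n
    proof (induction n)
      case (Suc n)
      let ?u = "(br x ^^ n) v0"
      have "br k (br x ?u) \<in> W" if "k \<in> K" for k
      proof -
        have "br (br k x) ?u \<in> W" "br x (br k ?u) \<in> W" using Suc that x st by auto
        thus ?thesis unfolding br_leibniz[of k x ?u] by (rule subspace_add[OF W])
      qed
      thus ?case using Suc st(1) x(1) by auto
    qed (use v0 in auto)
    define n where "n = (LEAST n. (br x ^^ n) v0 \<in> W)"
    have n: "(br x ^^ n) v0 \<in> W" unfolding n_def
      by (rule LeastI_ex) (use nilU x(1) v0(1) in blast)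
    have "n \<noteq> 0" using n v0(2) by (intro notI) simp
    then obtain k where k: "n = Suc k" using not0_implies_Suc by blast
    let ?v = "(br x ^^ k) v0"
    have vW: "?v \<notin> W" using not_less_Least[of k "\<lambda>n. (br x ^^ n) v0 \<in> W"] k n_def by auto
    have "br y ?v \<in> W" if y: "y \<in> L" for y
    proof -
      obtain c where c: "y - scale c x \<in> K" using y unfolding MeqL[symmetric] M_iff by blast
      have "br y ?v = br (y - scale c x) ?v + scale c (br x ?v)"
        by (simp add: br_diff_left br_scale_left)
      also have "\<dots> \<in> W" using pow[of k] c n unfolding k by (intro subspace_add subspace_scale W) simp_all
      finally show ?thesis .
    qed
    thus ?thesis using pow[of k] vW by blast
  qed
qed

text \<open>
  For a maximal proper invariant subspace \<open>W\<close> of \<open>C\<close>, Engel's theorem provides a vector outside \<open>W\<close>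
  which together with \<open>W\<close> spans an invariant subspace, hence \<open>C\<close>; so \<open>L\<close> maps \<open>C\<close> into \<open>W\<close>.
\<close>

lemma engel_bracket_proper:
  assumes L: "lie_subalgebra scale br L" "\<forall>x\<in>L. L \<subseteq> geigenspace (br x) 0"
    and C: "subspace C" "C \<noteq> {0}" "\<forall>x\<in>L. \<forall>y\<in>C. br x y \<in> C" "\<forall>x\<in>L. C \<subseteq> geigenspace (br x) 0"
  shows "bracket_span scale br L C \<noteq> C"
proof -
  let ?P = "\<lambda>W. subspace W \<and> W \<subset> C \<and> (\<forall>x\<in>L. \<forall>y\<in>W. br x y \<in> W)"
  have "?P {0}" using C subspace_0[OF C(1)] by auto
  then obtain W where W: "subspace W" "W \<subset> C" "\<forall>x\<in>L. \<forall>y\<in>W. br x y \<in> W"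
    and max: "\<And>W'. ?P W' \<Longrightarrow> dim W' \<le> dim W"
    using subspace_maximal_exists[of ?P "{0}"] by blast
  have "\<exists>v\<in>C - W. \<forall>x\<in>L. br x v \<in> W"
  proof (rule engel_vector[OF L C(1) W(1) _ _ C(3) W(3)])
    show "\<forall>x\<in>L. \<forall>u\<in>C. \<exists>n. (br x ^^ n) u \<in> W"
    proof (intro ballI)
      fix x u assume "x \<in> L" "u \<in> C"
      then obtain n where "(br x ^^ n) u = 0" using C(4) gen_0_iff by blast
      thus "\<exists>n. (br x ^^ n) u \<in> W" using subspace_0[OF W(1)] by (intro exI[of _ n]) simp
    qed
  qed (use W in auto)
  then obtain v where v: "v \<in> C" "v \<notin> W" "\<forall>x\<in>L. br x v \<in> W" by blast
  let ?M = "span (insert v W)"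
  have stab: "br x y \<in> W" if "x \<in> L" "y \<in> ?M" for x y
  proof -
    obtain c where "y - scale c v \<in> W"
      using \<open>y \<in> ?M\<close> W(1) by (auto simp: span_insert span_eq_iff[THEN iffD2])
    moreover have "br x y = br x (y - scale c v) + scale c (br x v)"
      by (simp add: br_diff_right br_scale_right)
    ultimately show ?thesis using W v that by (auto intro!: subspace_add subspace_scale W(1))
  qed
  have WM: "W \<subseteq> ?M" by (rule order_trans[OF _ span_superset]) blast
  have MC: "?M \<subseteq> C" using W v C by (intro span_minimal) auto
  have "\<not> ?P ?M" using max[of ?M] dim_span_insert[OF W(1) v(2)] by auto
  hence "?M = C" using MC WM stab by blast
  hence "bracket_span scale br L C \<subseteq> W" using stab by (intro bracket_span_subset W(1)) auto
  thus ?thesis using W(2) by blast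
qed

lemma lower_central_series_facts:
  assumes L: "lie_subalgebra scale br L"
  shows "subspace (lower_central_series scale br L n) \<and> lower_central_series scale br L n \<subseteq> L \<and>
    (\<forall>x\<in>L. \<forall>y\<in>lower_central_series scale br L n. br x y \<in> lower_central_series scale br L n)"
proof (induction n)
  case 0
  show ?case using subalgebra_subspace[OF L] subalgebra_closed[OF L] by auto
next
  case (Suc n)
  have sub: "bracket_span scale br L (lower_central_series scale br L n)
      \<subseteq> lower_central_series scale br L n"
    using Suc by (intro bracket_span_subset) auto
  show ?case using Suc sub by (auto simp: bracket_span_subspace intro!: bracket_in_span)
qed

lemma engel_nilpotent:
  assumes L: "lie_subalgebra scale br L" "\<forall>x\<in>L. L \<subseteq> geigenspace (br x) 0"
  shows "lie_nilpotent scale br L"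
  unfolding lie_nilpotent_def
proof (rule descending_chain_reaches_zero)
  note facts = lower_central_series_facts[OF L(1)]
  show "subspace (lower_central_series scale br L n)" for n using facts by blast
  show "lower_central_series scale br L (Suc n) \<subseteq> lower_central_series scale br L n" for n
    unfolding lower_central_series.simps using facts[of n] by (intro bracket_span_subset) auto
  show "lower_central_series scale br L (Suc n) \<noteq> lower_central_series scale br L n"
    if "lower_central_series scale br L n \<noteq> {0}" for n
    unfolding lower_central_series.simps
    by (rule engel_bracket_proper[OF L]) (use facts[of n] that L(2) in blast)+
qed

lemma derived_series_facts:
  assumes L: "lie_subalgebra scale br L"
  shows "subspace (derived_series scale br L n) \<and> derived_series scale br L n \<subseteq> L \<and>
    (\<forall>x\<in>L. \<forall>y\<in>derived_series scale br L n. br x y \<in> derived_series scale br L n)"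
proof (induction n)
  case 0
  show ?case using subalgebra_subspace[OF L] subalgebra_closed[OF L] by auto
next
  case (Suc n)
  let ?D = "derived_series scale br L n"
  have sub: "bracket_span scale br ?D ?D \<subseteq> ?D"
    using Suc by (intro bracket_span_subset) auto
  have "br x y \<in> bracket_span scale br ?D ?D" if x: "x \<in> L" and "y \<in> bracket_span scale br ?D ?D" for x y
  proof -
    have "bracket_span scale br ?D ?D \<subseteq> {y. br x y \<in> bracket_span scale br ?D ?D}"
    proof (rule bracket_span_subset)
      show "subspace {y. br x y \<in> bracket_span scale br ?D ?D}"
        by (rule vp.linear_subspace_linear_preimage[OF br_lin bracket_span_subspace])
      fix a b assume "a \<in> ?D" "b \<in> ?D"
      hence "br (br x a) b \<in> bracket_span scale br ?D ?D" "br a (br x b) \<in> bracket_span scale br ?D ?D"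
        using Suc x by (auto intro!: bracket_in_span)
      thus "br a b \<in> {y. br x y \<in> bracket_span scale br ?D ?D}"
        by (simp add: br_leibniz[of x a b] subspace_add bracket_span_subspace)
    qed
    thus ?thesis using that by blast
  qed
  thus ?case using Suc sub by (auto simp: bracket_span_subspace)
qed

lemma derived_series_subalgebra:
  "lie_subalgebra scale br L \<Longrightarrow> lie_subalgebra scale br (derived_series scale br L n)"
  using derived_series_facts[of L n] unfolding lie_subalgebra_def by blast

lemma derived_series_decreasing:
  "lie_subalgebra scale br L \<Longrightarrow> derived_series scale br L (Suc n) \<subseteq> derived_series scale br L n"
  using derived_series_subalgebra[of L n] unfolding derived_series.simps
  by (intro bracket_span_subset) (auto simp: lie_subalgebra_def)

lemma derived_series_add:
  "derived_series scale br L (s + t) = derived_series scale br (derived_series scale br L s) t"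
  by (induction t) simp_all

lemma solvable_if_derived_nilpotent:
  assumes L: "lie_subalgebra scale br L"
    and nil: "\<And>x. x \<in> bracket_span scale br L L \<Longrightarrow> geigenspace (br x) 0 = UNIV"
  shows "lie_solvable scale br L"
  unfolding lie_solvable_def
proof (rule descending_chain_reaches_zero)
  let ?D = "derived_series scale br L"
  show "subspace (?D n)" for n using derived_series_facts[OF L] by blast
  show "?D (Suc n) \<subseteq> ?D n" for n by (rule derived_series_decreasing[OF L])
  show "?D (Suc n) \<noteq> ?D n" if n: "?D n \<noteq> {0}" for n
  proof
    assume eq: "?D (Suc n) = ?D n"
    have "?D (Suc n) \<subseteq> bracket_span scale br L L"
      using derived_series_facts[OF L, of n] by (simp add: bracket_span_mono)
    hence nil': "\<forall>x\<in>?D n. ?D n \<subseteq> geigenspace (br x) 0" using nil eq by blast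
    have "bracket_span scale br (?D n) (?D n) \<noteq> ?D n"
      by (rule engel_bracket_proper[OF derived_series_subalgebra[OF L] nil'])
        (use derived_series_facts[OF L, of n] n nil' in blast)+
    thus False using eq by simp
  qed
qed

lemma nilpotent_solvable:
  assumes L: "lie_subalgebra scale br L" and "lie_nilpotent scale br L"
  shows "lie_solvable scale br L"
proof -
  obtain n where n: "lower_central_series scale br L n = {0}"
    using assms(2) by (auto simp: lie_nilpotent_def)
  have "derived_series scale br L k \<subseteq> lower_central_series scale br L k" for k
  proof (induction k)
    case (Suc k)
    thus ?case using derived_series_facts[OF L, of k] by (simp add: bracket_span_mono)
  qed simp
  hence "derived_series scale br L n = {0}"
    using n subspace_0 derived_series_facts[OF L, of n] by blast
  thus ?thesis by (auto simp: lie_solvable_def)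
qed

section \<open>Cartan subalgebras\<close>

lemma engel_subalgebra:
  assumes "lie_subalgebra scale br L"
  shows "lie_subalgebra scale br (L \<inter> geigenspace (br x) 0)"
  using bracket_gen[OF derivation_br, of _ x 0 _ 0] subalgebra_closed[OF assms]
    subspace_inter[OF subalgebra_subspace[OF assms] gen_br_subspace[of x 0]]
  by (auto simp: lie_subalgebra_def)

text \<open>
  Let \<open>E = L \<inter> geigenspace (br z) 0\<close> be the Engel subalgebra of \<open>z\<close>.  As \<open>br z\<close> is injective modulo \<open>E\<close>, so is \<open>br (z + c x)\<close> for almost all \<open>c\<close>; for these \<open>c\<close> the Engel
  subalgebra of \<open>z + c x\<close> is contained in \<open>E\<close>, and it equals \<open>E\<close> by minimality.  So a fixed power of
  \<open>br z + c br x\<close> vanishes on \<open>E\<close> for almost all \<open>c\<close>, and its leading coefficient in \<open>c\<close> is a power of \<open>br x\<close>.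
\<close>

lemma minimal_engel_subalgebra:
  assumes L: "lie_subalgebra scale br L" and K: "subspace K" "K \<subseteq> L" and z: "z \<in> K"
    and KE: "K \<subseteq> geigenspace (br z) 0"
    and min: "\<And>x. x \<in> K \<Longrightarrow> dim (L \<inter> geigenspace (br z) 0) \<le> dim (L \<inter> geigenspace (br x) 0)"
    and x: "x \<in> K"
  shows "L \<inter> geigenspace (br z) 0 \<subseteq> geigenspace (br x) 0"
proof
  define E where "E = L \<inter> geigenspace (br z) 0"
  have sL: "subspace L" by (rule subalgebra_subspace[OF L])
  have E: "lie_subalgebra scale br E" unfolding E_def by (rule engel_subalgebra[OF L])
  have sE: "subspace E" by (rule subalgebra_subspace[OF E])
  have KsubE: "K \<subseteq> E" using K KE by (auto simp: E_def)
  obtain U where U: "subspace U" "U \<subseteq> L" "U \<inter> E = {0}" "\<forall>s\<in>L. \<exists>u\<in>U. \<exists>w\<in>E. s = u + w"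
    using complement_exists[OF sE sL] E_def by blast
  have "\<forall>u\<in>U. br z u \<in> E \<longrightarrow> u = 0"
  proof (intro ballI impI)
    fix u assume u: "u \<in> U" "br z u \<in> E"
    have "br z u - scale 0 u \<in> geigenspace (br z) 0" using u(2) by (simp add: E_def)
    hence "u \<in> geigenspace (br z) 0" by (rule gen_shiftI)
    thus "u = 0" using u(1) U(2,3) by (auto simp: E_def)
  qed
  from pencil_injective[OF br_lin br_lin U(1) sE this, of x]
  have inf: "infinite (- {c. \<exists>u\<in>U. u \<noteq> 0 \<and> br z u + scale c (br x u) \<in> E})" (is "infinite ?S")
    unfolding Compl_eq_Diff_UNIV by (rule Diff_infinite_finite) (rule infinite_UNIV_char_0)
  have br_y: "br (z + scale c x) v = br z v + scale c (br x v)" for c v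
    by (simp add: br_add_left br_scale_left)
  fix v assume "v \<in> L \<inter> geigenspace (br z) 0"
  hence v: "v \<in> E" by (simp add: E_def)
  have zero: "((\<lambda>v. br z v + scale c (br x v)) ^^ dimension) v = 0" if c: "c \<in> ?S" for c
  proof -
    define y where "y = z + scale c x"
    have y: "y \<in> K" unfolding y_def using z x by (intro subspace_add subspace_scale K(1))
    hence yE: "y \<in> E" using KsubE by blast
    have "L \<inter> geigenspace (br y) 0 \<subseteq> E"
    proof
      fix w assume "w \<in> L \<inter> geigenspace (br y) 0"
      hence "w \<in> geigenspace (br y) 0" "w \<in> L" by auto
      thus "w \<in> E"
      proof (induction rule: gen_induct)
        case zero
        show ?case by (rule subspace_0[OF sE])
      next
        case (shift w)
        have "br y w \<in> L" using y K(2) shift.prems subalgebra_closed[OF L] by blast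
        hence bw: "br y w \<in> E" using shift.IH by simp
        obtain u e where ue: "u \<in> U" "e \<in> E" "w = u + e" using U(4) shift.prems by blast
        have "br y u = br y w - br y e" by (simp add: ue(3) br_add_right)
        also have "\<dots> \<in> E" using bw subalgebra_closed[OF E yE ue(2)] by (rule subspace_diff[OF sE])
        finally have "br z u + scale c (br x u) \<in> E" by (simp add: y_def br_y)
        hence "u = 0" using c ue(1) by blast
        thus ?case using ue by simp
      qed
    qed
    moreover have "dim E \<le> dim (L \<inter> geigenspace (br y) 0)" using min[OF y] by (simp add: E_def)
    ultimately have "L \<inter> geigenspace (br y) 0 = E"
      by (intro subspace_dim_equal subspace_inter sL gen_br_subspace sE)
    hence "E \<subseteq> geigenspace (br y) 0" by blast
    hence "(br y ^^ dimension) v = 0"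
      using subalgebra_closed[OF E yE]
      by (intro nilpotent_bound[OF br_lin sE _ _ dim_subset_UNIV v]) auto
    thus ?thesis by (simp add: y_def ext[OF br_y])
  qed
  obtain w where w: "\<And>c. ((\<lambda>v. br z v + scale c (br x v)) ^^ dimension) v = (\<Sum>j\<le>dimension. scale (c ^ j) (w j))"
    "w dimension = (br x ^^ dimension) v"
    using pencil_power[OF br_lin br_lin, where N = dimension and v = v] by blast
  have "w dimension = 0"
    by (rule vector_polynomial_zero[OF inf, where N = dimension]) (use zero w(1) in auto)
  thus "v \<in> geigenspace (br x) 0" using w(2) by (auto simp: gen_0_iff)
qed

text \<open>
  A minimal Engel subalgebra is nilpotent by Engel's theorem.  It is its own normaliser because it
  contains every \<open>x\<close> with \<open>[z, x]\<close> in it.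
\<close>

theorem cartan_subalgebra_exists:
  assumes L: "lie_subalgebra scale br L"
  shows "\<exists>H. cartan_subalgebra scale br L H"
proof -
  have sL: "subspace L" by (rule subalgebra_subspace[OF L])
  obtain z where z: "z \<in> L" "\<And>x. x \<in> L \<Longrightarrow> dim (L \<inter> geigenspace (br z) 0) \<le> dim (L \<inter> geigenspace (br x) 0)"
    using ex_has_least_nat[of "\<lambda>x. x \<in> L" 0 "\<lambda>x. dim (L \<inter> geigenspace (br x) 0)"] subspace_0[OF sL] by blast
  define E where "E = L \<inter> geigenspace (br z) 0"
  have E: "lie_subalgebra scale br E" unfolding E_def by (rule engel_subalgebra[OF L])
  have "z \<in> geigenspace (br z) 0" by (rule eigenvector_in_gen) simp
  hence zE: "z \<in> E" using z(1) by (simp add: E_def)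
  have "E \<subseteq> geigenspace (br x) 0" if "x \<in> E" for x
    unfolding E_def
    by (rule minimal_engel_subalgebra[OF L subalgebra_subspace[OF E] _ zE _ _ that])
      (use z in \<open>auto simp: E_def\<close>)
  hence "lie_nilpotent scale br E" by (intro engel_nilpotent E) blast
  moreover have "{x \<in> L. \<forall>h\<in>E. br x h \<in> E} = E"
  proof (intro equalityI subsetI)
    fix x assume "x \<in> {x \<in> L. \<forall>h\<in>E. br x h \<in> E}"
    hence x: "x \<in> L" "br x z \<in> E" using zE by auto
    have "br z x \<in> E" using x(2) br_anti[of z x] subspace_neg[OF subalgebra_subspace[OF E]] by simp
    hence "br z x - scale 0 x \<in> geigenspace (br z) 0" by (simp add: E_def)
    hence "x \<in> geigenspace (br z) 0" by (rule gen_shiftI)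
    thus "x \<in> E" using x by (simp add: E_def)
  next
    fix x assume "x \<in> E"
    thus "x \<in> {x \<in> L. \<forall>h\<in>E. br x h \<in> E}" using subalgebra_closed[OF E] by (auto simp: E_def)
  qed
  moreover have "E \<subseteq> L" by (auto simp: E_def)
  ultimately show ?thesis using E unfolding cartan_subalgebra_def by blast
qed

lemma lie_rank_cartan:
  assumes "lie_subalgebra scale br L"
  obtains H where "cartan_subalgebra scale br L H" "lie_rank scale br L = dim H"
  using someI_ex[OF cartan_subalgebra_exists[OF assms]] by (auto simp: lie_rank_def)

lemma lie_rank_abelian:
  assumes L: "lie_subalgebra scale br L" and "lie_abelian br L"
  shows "lie_rank scale br L = dim L"
proof -
  obtain H where H: "cartan_subalgebra scale br L H" "lie_rank scale br L = dim H"
    by (rule lie_rank_cartan[OF L])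
  have "H \<subseteq> L" "subspace H" "{x \<in> L. \<forall>h\<in>H. br x h \<in> H} = H"
    using H(1) by (auto simp: cartan_subalgebra_def lie_subalgebra_def)
  moreover have "br x h \<in> H" if "x \<in> L" "h \<in> H" for x h
    using that assms(2) \<open>H \<subseteq> L\<close> subspace_0[OF \<open>subspace H\<close>] by (auto simp: lie_abelian_def)
  ultimately have "H = L" by blast
  thus ?thesis using H(2) by simp
qed

lemma nilpotent_if_dim_eq_rank:
  assumes L: "lie_subalgebra scale br L" and "dim L = lie_rank scale br L"
  shows "lie_nilpotent scale br L"
proof -
  obtain H where H: "cartan_subalgebra scale br L H" "lie_rank scale br L = dim H"
    by (rule lie_rank_cartan[OF L])
  have "H = L"
    using H assms by (intro subspace_dim_equal) (auto simp: cartan_subalgebra_def lie_subalgebra_def)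
  thus ?thesis using H(1) by (simp add: cartan_subalgebra_def)
qed

section \<open>The Killing form\<close>

definition killing :: "'v \<Rightarrow> 'v \<Rightarrow> 'k" where
  "killing x y = trace (\<lambda>v. br x (br y v))"

lemma killing_add_left: "killing (x + x') y = killing x y + killing x' y"
  unfolding killing_def br_add_left by (rule trace_on_add) (auto simp: lin_br_br)

lemma killing_add_right: "killing x (y + y') = killing x y + killing x y'"
  unfolding killing_def br_add_left br_add_right by (rule trace_on_add) (auto simp: lin_br_br)

lemma killing_scale_left: "killing (scale a x) y = a * killing x y"
  unfolding killing_def br_scale_left by (rule trace_on_scale) (auto simp: lin_br_br)

lemma killing_scale_right: "killing x (scale a y) = a * killing x y"
  unfolding killing_def br_scale_left br_scale_right by (rule trace_on_scale) (auto simp: lin_br_br)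

lemma killing_lin: "functional (killing x)"
  by (simp add: linear_functional_iff killing_add_right killing_scale_right)

lemma killing_bilinear: "bilinear_form killing"
  by (simp add: bilinear_form_def killing_add_left killing_add_right killing_scale_left killing_scale_right)

lemma killing_0 [simp]: "killing x 0 = 0" "killing 0 x = 0"
  using killing_scale_left[of 0 0 x] killing_scale_right[of x 0 0] by auto

lemma killing_neg: "killing (- x) y = - killing x y" "killing x (- y) = - killing x y"
  using killing_scale_left[of "-1" x y] killing_scale_right[of x "-1" y] by auto

lemma killing_sum_right: "killing x (\<Sum>i\<in>I. y i) = (\<Sum>i\<in>I. killing x (y i))"
  by (induction I rule: infinite_finite_induct) (simp_all add: killing_add_right)

lemma killing_invariant: "killing (br x y) z = killing x (br y z)"
proof -
  have 3: "lin (\<lambda>v. br a (br b (br c v)))" for a b c by (rule lin_comp[OF br_lin lin_br_br])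
  have "killing (br x y) z =
      trace (\<lambda>v. br x (br y (br z v))) - trace (\<lambda>v. br y (br x (br z v)))"
    unfolding killing_def br_br by (rule trace_on_diff) (auto simp: 3)
  also have "trace (\<lambda>v. br y (br x (br z v))) = trace (\<lambda>v. br x (br z (br y v)))"
    using trace_on_commute[of UNIV "br y" "\<lambda>v. br x (br z v)"] by (simp add: br_lin lin_br_br)
  also have "trace (\<lambda>v. br x (br y (br z v))) - trace (\<lambda>v. br x (br z (br y v)))
      = killing x (br y z)"
    unfolding killing_def br_br br_diff_right by (rule trace_on_diff[symmetric]) (auto simp: 3)
  finally show ?thesis .
qed

text \<open>The product of commuting operators is nilpotent if one of them is.\<close>

lemma killing_nilpotent_commuting:
  assumes nil: "geigenspace (br n) 0 = UNIV" and comm: "br n w = 0"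
  shows "killing n w = 0"
proof -
  let ?F = "\<lambda>v. br n (br w v)"
  have swap: "br n (br w v) = br w (br n v)" for v by (simp add: br_leibniz[of n w v] comm)
  have "v \<in> geigenspace ?F 0" if "v \<in> geigenspace (br n) 0" for v
    using that
  proof (induction rule: gen_induct)
    case zero
    show ?case by (rule subspace_0[OF gen_subspace[OF lin_br_br]])
  next
    case (shift v)
    have "br w (br n v) \<in> geigenspace ?F 0"
    proof (rule gen_commute[OF lin_br_br br_lin])
      show "?F (br w v) = br w (?F v)" for v by (simp add: swap)
      show "br n v \<in> geigenspace ?F 0" using shift.IH by simp
    qed
    hence "?F v - scale 0 v \<in> geigenspace ?F 0" by (simp add: swap)
    thus ?case by (rule gen_shiftI)
  qed
  hence "UNIV \<subseteq> geigenspace ?F 0" using nil by blast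
  thus ?thesis unfolding killing_def
    by (intro trace_on_nilpotent lin_br_br) auto
qed

lemma trace_on_bracket:
  assumes "subspace V" "br x ` V \<subseteq> V" "br y ` V \<subseteq> V"
  shows "trace_on V (br (br x y)) = 0"
proof -
  have "trace_on V (\<lambda>v. br x (br y v) - br y (br x v)) =
      trace_on V (\<lambda>v. br x (br y v)) - trace_on V (\<lambda>v. br y (br x v))"
    by (rule trace_on_diff) (use assms in \<open>auto simp: lin_br_br\<close>)
  also have "\<dots> = 0" using trace_on_commute[of V "br x" "br y"] assms by (simp add: br_lin)
  finally show ?thesis unfolding br_br by simp
qed

text \<open>
  The operator maps \<open>C\<close> into \<open>[A, C]\<close>, which is a smaller subspace with the same invariance.
\<close>

lemma trace_through_nilpotent_ideal:
  assumes A: "lie_subalgebra scale br A" "\<forall>x\<in>A. geigenspace (br x) 0 = UNIV"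
    and x: "\<forall>a\<in>A. br x a \<in> A" and a: "a \<in> A"
    and "subspace C" "\<forall>a\<in>A. \<forall>y\<in>C. br a y \<in> C" "\<forall>y\<in>C. br x y \<in> C"
  shows "trace_on C (\<lambda>v. br a (br x v)) = 0"
  using assms(5-)
proof (induction "dim C" arbitrary: C rule: less_induct)
  case less
  note C = less.prems
  show ?case
  proof (cases "C = {0}")
    case True
    thus ?thesis by (simp add: trace_on_0)
  next
    case False
    let ?D = "bracket_span scale br A C"
    have D: "subspace ?D" "?D \<subseteq> C"
      using bracket_span_subspace bracket_span_subset[OF C(1)] C(2) by blast+
    have "?D \<noteq> C"
      by (rule engel_bracket_proper[OF A(1) _ C(1) False C(2)]) (use A(2) in blast)+
    hence dim: "dim ?D < dim C" using D C(1) by (intro dim_psubset_subspace) auto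
    have "?D \<subseteq> {y. br x y \<in> ?D}"
    proof (rule bracket_span_subset)
      show "subspace {y. br x y \<in> ?D}" by (rule vp.linear_subspace_linear_preimage[OF br_lin D(1)])
      fix b c assume "b \<in> A" "c \<in> C"
      hence "br (br x b) c \<in> ?D" "br b (br x c) \<in> ?D" using x C by (auto intro!: bracket_in_span)
      thus "b \<in> A \<Longrightarrow> c \<in> C \<Longrightarrow> br b c \<in> {y. br x y \<in> ?D}"
        by (simp add: br_leibniz[of x b c] subspace_add[OF D(1)])
    qed
    hence "\<forall>y\<in>?D. br x y \<in> ?D" by blast
    moreover have "\<forall>b\<in>A. \<forall>y\<in>?D. br b y \<in> ?D" using D(2) bracket_in_span by blast
    ultimately have "trace_on ?D (\<lambda>v. br a (br x v)) = 0"
      by (intro less.hyps[OF dim D(1)])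
    moreover have "trace_on C (\<lambda>v. br a (br x v)) = trace_on ?D (\<lambda>v. br a (br x v))"
      by (rule trace_on_image[OF C(1) D lin_br_br]) (use C a in \<open>auto intro!: bracket_in_span\<close>)
    ultimately show ?thesis by simp
  qed
qed

text \<open>
  If \<open>L\<close> is not abelian, its last nonzero derived algebra \<open>A\<close> is an abelian ideal contained in \<open>[L, L]\<close>.
  For \<open>a \<in> A\<close> the generalised eigenspaces of \<open>br a\<close> are invariant under \<open>L\<close>, because \<open>[a, [a, x]] = 0\<close>
  for \<open>x \<in> L\<close>.  As a sum of brackets, \<open>a\<close> has trace zero on each of them, so its eigenvalues vanish.
  Hence \<open>A\<close> acts nilpotently and is orthogonal to \<open>L\<close>.
\<close>

lemma solvable_nondegenerate_abelian:
  assumes L: "lie_subalgebra scale br L" and "lie_solvable scale br L"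
    and nondeg: "\<And>v. v \<in> L \<Longrightarrow> (\<And>w. w \<in> L \<Longrightarrow> killing v w = 0) \<Longrightarrow> v = 0"
  shows "lie_abelian br L"
proof (rule ccontr)
  assume na: "\<not> lie_abelian br L"
  let ?D = "derived_series scale br L"
  define n where "n = (LEAST n. ?D n = {0})"
  have n: "?D n = {0}" unfolding n_def
    by (rule LeastI_ex) (use assms(2) in \<open>simp add: lie_solvable_def\<close>)
  have "n \<noteq> 0" using n na by (intro notI) (simp add: lie_abelian_def)
  moreover have "n \<noteq> 1"
  proof
    assume "n = 1"
    hence "bracket_span scale br L L = {0}" using n by simp
    thus False using na bracket_in_span[of _ L _ L] by (auto simp: lie_abelian_def)
  qed
  ultimately obtain k where k: "n = Suc (Suc k)" by (metis One_nat_def not0_implies_Suc)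
  define A where "A = ?D (Suc k)"
  have A0: "A \<noteq> {0}" using not_less_Least[of "Suc k" "\<lambda>n. ?D n = {0}"] k n_def A_def by auto
  have A: "lie_subalgebra scale br A" unfolding A_def by (rule derived_series_subalgebra[OF L])
  have sA: "subspace A" by (rule subalgebra_subspace[OF A])
  have AL: "A \<subseteq> L" and ideal: "\<And>x a. x \<in> L \<Longrightarrow> a \<in> A \<Longrightarrow> br x a \<in> A"
    using derived_series_facts[OF L, of "Suc k"] unfolding A_def by auto
  have ab: "br a b = 0" if "a \<in> A" "b \<in> A" for a b
    using bracket_in_span[OF that] n k by (auto simp: A_def)
  have A_sub: "A \<subseteq> bracket_span scale br L L"
    using derived_series_facts[OF L, of k] by (simp add: A_def bracket_span_mono)
  have nil: "geigenspace (br a) 0 = UNIV" if a: "a \<in> A" for a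
  proof -
    obtain C where C: "\<forall>v. v \<in> span (\<Union>c\<in>C. geigenspace (br a) c)"
      using trace_eigenvalue_calculus[OF br_lin] by blast
    have "geigenspace (br a) c = {0}" if "c \<noteq> 0" for c
    proof -
      let ?V = "geigenspace (br a) c"
      let ?N = "{w. br w ` ?V \<subseteq> ?V \<and> trace_on ?V (br w) = 0}"
      have sV: "subspace ?V" by (rule gen_subspace[OF br_lin])
      have st: "br x ` ?V \<subseteq> ?V" if "x \<in> L" for x
      proof -
        have "br a x \<in> A" using ideal[OF that a] br_anti[of a x] subspace_neg[OF sA] by simp
        hence "(br a ^^ 2) x = 0" using ab[OF a] by (simp add: numeral_2_eq_2)
        hence "x \<in> geigenspace (br a) 0" unfolding gen_0_iff by blast
        thus ?thesis using bracket_gen[OF derivation_br, of x a 0 _ c] by auto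
      qed
      have "bracket_span scale br L L \<subseteq> ?N"
      proof (rule bracket_span_subset)
        show "subspace ?N"
        proof (rule subspaceI)
          show "0 \<in> ?N"
          proof -
            have "br 0 = (\<lambda>v. 0)" by auto
            thus ?thesis using trace_on_scalar[OF sV, of 0] subspace_0[OF sV] by auto
          qed
        next
          fix x y assume "x \<in> ?N"
            "y \<in> ?N"
          thus "x + y \<in> ?N"
            using trace_on_add[OF sV br_lin _ br_lin, of x y]
            by (auto simp: br_add_left ext[OF br_add_left] intro!: subspace_add[OF sV])
        next
          fix r x assume "x \<in> ?N"
          thus "scale r x \<in> ?N"
            using trace_on_scale[OF sV br_lin, of x r]
            by (auto simp: br_scale_left ext[OF br_scale_left] intro!: subspace_scale[OF sV])
        qed
        fix x y assume "x \<in> L" "y \<in> L"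
        thus "br x y \<in> ?N"
          using st trace_on_bracket[OF sV] subalgebra_closed[OF L] by simp
      qed
      hence "trace_on ?V (br a) = 0" using A_sub a by blast
      moreover have "trace_on ?V (br a) = c * of_nat (dim ?V)"
        by (rule trace_on_gen[OF br_lin sV]) (use gen_closed[OF br_lin] in auto)
      ultimately show ?thesis using that sV by (simp add: dim_0_subspace del: dim_eq_0)
    qed
    thus ?thesis by (rule nilpotent_if_eigenvalues_0[OF br_lin C])
  qed
  have "a = 0" if a: "a \<in> A" for a
  proof (rule nondeg)
    show "a \<in> L" using a AL by blast
    show "killing a w = 0" if "w \<in> L" for w
      unfolding killing_def
      by (rule trace_through_nilpotent_ideal[OF A]) (use nil ideal that a in auto)
  qed
  thus False using A0 subspace_0[OF sA] by blast
qed

section \<open>Centralizers under formal deformation\<close>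

text \<open>
  Formal power series with vector coefficients are represented by the sequences of their coefficients;
  their bracket is a convolution.
\<close>

definition conv :: "(nat \<Rightarrow> 'v) \<Rightarrow> (nat \<Rightarrow> 'v) \<Rightarrow> nat \<Rightarrow> 'v" where
  "conv p q n = (\<Sum>a=0..n. br (p a) (q (n - a)))"

lemma conv_leibniz: "conv p (conv q r) n = conv (conv p q) r n + conv q (conv p r) n"
proof -
  have "conv p (conv q r) n = (\<Sum>a=0..n. \<Sum>b=0..n - a. br (p a) (br (q b) (r (n - a - b))))"
    by (simp add: conv_def br_sum_right)
  also have "\<dots> = (\<Sum>a=0..n. \<Sum>b=0..n - a. br (br (p a) (q b)) (r (n - a - b)))
      + (\<Sum>a=0..n. \<Sum>b=0..n - a. br (q b) (br (p a) (r (n - a - b))))"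
    by (simp only: br_leibniz[of "p _" "q _" "r _"] sum.distrib)
  also have "(\<Sum>a=0..n. \<Sum>b=0..n - a. br (br (p a) (q b)) (r (n - a - b))) =
      (\<Sum>j=0..n. \<Sum>i=0..j. br (br (p i) (q (j - i))) (r (n - j)))"
    by (rule fps_mult_assoc_lemma[where f = "\<lambda>i j k. br (br (p i) (q j)) (r k)", symmetric])
  also have "\<dots> = conv (conv p q) r n" by (simp add: conv_def br_sum_left)
  also have "(\<Sum>a=0..n. \<Sum>b=0..n - a. br (q b) (br (p a) (r (n - a - b)))) =
      (\<Sum>b=0..n. \<Sum>a=0..n - b. br (q b) (br (p a) (r (n - a - b))))"
    by (rule triangle_swap)
  also have "\<dots> = conv q (conv p r) n"
    by (simp add: conv_def br_sum_right add.commute)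
  finally show ?thesis .
qed

definition fderiv :: "(nat \<Rightarrow> 'v) \<Rightarrow> nat \<Rightarrow> 'v" where
  "fderiv p n = scale (of_nat (Suc n)) (p (Suc n))"

lemma fderiv_conv: "fderiv (conv p q) n = conv (fderiv p) q n + conv p (fderiv q) n"
proof -
  let ?t = "\<lambda>a. br (p a) (q (Suc n - a))"
  have "fderiv (conv p q) n = (\<Sum>a=0..Suc n. scale (of_nat a) (?t a) + scale (of_nat (Suc n - a)) (?t a))"
    unfolding fderiv_def conv_def scale_sum_right
  proof (intro sum.cong refl)
    fix a assume "a \<in> {0..Suc n}"
    hence "Suc n = a + (Suc n - a)" by simp
    hence "(of_nat (Suc n) :: 'k) = of_nat a + of_nat (Suc n - a)" by (metis of_nat_add)
    thus "scale (of_nat (Suc n)) (?t a) = scale (of_nat a) (?t a) + scale (of_nat (Suc n - a)) (?t a)"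
      by (simp only: scale_left_distrib)
  qed
  also have "\<dots> = (\<Sum>a=0..Suc n. scale (of_nat a) (?t a)) + (\<Sum>a=0..Suc n. scale (of_nat (Suc n - a)) (?t a))"
    by (rule sum.distrib)
  also have "(\<Sum>a=0..Suc n. scale (of_nat a) (?t a)) = conv (fderiv p) q n"
    unfolding sum.atLeast0_atMost_Suc_shift by (simp add: conv_def fderiv_def br_scale_left)
  also have "(\<Sum>a=0..Suc n. scale (of_nat (Suc n - a)) (?t a)) = conv p (fderiv q) n"
    unfolding sum.atLeast0_atMost_Suc conv_def fderiv_def
    by (simp add: br_scale_right Suc_diff_le)
  finally show ?thesis .
qed

text \<open>
  The linear equation \<open>d' = [w, d]\<close> has only the zero solution with initial value zero.
\<close>

lemma ode_zero:
  assumes "d 0 = 0" "\<And>n. fderiv d n = conv w d n" shows "d n = 0"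
proof (induction n rule: less_induct)
  case (less n)
  show ?case
  proof (cases n)
    case 0
    thus ?thesis using assms(1) by simp
  next
    case (Suc k)
    have "conv w d k = 0" unfolding conv_def using less Suc by (intro sum.neutral) auto
    thus ?thesis using assms(2)[of k] by (simp add: Suc fderiv_def del: of_nat_Suc)
  qed
qed

text \<open>
  If every vector is \<open>[w, X 0] + c\<close> with \<open>c \<in> l\<close>, a formal curve \<open>X\<close> can be followed by a flow \<open>\<Psi>\<close>:
  the equations \<open>\<Psi>' = [w, \<Psi>]\<close> and \<open>X' = [w, X] + \<Psi> c\<close> with \<open>c\<close> in \<open>l\<close> are solved coefficient by coefficient.
  The coefficients of \<open>w\<close> and \<open>c\<close> of order \<open>n\<close> are chosen after the operator \<open>\<Psi> n\<close>, which only
  depends on earlier ones.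
\<close>

lemma straightening_exists:
  fixes X :: "nat \<Rightarrow> 'v" and l :: "'v set"
  assumes split: "\<And>y. \<exists>w c. y = br w (X 0) + c \<and> c \<in> l"
  shows "\<exists>w c \<Psi>. (\<forall>n. c n \<in> l) \<and> (\<forall>v. \<Psi> 0 v = v) \<and>
    (\<forall>v n. fderiv (\<lambda>n. \<Psi> n v) n = conv w (\<lambda>n. \<Psi> n v) n) \<and>
    (\<forall>n. fderiv X n = conv w X n + (\<Sum>a=0..n. \<Psi> (n - a) (c a)))"
proof -
  \<comment> \<open>The candidate \<open>r\<close> is the triple of \<open>w\<close>, \<open>c\<close> and \<open>\<Psi>\<close> at \<open>n\<close>;
    the terms that involve it are split off from the convolutions.\<close>
  define P where "P S n r \<longleftrightarrow>
    snd (snd r) = (if n = 0 then (\<lambda>v. v) else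
      (\<lambda>v. scale (inverse (of_nat n)) (\<Sum>a<n. br (fst (S a)) (snd (snd (S (n - 1 - a))) v)))) \<and>
    fst (snd r) \<in> l \<and>
    fderiv X n = (\<Sum>a<n. br (fst (S a)) (X (n - a))) + br (fst r) (X 0) +
      ((\<Sum>a<n. (if a = 0 then snd (snd r) else snd (snd (S (n - a)))) (fst (snd (S a)))) + fst (snd r))"
    for S :: "nat \<Rightarrow> 'v \<times> 'v \<times> ('v \<Rightarrow> 'v)" and n and r :: "'v \<times> 'v \<times> ('v \<Rightarrow> 'v)"
  have "\<exists>S. \<forall>n. P S n (S n)"
  proof (rule dependent_wf_choice[OF wf_less_than])
    fix f g :: "nat \<Rightarrow> 'v \<times> 'v \<times> ('v \<Rightarrow> 'v)" and n and r :: "'v \<times> 'v \<times> ('v \<Rightarrow> 'v)"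
    assume "\<And>z. (z, n) \<in> less_than \<Longrightarrow> f z = g z"
    hence eq: "f a = g a" if "a < n" for a using that by simp
    have 1: "(\<Sum>a<n. br (fst (f a)) (snd (snd (f (n - 1 - a))) v)) =
        (\<Sum>a<n. br (fst (g a)) (snd (snd (g (n - 1 - a))) v))" for v
      by (intro sum.cong refl) (simp add: eq)
    have 2: "(\<Sum>a<n. br (fst (f a)) (X (n - a))) = (\<Sum>a<n. br (fst (g a)) (X (n - a)))"
      by (intro sum.cong refl) (simp add: eq)
    have 3: "(\<Sum>a<n. (if a = 0 then snd (snd r) else snd (snd (f (n - a)))) (fst (snd (f a)))) =
        (\<Sum>a<n. (if a = 0 then snd (snd r) else snd (snd (g (n - a)))) (fst (snd (g a))))"
      by (intro sum.cong refl) (auto simp: eq)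
    show "P f n r = P g n r" unfolding P_def 1 2 3 ..
  next
    fix n and S :: "nat \<Rightarrow> 'v \<times> 'v \<times> ('v \<Rightarrow> 'v)"
    define \<psi> where "\<psi> = (if n = 0 then (\<lambda>v. v) else
      (\<lambda>v. scale (inverse (of_nat n)) (\<Sum>a<n. br (fst (S a)) (snd (snd (S (n - 1 - a))) v))))"
    obtain w c where "fderiv X n - (\<Sum>a<n. br (fst (S a)) (X (n - a))) -
        (\<Sum>a<n. (if a = 0 then \<psi> else snd (snd (S (n - a)))) (fst (snd (S a)))) = br w (X 0) + c" "c \<in> l"
      using split by blast
    hence "P S n (w, c, \<psi>)" unfolding P_def \<psi>_def[symmetric] fst_conv snd_conv by (simp add: algebra_simps)
    thus "\<exists>r. P S n r" by blast
  qed
  then obtain S where S: "\<And>n. P S n (S n)" by blast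
  define w c \<Psi> where "w n = fst (S n)" and "c n = fst (snd (S n))" and "\<Psi> n = snd (snd (S n))" for n
  have cl: "c n \<in> l" for n using S[of n] by (simp add: P_def c_def)
  have \<Psi>0: "\<Psi> 0 v = v" for v using S[of 0] by (simp add: P_def \<Psi>_def)
  have \<Psi>S: "fderiv (\<lambda>n. \<Psi> n v) n = conv w (\<lambda>n. \<Psi> n v) n" for v n
  proof -
    have "\<Psi> (Suc n) v = scale (inverse (of_nat (Suc n))) (\<Sum>a<Suc n. br (w a) (\<Psi> (n - a) v))"
      using S[of "Suc n"] unfolding P_def w_def \<Psi>_def by simp
    thus ?thesis
      by (simp add: fderiv_def conv_def atLeast0AtMost lessThan_Suc_atMost del: of_nat_Suc)
  qed
  have XS: "fderiv X n = conv w X n + (\<Sum>a=0..n. \<Psi> (n - a) (c a))" for n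
  proof -
    have "fderiv X n = (\<Sum>a<n. br (w a) (X (n - a))) + br (w n) (X 0) +
      ((\<Sum>a<n. (if a = 0 then \<Psi> n else \<Psi> (n - a)) (c a)) + c n)"
      using S[of n] unfolding P_def w_def c_def \<Psi>_def by blast
    also have "(\<Sum>a<n. (if a = 0 then \<Psi> n else \<Psi> (n - a)) (c a)) = (\<Sum>a<n. \<Psi> (n - a) (c a))"
      by (intro sum.cong) auto
    finally show ?thesis
      by (simp add: conv_def atLeast0AtMost lessThan_Suc_atMost[symmetric] \<Psi>0)
  qed
  show ?thesis using cl \<Psi>0 \<Psi>S XS by blast
qed

text \<open>
  Let \<open>l\<close> be the centralizer of \<open>h\<close> and let the flow \<open>\<Psi>\<close> follow the line \<open>X = h + s x\<close>.  Brackets of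
  \<open>\<Psi> u\<close> and \<open>\<Psi> v\<close> solve \<open>d' = [w, d]\<close>, so they stay zero for \<open>u, v \<in> l\<close>.  Therefore \<open>[X, \<Psi> u]\<close> solves
  the same equation and stays zero as well: \<open>\<Psi> u\<close> centralizes \<open>X\<close>.
\<close>

lemma formal_centralizer:
  assumes abelian: "\<And>u v. br h u = 0 \<Longrightarrow> br h v = 0 \<Longrightarrow> br u v = 0"
    and split: "\<And>y. \<exists>w c. y = br h w + c \<and> br h c = 0"
  shows "\<exists>U. \<forall>u. br h u = 0 \<longrightarrow> U u 0 = u \<and> (\<forall>n. br h (U u (Suc n)) + br x (U u n) = 0)"
proof -
  define X where "X n = (if n = 0 then h else if n = Suc 0 then x else 0)" for n
  have "\<exists>w c. y = br w (X 0) + c \<and> c \<in> {c. br h c = 0}" for y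
  proof -
    obtain w c where "y = br h w + c" "br h c = 0" using split by blast
    thus ?thesis
      by (intro exI[of _ "- w"] exI[of _ c]) (simp add: X_def br_neg_left br_anti[of w h])
  qed
  from straightening_exists[of X, OF this] obtain w c \<Psi>
    where c: "\<And>n. br h (c n) = 0" and \<Psi>0: "\<And>v. \<Psi> 0 v = v"
      and \<Psi>S: "\<And>v. fderiv (\<lambda>n. \<Psi> n v) = conv w (\<lambda>n. \<Psi> n v)"
      and XS: "fderiv X = (\<lambda>n. conv w X n + (\<Sum>a=0..n. \<Psi> (n - a) (c a)))"
    by (auto simp: fun_eq_iff)
  define flow where "flow u = (\<lambda>n. \<Psi> n u)" for u
  have comm: "conv (flow u) (flow v) n = 0" if uv: "br h u = 0" "br h v = 0" for u v n
  proof (rule ode_zero)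
    show "conv (flow u) (flow v) 0 = 0"
      using abelian[OF uv] by (simp add: conv_def flow_def \<Psi>0)
    show "fderiv (conv (flow u) (flow v)) n = conv w (conv (flow u) (flow v)) n" for n
      unfolding fderiv_conv by (simp add: flow_def \<Psi>S conv_leibniz[of w])
  qed
  have "conv X (flow u) n = 0" if u: "br h u = 0" for u n
  proof (rule ode_zero)
    show "conv X (flow u) 0 = 0" using u by (simp add: conv_def flow_def \<Psi>0 X_def)
    fix n
    have "conv (fderiv X) (flow u) n = conv (conv w X) (flow u) n +
        (\<Sum>k=0..n. \<Sum>a=0..k. br (\<Psi> (k - a) (c a)) (\<Psi> (n - k) u))"
      by (simp add: XS conv_def br_add_left br_sum_left sum.distrib flow_def)
    also have "(\<Sum>k=0..n. \<Sum>a=0..k. br (\<Psi> (k - a) (c a)) (\<Psi> (n - k) u)) =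
        (\<Sum>a=0..n. \<Sum>b=0..n - a. br (\<Psi> b (c a)) (\<Psi> (n - a - b) u))"
      by (rule fps_mult_assoc_lemma[where f = "\<lambda>a b e. br (\<Psi> b (c a)) (\<Psi> e u)"])
    also have "\<dots> = (\<Sum>a=0..n. conv (flow (c a)) (flow u) (n - a))"
      by (simp add: conv_def flow_def)
    also have "\<dots> = 0" using comm[OF c u] by simp
    finally show "fderiv (conv X (flow u)) n = conv w (conv X (flow u)) n"
      unfolding fderiv_conv by (simp add: flow_def \<Psi>S conv_leibniz[of w])
  qed
  note XU = this
  have "br h (\<Psi> (Suc n) u) + br x (\<Psi> n u) = 0" if u: "br h u = 0" for u n
  proof -
    have "conv X (flow u) (Suc n) = (\<Sum>a\<in>{0, Suc 0}. br (X a) (flow u (Suc n - a)))"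
      unfolding conv_def by (rule sum.mono_neutral_right) (auto simp: X_def)
    thus ?thesis using XU[OF u, of "Suc n"] by (simp add: X_def flow_def)
  qed
  thus ?thesis using \<Psi>0 by (intro exI[of _ "\<lambda>u n. \<Psi> n u"]) auto
qed

text \<open>
  The centralizer of \<open>h\<close> extends to a formal centralizer of the line from \<open>h\<close> to \<open>y\<close>, which bounds the
  centralizer of \<open>y\<close> from below.
\<close>

theorem abelian_centralizer_minimal:
  assumes abelian: "\<And>u v. br h u = 0 \<Longrightarrow> br h v = 0 \<Longrightarrow> br u v = 0"
    and split: "\<And>y. \<exists>w c. y = br h w + c \<and> br h c = 0"
  shows "dim {v. br h v = 0} \<le> dim {v. br y v = 0}"
proof -
  obtain U where U: "\<And>u. br h u = 0 \<Longrightarrow> U u 0 = u"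
    "\<And>u n. br h u = 0 \<Longrightarrow> br h (U u (Suc n)) + br (y - h) (U u n) = 0"
    using formal_centralizer[OF assms, of "y - h"] by blast
  have "subspace {v. br h v = 0}" by (rule vp.linear_subspace_kernel[OF br_lin])
  then obtain J where J: "J \<subseteq> {v. br h v = 0}" "independent J" "finite J" "card J = dim {v. br h v = 0}"
    using basis_of_subspace by metis
  have "card J \<le> dim {v. br h v + br (y - h) v = 0}"
    by (rule pencil_formal_kernel[OF br_lin br_lin J(3,2), of U]) (use U J(1) in auto)
  thus ?thesis using J(4) by (simp add: br_diff_left)
qed

end

section \<open>Cartan's criterion\<close>

locale closed_semisimple_lie_algebra = closed_lie_algebra scale Basis br + semisimple_lie_algebra scale br
  for scale :: "'k::{alg_closed_field, field_char_0} \<Rightarrow> 'v::ab_group_add \<Rightarrow> 'v"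
    and Basis :: "'v set" and br :: "'v \<Rightarrow> 'v \<Rightarrow> 'v"
begin

lemma lin_br_triple: "lin f \<Longrightarrow> lin (\<lambda>v. br x (br y (f v)))" "lin f \<Longrightarrow> lin (\<lambda>v. br x (f (br y v)))"
    "lin f \<Longrightarrow> lin (\<lambda>v. f (br x (br y v)))"
  by (auto intro: lin_comp[OF br_lin lin_comp[OF br_lin]] lin_comp[OF br_lin lin_comp[OF _ br_lin]]
      lin_comp[OF _ lin_br_br])

text \<open>
  For \<open>x = \<Sum> [a\<^sub>i, b\<^sub>i]\<close> and a derivation \<open>D\<close> the trace of \<open>br x \<circ> D\<close> is \<open>- \<Sum> killing a\<^sub>i (D b\<^sub>i)\<close>, which
  vanishes for \<open>a\<^sub>i\<close> in the radical.  Rational functionals of the eigenvalues of \<open>br x\<close> are derivations,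
  so the trace criterion for nilpotency applies.
\<close>

lemma killing_radical_nilpotent:
  assumes P: "P = {x. \<forall>y. killing x y = 0}" and x: "x \<in> bracket_span scale br P P"
  shows "geigenspace (br x) 0 = UNIV"
proof (rule nilpotent_by_rational_traces[OF br_lin])
  fix \<psi> :: "'k \<Rightarrow> rat" and D
  assume \<psi>: "\<And>x y. \<psi> (x + y) = \<psi> x + \<psi> y" and D: "lin D"
    and "\<And>c v. v \<in> geigenspace (br x) c \<Longrightarrow> D v = scale (of_rat (\<psi> c)) v"
  hence der: "derivation D"
    by (intro additive_calculus_derivation[OF derivation_br, of D x "\<lambda>c. of_rat (\<psi> c)"])
      (simp_all add: of_rat_add)
  have lD: "lin (\<lambda>v. br w (D v))" for w by (rule lin_comp[OF br_lin D])
  let ?T = "{w. trace (\<lambda>v. br w (D v)) = 0}"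
  have "bracket_span scale br P P \<subseteq> ?T"
  proof (rule bracket_span_subset)
    show "subspace ?T"
    proof (rule subspaceI)
      show "0 \<in> ?T" using trace_on_scalar[of UNIV 0] by simp
      fix a b assume "a \<in> ?T" "b \<in> ?T"
      thus "a + b \<in> ?T" using trace_on_add[of UNIV "\<lambda>v. br a (D v)" "\<lambda>v. br b (D v)"]
        by (simp add: br_add_left lD)
    next
      fix c a assume "a \<in> ?T"
      thus "scale c a \<in> ?T" using trace_on_scale[of UNIV "\<lambda>v. br a (D v)" c]
        by (simp add: br_scale_left lD)
    qed
    fix a b assume "a \<in> P"
    have "trace (\<lambda>v. br (br a b) (D v)) =
        trace (\<lambda>v. br a (br b (D v))) - trace (\<lambda>v. br b (br a (D v)))"
      unfolding br_br by (rule trace_on_diff) (auto simp: lin_br_triple D)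
    also have "trace (\<lambda>v. br b (br a (D v))) = trace (\<lambda>v. br a (D (br b v)))"
      using trace_on_commute[of UNIV "br b" "\<lambda>v. br a (D v)"] by (simp add: br_lin lD)
    also have "trace (\<lambda>v. br a (br b (D v))) - trace (\<lambda>v. br a (D (br b v)))
        = trace (\<lambda>v. br a (br b (D v)) - br a (D (br b v)))"
      by (rule trace_on_diff[symmetric]) (auto simp: lin_br_triple D)
    also have "(\<lambda>v. br a (br b (D v)) - br a (D (br b v))) = (\<lambda>v. br a (br (- D b) v))"
      using der by (auto simp: derivation_def br_add_right br_neg_left br_neg_right)
    also have "trace \<dots> = 0"
      using \<open>a \<in> P\<close> by (auto simp: P killing_def)
    finally show "br a b \<in> ?T" by simp
  qed
  thus "trace (\<lambda>v. br x (D v)) = 0" using x by blast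
qed

text \<open>
  Cartan's criterion: the radical of the Killing form is an ideal whose derived algebra acts
  nilpotently, so it is solvable.
\<close>

theorem killing_nondegenerate:
  assumes "\<And>y. killing x y = 0" shows "x = 0"
proof -
  define P where "P = {x. \<forall>y. killing x y = 0}"
  have sub: "subspace P"
    by (rule subspaceI) (auto simp: P_def killing_add_left killing_scale_left)
  have ideal: "br y x \<in> P" if "x \<in> P" for x y
  proof -
    have "killing (br y x) z = 0" for z
      using that killing_invariant[of x y z] br_anti[of y x] by (simp add: P_def killing_neg)
    thus ?thesis by (simp add: P_def)
  qed
  have "lie_subalgebra scale br P" using sub ideal by (simp add: lie_subalgebra_def)
  hence "lie_solvable scale br P"
    using killing_radical_nilpotent[OF P_def] by (rule solvable_if_derived_nilpotent)
  moreover have "lie_ideal scale br P" using sub ideal by (simp add: lie_ideal_def)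
  ultimately have "P = {0}" using solvable_ideal_trivial by blast
  thus ?thesis using assms by (auto simp: P_def)
qed

lemma killing_represents:
  assumes \<xi>: "functional \<xi>"
  shows "\<exists>x. \<forall>y. \<xi> y = killing x y"
proof -
  note J = form_op_lin[OF killing_bilinear]
  have "inj (form_op killing)"
  proof (subst vp.linear_inj_iff_eq_0[OF J], intro allI impI)
    fix x assume "form_op killing x = 0"
    hence "x \<in> form_kernel killing" by (simp add: form_kernel_op[OF killing_bilinear])
    thus "x = 0" using killing_nondegenerate by (simp add: form_kernel_def)
  qed
  hence "surj (form_op killing)" by (rule linear_inj_imp_surj[OF J])
  then obtain x where x: "form_op killing x = (\<Sum>b\<in>Basis. scale (\<xi> b) b)" by (metis surj_def)
  have "\<xi> b = killing x b" if "b \<in> Basis" for b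
    using x coord_combination[OF that, of "killing x"] coord_combination[OF that, of \<xi>]
    by (simp add: form_op_def)
  hence "\<xi> y = killing x y" for y
    using functional_expand[OF \<xi>, of y] functional_expand[OF killing_lin, of x y] by simp
  thus ?thesis by blast
qed

text \<open>
  Choose \<open>d\<close> such that \<open>killing d x\<close> is the trace of \<open>D \<circ> br x\<close>.  Then \<open>E = D - br d\<close> is a derivation with
  all traces of \<open>E \<circ> br x\<close> zero.  As \<open>br (E x)\<close> is the commutator of \<open>E\<close> and \<open>br x\<close>, the number
  \<open>killing (E x) y\<close> is the trace of \<open>E \<circ> br [x, y]\<close>, so \<open>E x\<close> is in the radical.
\<close>

lemma derivation_inner:
  assumes der: "derivation D" shows "\<exists>d. \<forall>v. D v = br d v"
proof -
  have D: "lin D" using der by (simp add: derivation_def)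
  have tr_lin: "functional (\<lambda>x. trace (\<lambda>v. D (br x v)))"
  proof -
    have l: "lin (\<lambda>v. D (br x v))" for x by (rule lin_comp[OF D br_lin])
    have "trace (\<lambda>v. D (br x v) + D (br y v)) =
        trace (\<lambda>v. D (br x v)) + trace (\<lambda>v. D (br y v))" for x y
      by (rule trace_on_add) (auto simp: l)
    moreover have "trace (\<lambda>v. scale c (D (br x v))) = c * trace (\<lambda>v. D (br x v))" for c x
      by (rule trace_on_scale) (auto simp: l)
    ultimately show ?thesis
      by (simp add: linear_functional_iff br_add_left br_scale_left lin_add[OF D] lin_scale[OF D])
  qed
  then obtain d where d: "trace (\<lambda>v. D (br x v)) = killing d x" for x
    using killing_represents by blast
  define E where "E v = D v - br d v" for v
  have E: "lin E" unfolding E_def by (intro lin_minus D br_lin)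
  have trE: "trace (\<lambda>v. E (br x v)) = 0" for x
  proof -
    have "trace (\<lambda>v. E (br x v)) = trace (\<lambda>v. D (br x v)) - killing d x"
      unfolding E_def killing_def by (rule trace_on_diff) (auto simp: lin_br_br lin_comp[OF D br_lin])
    thus ?thesis using d by simp
  qed
  have Eder: "E (br x y) = br (E x) y + br x (E y)" for x y
    using der by (simp add: E_def derivation_def br_leibniz[of d x y] br_diff_left br_diff_right)
  have "killing (E x) y = 0" for x y
  proof -
    have "killing (E x) y = trace (\<lambda>v. E (br x (br y v)) - br x (E (br y v)))"
      unfolding killing_def by (simp add: Eder)
    also have "\<dots> = trace (\<lambda>v. E (br x (br y v))) - trace (\<lambda>v. br x (E (br y v)))"
      by (rule trace_on_diff) (auto simp: lin_br_triple E)
    also have "trace (\<lambda>v. br x (E (br y v))) = trace (\<lambda>v. E (br y (br x v)))"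
      using trace_on_commute[of UNIV "br x" "\<lambda>v. E (br y v)"] by (simp add: br_lin lin_comp[OF E br_lin])
    also have "trace (\<lambda>v. E (br x (br y v))) - \<dots> =
        trace (\<lambda>v. E (br x (br y v)) - E (br y (br x v)))"
      by (rule trace_on_diff[symmetric]) (auto simp: lin_br_triple E)
    also have "\<dots> = trace (\<lambda>v. E (br (br x y) v))"
      by (simp add: br_br lin_diff[OF E])
    finally show ?thesis using trE by simp
  qed
  hence "E x = 0" for x using killing_nondegenerate by blast
  thus ?thesis by (auto simp: E_def)
qed

lemma centralizer_trivial: "(\<And>v. br x v = 0) \<Longrightarrow> x = 0"
  using killing_nondegenerate[of x] trace_on_scalar[of UNIV 0] by (simp add: killing_def)

end

section \<open>Periodic gradings and Kreknin's theorem\<close>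

locale periodic_lie_algebra = closed_lie_algebra scale Basis br
  for scale :: "'k::{alg_closed_field, field_char_0} \<Rightarrow> 'v::ab_group_add \<Rightarrow> 'v"
    and Basis :: "'v set" and br :: "'v \<Rightarrow> 'v \<Rightarrow> 'v" +
  fixes \<theta> :: "'v \<Rightarrow> 'v" and \<zeta> :: 'k and m :: nat
  assumes aut: "lie_automorphism scale br \<theta>"
    and period: "\<theta> ^^ m = id"
    and root: "primitive_root_of_unity m \<zeta>"
begin

lemma theta_lin: "lin \<theta>" and theta_br: "\<theta> (br x y) = br (\<theta> x) (\<theta> y)"
  using aut by (auto simp: lie_automorphism_def)

lemma m_nz: "(of_nat m :: 'k) \<noteq> 0" and m_gt_0: "0 < m"
  using root by (auto simp: primitive_root_of_unity_def)

abbreviation part :: "nat \<Rightarrow> 'v set" where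
  "part j \<equiv> graded_part scale \<theta> \<zeta> j"

abbreviation pr :: "nat \<Rightarrow> 'v \<Rightarrow> 'v" where
  "pr \<equiv> proj \<theta> \<zeta> m"

lemmas pr_lin = lin_proj[OF m_nz theta_lin period root]
  and pr_in = proj_in[OF m_nz theta_lin period root]
  and sum_pr = sum_proj[OF m_nz theta_lin period root]
  and pr_part = proj_graded[OF m_nz theta_lin period root]
  and zeta_eq = zeta_inj[OF m_nz theta_lin period root]
  and zeta_pow_m = zeta_m[OF m_nz theta_lin period root]

lemma part_subspace: "subspace (part j)"
  by (rule subspaceI)
    (auto simp: graded_part_def lin_0[OF theta_lin] lin_add[OF theta_lin] lin_scale[OF theta_lin]
      scale_right_distrib scale_left_commute mult.commute)

lemma part_br: "x \<in> part i \<Longrightarrow> y \<in> part j \<Longrightarrow> br x y \<in> part (i + j)"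
  by (auto simp: graded_part_def theta_br br_scale_left br_scale_right power_add mult.commute)

lemma zeta_pow_mod: "\<zeta> ^ (i mod m) = \<zeta> ^ i"
proof -
  have "\<zeta> ^ i = \<zeta> ^ (m * (i div m) + i mod m)" by simp
  also have "\<dots> = \<zeta> ^ (i mod m)" unfolding power_add power_mult zeta_pow_m by simp
  finally show ?thesis by simp
qed

lemma part_mod: "part (i mod m) = part i"
  by (simp add: graded_part_def zeta_pow_mod)

lemma pr_part_mod:
  assumes "x \<in> part i" "j < m" shows "pr j x = (if i mod m = j then x else 0)"
  using pr_part[of x "i mod m" j] assms m_gt_0 by (simp add: part_mod)

definition graded :: "'v set \<Rightarrow> bool" where
  "graded M \<longleftrightarrow> (\<forall>j<m. \<forall>x\<in>M. pr j x \<in> M)"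

lemma graded_bracket_span:
  assumes A: "graded A" and B: "graded B"
  shows "graded (bracket_span scale br A B)"
  unfolding graded_def
proof (intro allI impI)
  fix k assume k: "k < m"
  let ?S = "bracket_span scale br A B"
  have "?S \<subseteq> {x. pr k x \<in> ?S}"
  proof (rule bracket_span_subset)
    show "subspace {x. pr k x \<in> ?S}"
      by (rule vp.linear_subspace_linear_preimage[OF pr_lin bracket_span_subspace])
    fix a b assume ab: "a \<in> A" "b \<in> B"
    have "br a b = br (\<Sum>i<m. pr i a) (\<Sum>j<m. pr j b)" by (simp add: sum_pr)
    also have "\<dots> = (\<Sum>i<m. br (pr i a) (\<Sum>j<m. pr j b))" by (rule br_sum_left)
    also have "\<dots> = (\<Sum>i<m. \<Sum>j<m. br (pr i a) (pr j b))" by (simp only: br_sum_right)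
    finally have eq: "br a b = (\<Sum>i<m. \<Sum>j<m. br (pr i a) (pr j b))" .
    have "pr k (br (pr i a) (pr j b)) \<in> ?S" if "i < m" "j < m" for i j
      using pr_part_mod[OF part_br[OF pr_in pr_in] k, of i a j b] that ab A B
      by (auto simp: graded_def intro: bracket_in_span subspace_0[OF bracket_span_subspace])
    thus "br a b \<in> {x. pr k x \<in> ?S}"
      by (auto simp: eq lin_sum[OF pr_lin] intro!: subspace_sum[OF bracket_span_subspace])
  qed
  thus "\<forall>x\<in>?S. pr k x \<in> ?S" by blast
qed

lemma graded_derived_series: "graded M \<Longrightarrow> graded (derived_series scale br M s)"
  by (induction s) (simp_all add: graded_bracket_span)

text \<open>
  In Kreknin's induction some derived algebra of \<open>M\<close> lies in the subalgebra generated by this set, for larger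
  and larger \<open>k\<close>.
\<close>

definition upper_generators :: "'v set \<Rightarrow> nat \<Rightarrow> 'v set" where
  "upper_generators M k = (M \<inter> part 0) \<union> (\<Union>j\<in>{k<..<m}. M \<inter> part j)"

text \<open>
  The property in the conclusion passes from \<open>a\<close> and \<open>a'\<close> to \<open>[a, a']\<close> by the Jacobi identity, so it
  need only be checked for a generator \<open>a\<close>.  If \<open>a\<close> has degree \<open>k + 1\<close>, the component of \<open>b\<close> that
  contributes has degree \<open>0\<close> and is central.  If the degree of \<open>a\<close> is larger, the contributing
  component of \<open>b\<close> has degree larger than \<open>k + 1\<close> as well, since the two degrees add up to \<open>m + k + 1\<close>.
\<close>

lemma kreknin_component:
  assumes M: "lie_subalgebra scale br M" "graded M"
    and central: "\<forall>x\<in>M \<inter> part 0. \<forall>y\<in>M. br x y = 0"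
    and k: "Suc k < m" and b: "b \<in> M" and a: "a \<in> generated (upper_generators M k)"
  shows "pr (Suc k) (br b a) \<in> generated (upper_generators M (Suc k))"
proof -
  let ?T = "generated (upper_generators M (Suc k))"
  have T: "lie_subalgebra scale br ?T" by (rule generated_subalgebra)
  have sT: "subspace ?T" by (rule subalgebra_subspace[OF T])
  have sM: "subspace M" by (rule subalgebra_subspace[OF M(1)])
  define Q where "Q = {a \<in> M. \<forall>b\<in>M. pr (Suc k) (br b a) \<in> ?T}"
  have "lie_subalgebra scale br Q"
    unfolding lie_subalgebra_def
  proof (intro conjI ballI)
    show "subspace Q"
      by (rule subspaceI) (auto simp: Q_def br_add_right br_scale_right lin_add[OF pr_lin]
          lin_scale[OF pr_lin] lin_0[OF pr_lin] intro: subspace_0[OF sT] subspace_0[OF sM]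
          subspace_add[OF sT] subspace_add[OF sM] subspace_scale[OF sT] subspace_scale[OF sM])
    fix x y assume xy: "x \<in> Q" "y \<in> Q"
    have "pr (Suc k) (br b (br x y)) \<in> ?T" if b: "b \<in> M" for b
    proof -
      have "br b x \<in> M" "br b y \<in> M" using b xy subalgebra_closed[OF M(1)] by (auto simp: Q_def)
      hence "pr (Suc k) (br (br b x) y) - pr (Suc k) (br (br b y) x) \<in> ?T"
        using xy by (intro subspace_diff[OF sT]) (auto simp: Q_def)
      moreover have "br b (br x y) = br (br b x) y - br (br b y) x"
        by (simp add: br_leibniz[of b x y] br_anti[of x "br b y"])
      ultimately show ?thesis by (simp add: lin_diff[OF pr_lin])
    qed
    thus "br x y \<in> Q" using xy subalgebra_closed[OF M(1)] by (auto simp: Q_def)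
  qed
  moreover have "upper_generators M k \<subseteq> Q"
  proof
    fix a assume a: "a \<in> upper_generators M k"
    hence aM: "a \<in> M" by (auto simp: upper_generators_def)
    have "pr (Suc k) (br b a) \<in> ?T" if b: "b \<in> M" for b
    proof (cases "a \<in> part 0")
      case True
      hence "br b a = 0" using central aM b br_anti[of b a] by simp
      thus ?thesis using lin_0[OF pr_lin] subspace_0[OF sT] by simp
    next
      case False
      then obtain c where c: "k < c" "c < m" "a \<in> part c" using a by (auto simp: upper_generators_def)
      have "br b a = br (\<Sum>j<m. pr j b) a" by (simp add: sum_pr)
      also have "\<dots> = (\<Sum>j<m. br (pr j b) a)" by (simp add: br_sum_left)
      finally have eq: "br b a = (\<Sum>j<m. br (pr j b) a)" .
      have "pr (Suc k) (br (pr j b) a) \<in> ?T" if j: "j < m" for j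
      proof (cases "(j + c) mod m = Suc k")
        case False
        hence "pr (Suc k) (br (pr j b) a) = 0"
          using pr_part_mod[OF part_br[OF pr_in c(3)] k, of j b] by simp
        thus ?thesis using subspace_0[OF sT] by simp
      next
        case True
        have jb: "pr j b \<in> M" using M(2) b j by (auto simp: graded_def)
        show ?thesis
        proof (cases "c = Suc k")
          case True
          have "j = 0"
          proof (rule ccontr)
            assume j0: "j \<noteq> 0"
            show False
            proof (cases "j + c < m")
              case True
              thus False using j0 \<open>(j + c) mod m = Suc k\<close> \<open>c = Suc k\<close> by simp
            next
              case False
              hence "(j + c) mod m = j + c - m" using j c(2) by (simp add: mod_if)
              thus False using \<open>(j + c) mod m = Suc k\<close> \<open>c = Suc k\<close> j False by simp
            qed
          qed
          hence "br (pr j b) a = 0" using central jb aM pr_in[of j b] by auto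
          thus ?thesis using lin_0[OF pr_lin] subspace_0[OF sT] by simp
        next
          case False
          have "Suc k < j"
          proof (cases "j + c < m")
            case True
            thus ?thesis using \<open>(j + c) mod m = Suc k\<close> c(1) \<open>c \<noteq> Suc k\<close> by simp
          next
            case False
            hence "(j + c) mod m = j + c - m" using j c(2) by (simp add: mod_if)
            thus ?thesis using \<open>(j + c) mod m = Suc k\<close> c(2) by simp
          qed
          hence "pr j b \<in> ?T" "a \<in> ?T"
            using jb pr_in[of j b] j c aM \<open>c \<noteq> Suc k\<close>
            by (auto intro!: generated_base simp: upper_generators_def)
          hence "br (pr j b) a \<in> ?T" by (rule subalgebra_closed[OF T])
          thus ?thesis using pr_part_mod[OF part_br[OF pr_in c(3)] k, of j b] True by simp
        qed
      qed
      thus ?thesis by (auto simp: eq lin_sum[OF pr_lin] intro!: subspace_sum[OF sT])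
    qed
    thus "a \<in> Q" using aM by (simp add: Q_def)
  qed
  ultimately have "generated (upper_generators M k) \<subseteq> Q" by (rule generated_minimal)
  thus ?thesis using a b by (auto simp: Q_def)
qed

text \<open>
  The next derived algebra \<open>N\<close> has its component of degree \<open>k + 1\<close> among the brackets of elements of
  higher degree; applying the induction hypothesis to \<open>N\<close> eliminates that degree.
\<close>

lemma kreknin_step:
  assumes "k < m" "lie_subalgebra scale br M" "graded M" "\<forall>x\<in>M \<inter> part 0. \<forall>y\<in>M. br x y = 0"
  shows "\<exists>s. derived_series scale br M s \<subseteq> generated (upper_generators M k)"
  using assms
proof (induction k arbitrary: M)
  case 0
  have "M \<subseteq> generated (upper_generators M 0)"
  proof
    fix x assume x: "x \<in> M"
    have "pr j x \<in> generated (upper_generators M 0)" if "j < m" for j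
      using that x 0(3) pr_in[of j x]
      by (intro generated_base) (cases "j = 0"; force simp: upper_generators_def graded_def)
    hence "(\<Sum>j<m. pr j x) \<in> generated (upper_generators M 0)"
      by (intro subspace_sum subalgebra_subspace generated_subalgebra) auto
    thus "x \<in> generated (upper_generators M 0)" by (simp add: sum_pr)
  qed
  thus ?case by (intro exI[of _ 0]) simp
next
  case (Suc k)
  let ?T = "generated (upper_generators M (Suc k))"
  note M = Suc.prems(2,3,4)
  obtain s where s: "derived_series scale br M s \<subseteq> generated (upper_generators M k)"
    using Suc.IH[of M] Suc.prems by auto
  define N where "N = derived_series scale br M (Suc s)"
  have N: "lie_subalgebra scale br N" "graded N" "N \<subseteq> M"
    unfolding N_def using derived_series_subalgebra[OF M(1)] graded_derived_series[OF M(2)]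
      derived_series_facts[OF M(1)] by blast+
  have DM: "derived_series scale br M s \<subseteq> M" using derived_series_facts[OF M(1)] by blast
  have "N \<subseteq> {x. pr (Suc k) x \<in> ?T}"
    unfolding N_def derived_series.simps
  proof (rule bracket_span_subset)
    show "subspace {x. pr (Suc k) x \<in> ?T}"
      by (rule vp.linear_subspace_linear_preimage[OF pr_lin subalgebra_subspace[OF generated_subalgebra]])
    fix b a assume "b \<in> derived_series scale br M s" "a \<in> derived_series scale br M s"
    thus "br b a \<in> {x. pr (Suc k) x \<in> ?T}"
      using kreknin_component[OF M Suc.prems(1)] s DM by blast
  qed
  hence comp: "N \<inter> part (Suc k) \<subseteq> ?T"
    using pr_part[OF _ Suc.prems(1) Suc.prems(1)] by fastforce
  have "upper_generators N k \<subseteq> ?T"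
  proof
    fix x assume "x \<in> upper_generators N k"
    then consider "x \<in> M \<inter> part 0" | j where "k < j" "j < m" "x \<in> N" "x \<in> part j"
      using N(3) by (auto simp: upper_generators_def)
    thus "x \<in> ?T"
    proof cases
      case 1
      thus ?thesis by (intro generated_base) (simp add: upper_generators_def)
    next
      case 2
      show ?thesis
      proof (cases "j = Suc k")
        case True
        thus ?thesis using comp 2 by blast
      next
        case False
        thus ?thesis using 2 N(3) by (intro generated_base) (auto simp: upper_generators_def)
      qed
    qed
  qed
  hence *: "generated (upper_generators N k) \<subseteq> ?T"
    by (intro generated_minimal generated_subalgebra)
  obtain t where "derived_series scale br N t \<subseteq> generated (upper_generators N k)"
    using Suc.IH[of N] Suc.prems N by auto
  hence "derived_series scale br M (Suc s + t) \<subseteq> ?T"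
    unfolding derived_series_add N_def[symmetric] using * by blast
  thus ?case by blast
qed

text \<open>
  Kreknin's theorem on gradings by a cyclic group, with a central instead of a zero component of degree
  zero.
\<close>

theorem kreknin:
  assumes M: "lie_subalgebra scale br M" "graded M" "\<forall>x\<in>M \<inter> part 0. \<forall>y\<in>M. br x y = 0"
  shows "lie_solvable scale br M"
proof -
  obtain s where s: "derived_series scale br M s \<subseteq> generated (upper_generators M (m - 1))"
    using kreknin_step[OF _ M, of "m - 1"] m_gt_0 by auto
  have "upper_generators M (m - 1) = M \<inter> part 0" by (auto simp: upper_generators_def)
  moreover have "lie_subalgebra scale br (M \<inter> part 0)"
    unfolding lie_subalgebra_def
    using subspace_inter[OF subalgebra_subspace[OF M(1)] part_subspace[of 0]] M(3) subspace_0 by auto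
  ultimately have "derived_series scale br M s \<subseteq> M \<inter> part 0"
    using s generated_minimal[of "M \<inter> part 0" "M \<inter> part 0"] by auto
  hence "derived_series scale br M (Suc s) \<subseteq> {0}"
    unfolding derived_series.simps using M(3) by (intro bracket_span_subset) auto
  hence "derived_series scale br M (Suc s) = {0}"
    using subspace_0 derived_series_facts[OF M(1), of "Suc s"] by blast
  thus ?thesis unfolding lie_solvable_def by blast
qed

section \<open>The contraction and its index\<close>

abbreviation br0 :: "'v \<Rightarrow> 'v \<Rightarrow> 'v" where "br0 \<equiv> bracket_zero scale br \<theta> \<zeta> m"

abbreviation br_inf :: "'v \<Rightarrow> 'v \<Rightarrow> 'v" where "br_inf \<equiv> bracket_infty scale br \<theta> \<zeta> m"

lemmas br0_truncated = bracket_zero_is_truncated[OF m_nz theta_lin period root]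
  and br_inf_truncated = bracket_infty_is_truncated[OF m_nz theta_lin period root]

lemma br0_bilinear: "bilinear_map scale br0" and br_inf_bilinear: "bilinear_map scale br_inf"
  using br0_truncated br_inf_truncated by (simp_all add: is_truncated_bracket_def)

lemma br0_part: "i < m \<Longrightarrow> j < m \<Longrightarrow> x \<in> part i \<Longrightarrow> y \<in> part j \<Longrightarrow> br0 x y = (if i + j < m then br x y else 0)"
  and br_inf_part: "i < m \<Longrightarrow> j < m \<Longrightarrow> x \<in> part i \<Longrightarrow> y \<in> part j \<Longrightarrow> br_inf x y = (if i + j \<ge> m then br x y else 0)"
  using br0_truncated br_inf_truncated by (simp_all add: is_truncated_bracket_def)

lemma bilinear_map_expand:
  assumes "bilinear_map scale B"
  shows "B x y = (\<Sum>i<m. \<Sum>j<m. B (pr i x) (pr j y))"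
proof -
  have l: "lin (\<lambda>x. B x y)" and r: "lin (B x)" for x y using assms by (auto simp: bilinear_map_def)
  have "B x y = B (\<Sum>i<m. pr i x) (\<Sum>j<m. pr j y)" by (simp add: sum_pr)
  also have "\<dots> = (\<Sum>i<m. B (pr i x) (\<Sum>j<m. pr j y))" by (rule lin_sum[OF l])
  also have "\<dots> = (\<Sum>i<m. \<Sum>j<m. B (pr i x) (pr j y))" by (simp only: lin_sum[OF r])
  finally show ?thesis .
qed

text \<open>
  A degree \<open>i + j\<close> below \<open>m\<close> is not reduced, so the part of degree zero is central in the contraction.
\<close>

lemma br_inf_part_0:
  assumes "x \<in> part 0" shows "br_inf x v = 0" "br_inf v x = 0"
proof -
  have px: "pr i x = (if i = 0 then x else 0)" if "i < m" for i
    using pr_part[OF assms m_gt_0 that] by auto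
  have "br_inf (pr i x) (pr j v) = 0" "br_inf (pr j v) (pr i x) = 0" if "i < m" "j < m" for i j
  proof -
    have z: "br_inf 0 w = 0" "br_inf w 0 = 0" for w
      using br_inf_bilinear lin_0 by (auto simp: bilinear_map_def)
    show "br_inf (pr i x) (pr j v) = 0" "br_inf (pr j v) (pr i x) = 0"
      using br_inf_part[OF m_gt_0 that(2) assms pr_in] br_inf_part[OF that(2) m_gt_0 pr_in assms] that px[OF that(1)] z
      by auto
  qed
  thus "br_inf x v = 0" "br_inf v x = 0"
    using bilinear_map_expand[OF br_inf_bilinear, of x v] bilinear_map_expand[OF br_inf_bilinear, of v x] by auto
qed

definition twist :: "'k \<Rightarrow> 'v \<Rightarrow> 'v" where
  "twist a v = (\<Sum>j<m. scale (a ^ j) (pr j v))"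

lemma twist_lin: "lin (twist a)"
  unfolding twist_def by (intro lin_setsum lin_smult pr_lin)

lemma twist_part:
  assumes "x \<in> part i" shows "twist a x = scale (a ^ (i mod m)) x"
proof -
  have "twist a x = (\<Sum>j<m. if j = i mod m then scale (a ^ (i mod m)) x else 0)"
    unfolding twist_def by (intro sum.cong refl) (auto simp: pr_part_mod[OF assms])
  thus ?thesis using m_gt_0 by simp
qed

lemma twist_twist:
  assumes "a \<noteq> 0" shows "twist a (twist (inverse a) v) = v"
proof -
  have "twist a (twist (inverse a) v) = (\<Sum>j<m. scale (inverse a ^ j) (twist a (pr j v)))"
    unfolding twist_def[of "inverse a" v] by (simp add: lin_sum[OF twist_lin] lin_scale[OF twist_lin])
  also have "\<dots> = (\<Sum>j<m. pr j v)"
    using assms by (intro sum.cong refl) (simp add: twist_part[OF pr_in] power_mult_distrib[symmetric])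
  finally show ?thesis by (simp add: sum_pr)
qed

text \<open>
  Reducing \<open>i + j\<close> modulo \<open>m\<close> costs a factor \<open>a\<^sup>m\<close>: the rescaling is an isomorphism between the given
  bracket and a member of the pencil, up to a scalar.
\<close>

lemma twist_br:
  assumes "a \<noteq> 0"
  shows "scale (a ^ m) (br0 (twist a u) (twist a v)) + br_inf (twist a u) (twist a v)
    = scale (a ^ m) (twist a (br u v))"
proof -
  let ?L = "\<lambda>u v. scale (a ^ m) (br0 (twist a u) (twist a v)) + br_inf (twist a u) (twist a v)"
  let ?R = "\<lambda>u v. scale (a ^ m) (twist a (br u v))"
  have l0: "lin (\<lambda>x. br0 x y)" "lin (\<lambda>x. br_inf x y)" and r0: "lin (br0 x)" "lin (br_inf x)" for x y
    using br0_bilinear br_inf_bilinear by (auto simp: bilinear_map_def)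
  have L: "bilinear_map scale ?L" unfolding bilinear_map_def
    by (intro conjI allI lin_plus lin_smult lin_comp[OF r0(1) twist_lin] lin_comp[OF r0(2) twist_lin]
        lin_comp[OF l0(1) twist_lin] lin_comp[OF l0(2) twist_lin])
  have R: "bilinear_map scale ?R" unfolding bilinear_map_def
    by (intro conjI allI lin_smult lin_comp[OF twist_lin br_lin] lin_comp[OF twist_lin br_lin_left])
  have part: "?L x y = ?R x y" if ij: "i < m" "j < m" and x: "x \<in> part i" and y: "y \<in> part j" for i j x y
  proof -
    have tx: "twist a x = scale (a ^ i) x" "twist a y = scale (a ^ j) y"
      using twist_part[OF x] twist_part[OF y] ij by auto
    have tb: "twist a (br x y) = scale (a ^ ((i + j) mod m)) (br x y)"
      by (rule twist_part[OF part_br[OF x y]])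
    show ?thesis
    proof (cases "i + j < m")
      case True
      thus ?thesis unfolding tx tb
        by (simp add: lin_scale[OF l0(1)] lin_scale[OF l0(2)] lin_scale[OF r0(1)] lin_scale[OF r0(2)]
            br0_part[OF ij x y] br_inf_part[OF ij x y] power_add)
    next
      case False
      have "i + j - m < m" using ij by simp
      hence e: "i + j = m + (i + j) mod m" using False by (simp add: le_mod_geq)
      have p: "a ^ j * a ^ i = a ^ m * a ^ ((i + j) mod m)" by (metis e power_add add.commute)
      thus ?thesis using False unfolding tx tb
        by (simp add: lin_scale[OF l0(1)] lin_scale[OF l0(2)] lin_scale[OF r0(1)] lin_scale[OF r0(2)]
            br0_part[OF ij x y] br_inf_part[OF ij x y])
    qed
  qed
  have "?L u v = (\<Sum>i<m. \<Sum>j<m. ?L (pr i u) (pr j v))" by (rule bilinear_map_expand[OF L])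
  also have "\<dots> = (\<Sum>i<m. \<Sum>j<m. ?R (pr i u) (pr j v))"
  proof (intro sum.cong refl)
    fix i j assume "i \<in> {..<m}" "j \<in> {..<m}"
    thus "?L (pr i u) (pr j v) = ?R (pr i u) (pr j v)" by (intro part[OF _ _ pr_in pr_in]) auto
  qed
  also have "\<dots> = ?R u v" by (rule bilinear_map_expand[OF R, symmetric])
  finally show ?thesis .
qed

text \<open>
  Over an algebraically closed field \<open>c\<close> has an \<open>m\<close>-th root, so this member of the pencil of brackets is
  isomorphic to the given one up to a scalar.
\<close>

lemma index_le_pencil:
  assumes \<xi>: "functional \<xi>" and "c \<noteq> 0"
  shows "lie_index scale br \<le> dim (form_kernel (\<lambda>u v. \<xi> (br_inf u v) + c * \<xi> (br0 u v)))"
proof -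
  obtain a where a: "a ^ m = c" using nth_root_exists[OF m_gt_0] by blast
  have a0: "a \<noteq> 0" using a assms(2) m_gt_0 by (auto simp: power_0_left)
  have \<xi>': "\<xi> (x + y) = \<xi> x + \<xi> y" "\<xi> (scale r x) = r * \<xi> x" for x y r
    using \<xi> by (auto simp: linear_functional_iff)
  have "functional (\<lambda>v. \<xi> (twist a v))"
    by (simp add: linear_functional_iff \<xi>' lin_add[OF twist_lin] lin_scale[OF twist_lin])
  hence "lie_index scale br \<le> dim (coadjoint_stabiliser br (\<lambda>v. \<xi> (twist a v)))" (is "_ \<le> dim ?S")
    by (rule lie_index_le)
  also have "inj_on (twist a) (span ?S)"
    by (rule inj_on_inverseI[of _ "twist (inverse a)"]) (use twist_twist[of "inverse a"] a0 in simp)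
  hence "dim ?S = dim (twist a ` ?S)" by (rule fvp.dim_image_eq[OF twist_lin, symmetric])
  also have "\<dots> \<le> dim (form_kernel (\<lambda>u v. \<xi> (br_inf u v) + c * \<xi> (br0 u v)))"
  proof (rule dim_subset, clarify)
    fix u assume u: "u \<in> ?S"
    have "\<xi> (br_inf (twist a u) v) + c * \<xi> (br0 (twist a u) v) = 0" for v
    proof -
      define v' where "v' = twist (inverse a) v"
      have v: "v = twist a v'" using twist_twist[OF a0] by (simp add: v'_def)
      have "\<xi> (br_inf (twist a u) v) + c * \<xi> (br0 (twist a u) v) =
          \<xi> (scale c (br0 (twist a u) (twist a v')) + br_inf (twist a u) (twist a v'))"
        by (simp add: \<xi>' v add.commute)
      also have "\<dots> = c * \<xi> (twist a (br u v'))"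
        using twist_br[OF a0, of u v'] by (simp add: a \<xi>')
      also have "\<dots> = 0" using u by (simp add: coadjoint_stabiliser_def)
      finally show ?thesis .
    qed
    thus "twist a u \<in> form_kernel (\<lambda>u v. \<xi> (br_inf u v) + c * \<xi> (br0 u v))"
      by (simp add: form_kernel_def)
  qed
  finally show ?thesis .
qed

lemma cofinite_nonempty: "finite (S :: 'k set) \<Longrightarrow> \<exists>c. c \<notin> S"
  using ex_new_if_finite[OF infinite_UNIV_char_0] by blast

lemma index_le_index_infty: "lie_index scale br \<le> lie_index scale br_inf"
proof -
  obtain \<xi> where \<xi>: "functional \<xi>" "lie_index scale br_inf = dim (coadjoint_stabiliser br_inf \<xi>)"
    using lie_index_attained by blast
  have "finite ({0} \<union> {c. \<not> dim (form_kernel (\<lambda>u v. \<xi> (br_inf u v) + c * \<xi> (br0 u v)))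
      \<le> dim (form_kernel (\<lambda>u v. \<xi> (br_inf u v)))})"
    using form_kernel_semicontinuous[OF coadjoint_form[OF br_inf_bilinear \<xi>(1)] coadjoint_form[OF br0_bilinear \<xi>(1)]]
    by simp
  from cofinite_nonempty[OF this] obtain c where c: "c \<noteq> 0"
    "dim (form_kernel (\<lambda>u v. \<xi> (br_inf u v) + c * \<xi> (br0 u v))) \<le> dim (form_kernel (\<lambda>u v. \<xi> (br_inf u v)))"
    by auto
  thus ?thesis using index_le_pencil[OF \<xi>(1) c(1)] \<xi>(2) by (simp add: coadjoint_stabiliser_form)
qed

text \<open>
  Almost all functionals on the line through \<open>\<xi>1\<close> and \<open>\<xi>2\<close> have a stabiliser of minimal dimension in the
  contraction and do not vanish at \<open>[x, y]\<close>.  For such a functional \<open>x\<close> and \<open>y\<close> are in the kernel at \<open>c = 0\<close>,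
  but they pair nontrivially in the direction of the pencil, so the kernel drops.
\<close>

theorem index_less_if_nonabelian:
  assumes "\<not> lie_abelian br (part 0)"
  shows "lie_index scale br < lie_index scale br_inf"
proof -
  obtain x y where xy: "x \<in> part 0" "y \<in> part 0" "br x y \<noteq> 0"
    using assms by (auto simp: lie_abelian_def)
  obtain \<xi>1 where \<xi>1: "functional \<xi>1"
    "lie_index scale br_inf = dim (coadjoint_stabiliser br_inf \<xi>1)" using lie_index_attained by blast
  obtain b where b: "b \<in> Basis" "representation Basis (br x y) b \<noteq> 0"
    using coord_inject[of "br x y" 0] xy(3) independent_Basis by (auto simp: representation_zero)
  define \<xi>2 where "\<xi>2 v = representation Basis v b" for v
  have \<xi>2: "functional \<xi>2" unfolding \<xi>2_def by (rule coord_lin)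
  have fin1: "finite {c. \<not> dim (form_kernel (\<lambda>u v. \<xi>1 (br_inf u v) + c * \<xi>2 (br_inf u v)))
      \<le> dim (form_kernel (\<lambda>u v. \<xi>1 (br_inf u v)))}"
    by (rule form_kernel_semicontinuous[OF coadjoint_form[OF br_inf_bilinear \<xi>1(1)] coadjoint_form[OF br_inf_bilinear \<xi>2]])
  have "{c. \<xi>1 (br x y) + c * \<xi>2 (br x y) = 0} \<subseteq> {- \<xi>1 (br x y) / \<xi>2 (br x y)}"
    using b(2) by (auto simp: \<xi>2_def field_simps eq_neg_iff_add_eq_0)
  hence fin2: "finite {c. \<xi>1 (br x y) + c * \<xi>2 (br x y) = 0}" by (rule finite_subset) simp
  from cofinite_nonempty[OF finite_UnI[OF fin1 fin2]] obtain c
    where c: "dim (form_kernel (\<lambda>u v. \<xi>1 (br_inf u v) + c * \<xi>2 (br_inf u v))) \<le> dim (form_kernel (\<lambda>u v. \<xi>1 (br_inf u v)))"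
      "\<xi>1 (br x y) + c * \<xi>2 (br x y) \<noteq> 0" by auto
  define \<xi> where "\<xi> v = \<xi>1 v + c * \<xi>2 v" for v
  have \<xi>: "functional \<xi>"
    using \<xi>1(1) \<xi>2 by (simp add: linear_functional_iff \<xi>_def algebra_simps)
  have le: "dim (form_kernel (\<lambda>u v. \<xi> (br_inf u v))) \<le> lie_index scale br_inf"
    using c(1) \<xi>1(2) by (simp add: \<xi>_def coadjoint_stabiliser_form)
  have "br0 x y = br x y" using br0_part[OF m_gt_0 m_gt_0 xy(1,2)] m_gt_0 by simp
  hence "\<xi> (br0 x y) \<noteq> 0" using c(2) by (simp add: \<xi>_def)
  moreover have "\<xi> 0 = 0" using \<xi> by (metis linear_functional_iff mult_zero_left scale_zero_left)
  ultimately have "finite {c. \<not> dim (form_kernel (\<lambda>u v. \<xi> (br_inf u v) + c * \<xi> (br0 u v)))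
      < dim (form_kernel (\<lambda>u v. \<xi> (br_inf u v)))}"
    using br_inf_part_0[OF xy(1)] br_inf_part_0[OF xy(2)]
    by (intro form_kernel_drops[of _ _ x y] coadjoint_form[OF br_inf_bilinear \<xi>] coadjoint_form[OF br0_bilinear \<xi>]) auto
  hence "finite ({0} \<union> {c. \<not> dim (form_kernel (\<lambda>u v. \<xi> (br_inf u v) + c * \<xi> (br0 u v)))
      < dim (form_kernel (\<lambda>u v. \<xi> (br_inf u v)))})" by simp
  from cofinite_nonempty[OF this] obtain e where e: "e \<noteq> 0"
    "dim (form_kernel (\<lambda>u v. \<xi> (br_inf u v) + e * \<xi> (br0 u v))) < dim (form_kernel (\<lambda>u v. \<xi> (br_inf u v)))"
    by auto
  thus ?thesis using index_le_pencil[OF \<xi> e(1)] le by simp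
qed

end

section \<open>The semisimple case\<close>

locale periodic_semisimple_lie_algebra =
  periodic_lie_algebra scale Basis br \<theta> \<zeta> m + closed_semisimple_lie_algebra scale Basis br
  for scale :: "'k::{alg_closed_field, field_char_0} \<Rightarrow> 'v::ab_group_add \<Rightarrow> 'v"
    and Basis :: "'v set" and br :: "'v \<Rightarrow> 'v \<Rightarrow> 'v" and \<theta> :: "'v \<Rightarrow> 'v" and \<zeta> :: 'k and m :: nat
begin

lemma theta_inverse: "\<exists>\<theta>'. lin \<theta>' \<and> (\<forall>v. \<theta> (\<theta>' v) = v) \<and> (\<forall>v. \<theta>' (\<theta> v) = v)"
proof (intro exI[of _ "\<theta> ^^ (m - 1)"] conjI allI)
  obtain k where k: "m = Suc k" using m_gt_0 by (cases m) auto
  show "lin (\<theta> ^^ (m - 1))" by (rule lin_funpow[OF theta_lin])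
  have "(\<theta> ^^ Suc k) v = v" for v using period k by simp
  thus "\<theta> ((\<theta> ^^ (m - 1)) v) = v" "(\<theta> ^^ (m - 1)) (\<theta> v) = v" for v
    by (simp_all add: k funpow_swap1)
qed

lemma killing_theta: "killing (\<theta> x) (\<theta> y) = killing x y"
proof -
  obtain \<theta>' where t: "lin \<theta>'" "\<And>v. \<theta> (\<theta>' v) = v" "\<And>v. \<theta>' (\<theta> v) = v" using theta_inverse by blast
  have "br (\<theta> x) (br (\<theta> y) v) = \<theta> (br x (br y (\<theta>' v)))" for v
    by (simp add: theta_br t)
  hence "killing (\<theta> x) (\<theta> y) = trace (\<lambda>v. \<theta> (br x (br y (\<theta>' v))))"
    by (simp add: killing_def)
  also have "\<dots> = trace (\<lambda>v. br x (br y (\<theta>' (\<theta> v))))"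
    by (rule trace_on_commute) (auto simp: theta_lin intro: lin_comp[OF br_lin lin_comp[OF br_lin t(1)]])
  finally show ?thesis by (simp add: t killing_def)
qed

text \<open>
  The Killing form is invariant under the automorphism, which scales it by \<open>\<zeta>\<^sup>i\<^sup>+\<^sup>j\<close> on these parts.
\<close>

lemma killing_part:
  assumes x: "x \<in> part i" and y: "y \<in> part j" and "(i + j) mod m \<noteq> 0"
  shows "killing x y = 0"
proof -
  have "killing x y = killing (scale (\<zeta> ^ i) x) (scale (\<zeta> ^ j) y)"
    using killing_theta[of x y] x y by (simp add: graded_part_def)
  also have "\<dots> = \<zeta> ^ (i + j) * killing x y"
    by (simp add: killing_scale_left killing_scale_right power_add)
  finally have "(1 - \<zeta> ^ (i + j)) * killing x y = 0" by (simp add: algebra_simps)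
  moreover have "\<zeta> ^ (i + j) \<noteq> 1"
  proof
    assume "\<zeta> ^ (i + j) = 1"
    hence "\<zeta> ^ ((i + j) mod m) = \<zeta> ^ 0" by (simp add: zeta_pow_mod)
    hence "(i + j) mod m = 0" using zeta_eq m_gt_0 by simp
    thus False using assms(3) by simp
  qed
  ultimately show ?thesis by simp
qed

lemma killing_part_0_nondegenerate:
  assumes x: "x \<in> part 0" and "\<And>w. w \<in> part 0 \<Longrightarrow> killing x w = 0"
  shows "x = 0"
proof (rule killing_nondegenerate)
  fix y
  have "killing x (pr j y) = 0" if "j < m" for j
    using assms(2) killing_part[OF x pr_in, of j y] pr_in[of 0 y] that by (cases "j = 0") auto
  hence "killing x (\<Sum>j<m. pr j y) = 0" by (simp add: killing_sum_right)
  thus "killing x y = 0" by (simp add: sum_pr)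
qed

lemma part_0_subalgebra: "lie_subalgebra scale br (part 0)"
  using part_subspace[of 0] part_br[of _ 0 _ 0] by (auto simp: lie_subalgebra_def)

theorem dim_eq_rank_iff_abelian:
  "dim (part 0) = lie_rank scale br (part 0) \<longleftrightarrow> lie_abelian br (part 0)"
proof
  assume "dim (part 0) = lie_rank scale br (part 0)"
  hence "lie_solvable scale br (part 0)"
    by (intro nilpotent_solvable nilpotent_if_dim_eq_rank part_0_subalgebra)
  thus "lie_abelian br (part 0)"
    using killing_part_0_nondegenerate by (rule solvable_nondegenerate_abelian[OF part_0_subalgebra])
next
  assume "lie_abelian br (part 0)"
  thus "dim (part 0) = lie_rank scale br (part 0)"
    by (rule lie_rank_abelian[OF part_0_subalgebra, symmetric])
qed

text \<open>
  The semisimple part of \<open>br x\<close> is a derivation, hence \<open>br d\<close>, and \<open>d\<close> has degree zero because the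
  semisimple part commutes with the automorphism.  So \<open>x - d\<close> is a nilpotent element of degree zero that
  commutes with that part, hence orthogonal to it, hence zero.
\<close>

lemma part_0_semisimple:
  assumes ab: "lie_abelian br (part 0)" and x: "x \<in> part 0" and v: "v \<in> geigenspace (br x) 0"
  shows "br x v = 0"
proof -
  have \<theta>x: "\<theta> x = x" using x by (simp add: graded_part_def)
  obtain D where D: "lin D" "\<forall>c. \<forall>v\<in>geigenspace (br x) c. D v = scale c v"
    using eigenvalue_calculus[OF br_lin, of x "\<lambda>c. c"] by blast
  have "derivation D"
    by (rule additive_calculus_derivation[OF derivation_br D(1), of x "\<lambda>c. c"]) (use D(2) in auto)
  then obtain d where d: "\<And>v. D v = br d v" using derivation_inner by blast
  obtain C where C: "\<forall>v. v \<in> span (\<Union>c\<in>C. geigenspace (br x) c)"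
    using trace_eigenvalue_calculus[OF br_lin, of x] by blast
  have \<theta>D: "\<theta> (D v) = D (\<theta> v)" for v
  proof (rule vp.linear_eq_on[OF lin_comp[OF theta_lin D(1)] lin_comp[OF D(1) theta_lin]])
    show "v \<in> span (\<Union>c\<in>C. geigenspace (br x) c)" using C by blast
    fix v assume "v \<in> (\<Union>c\<in>C. geigenspace (br x) c)"
    then obtain c where c: "v \<in> geigenspace (br x) c" by blast
    have "\<theta> v \<in> geigenspace (br x) c"
      by (rule gen_commute[OF br_lin theta_lin _ c]) (simp add: theta_br \<theta>x)
    thus "\<theta> (D v) = D (\<theta> v)" using D(2) c by (simp add: lin_scale[OF theta_lin])
  qed
  obtain \<theta>' where t: "\<And>v. \<theta> (\<theta>' v) = v" using theta_inverse by blast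
  have "br (\<theta> d) v = br d v" for v
  proof -
    have "br (\<theta> d) v = \<theta> (br d (\<theta>' v))" by (simp add: theta_br t)
    also have "\<dots> = br d v" using \<theta>D[of "\<theta>' v"] by (simp add: d t)
    finally show ?thesis .
  qed
  hence "br (\<theta> d - d) v = 0" for v by (simp add: br_diff_left)
  hence "\<theta> d - d = 0" by (rule centralizer_trivial)
  hence d0: "d \<in> part 0" by (simp add: graded_part_def)
  define n where "n = x - d"
  have n0: "n \<in> part 0" unfolding n_def by (rule subspace_diff[OF part_subspace x d0])
  have "v \<in> geigenspace (br n) 0" if "v \<in> geigenspace (br x) c" for v c
    using that
  proof (induction rule: gen_induct)
    case zero
    show ?case by (rule subspace_0[OF gen_br_subspace])
  next
    case (shift v)
    have "br n v - scale 0 v = br x v - scale c v"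
      using D(2) shift.hyps by (simp add: n_def br_diff_left d[symmetric])
    hence "br n v - scale 0 v \<in> geigenspace (br n) 0" using shift.IH by simp
    thus ?case by (rule gen_shiftI)
  qed
  hence "span (\<Union>c\<in>C. geigenspace (br x) c) \<subseteq> geigenspace (br n) 0"
    by (intro span_minimal gen_br_subspace) blast
  hence nil: "geigenspace (br n) 0 = UNIV" using C by blast
  have "n = 0"
  proof (rule killing_part_0_nondegenerate[OF n0])
    fix w assume "w \<in> part 0"
    hence "br n w = 0" using ab n0 by (simp add: lie_abelian_def)
    thus "killing n w = 0" by (rule killing_nilpotent_commuting[OF nil])
  qed
  hence "x = d" by (simp add: n_def)
  thus ?thesis using D(2) v by (simp add: d[symmetric])
qed

text \<open>
  For \<open>i \<noteq> 0\<close> the bracket of the component \<open>v\<^sub>i\<close> of degree \<open>i\<close> with degree \<open>m - i\<close> is not truncated, and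
  the part of degree \<open>i\<close> only pairs with that of degree \<open>m - i\<close>.  Hence \<open>killing [z, v\<^sub>i] y = 0\<close> for all \<open>y\<close>.
\<close>

lemma infty_stabiliser_centralizes:
  assumes ab: "lie_abelian br (part 0)" and z: "z \<in> part 0"
  shows "coadjoint_stabiliser br_inf (killing z) \<subseteq> {v. br z v = 0}"
proof
  fix v assume v: "v \<in> coadjoint_stabiliser br_inf (killing z)"
  have "br z (pr i v) = 0" if i: "i < m" for i
  proof (cases "i = 0")
    case True
    thus ?thesis using ab z pr_in[of 0 v] by (simp add: lie_abelian_def)
  next
    case False
    show ?thesis
    proof (rule killing_nondegenerate)
      fix y
      have b: "br z (pr i v) \<in> part i" using part_br[OF z pr_in[of i v]] by simp
      have "killing (br z (pr i v)) (pr j y) = 0" if j: "j < m" for j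
      proof (cases "(i + j) mod m = 0")
        case False
        thus ?thesis by (rule killing_part[OF b pr_in])
      next
        case True
        have ij: "i + j = m"
        proof (cases "i + j < m")
          case True
          thus ?thesis using \<open>(i + j) mod m = 0\<close> \<open>i \<noteq> 0\<close> by simp
        next
          case False
          moreover have "i + j - m < m" using i j by simp
          ultimately show ?thesis using \<open>(i + j) mod m = 0\<close> by (simp add: le_mod_geq)
        qed
        let ?w = "pr j y"
        have bl: "lin (\<lambda>u. br_inf u ?w)" using br_inf_bilinear by (simp add: bilinear_map_def)
        have "0 = killing z (br_inf v ?w)" using v by (simp add: coadjoint_stabiliser_def)
        also have "br_inf v ?w = br_inf (\<Sum>k<m. pr k v) ?w" by (simp add: sum_pr)
        also have "\<dots> = (\<Sum>k<m. br_inf (pr k v) ?w)" by (rule lin_sum[OF bl])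
        also have "killing z \<dots> = (\<Sum>k<m. killing z (br_inf (pr k v) ?w))" by (rule killing_sum_right)
        also have "\<dots> = (\<Sum>k<m. if k = i then killing z (br (pr i v) ?w) else 0)"
        proof (intro sum.cong refl)
          fix k assume "k \<in> {..<m}"
          hence k: "k < m" by simp
          have bk: "br_inf (pr k v) ?w = (if k + j \<ge> m then br (pr k v) ?w else 0)"
            by (rule br_inf_part[OF k j pr_in pr_in])
          show "killing z (br_inf (pr k v) ?w) = (if k = i then killing z (br (pr i v) ?w) else 0)"
          proof (cases "k = i")
            case True
            thus ?thesis using bk ij by simp
          next
            case False
            have "killing z (br (pr k v) ?w) = 0" if "k + j \<ge> m"
            proof (rule killing_part[OF z part_br[OF pr_in pr_in]])
              have "k + j - m < m" "k + j - m \<noteq> 0" using k j that False ij by auto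
              thus "(0 + (k + j)) mod m \<noteq> 0" using that by (simp add: le_mod_geq)
            qed
            thus ?thesis using bk False by simp
          qed
        qed
        also have "\<dots> = killing (br z (pr i v)) ?w" using i by (simp add: killing_invariant)
        finally show ?thesis by simp
      qed
      hence "killing (br z (pr i v)) (\<Sum>j<m. pr j y) = 0" by (simp add: killing_sum_right)
      thus "killing (br z (pr i v)) y = 0" by (simp add: sum_pr)
    qed
  qed
  hence "br z (\<Sum>i<m. pr i v) = 0" by (simp add: br_sum_right)
  thus "v \<in> {v. br z v = 0}" by (simp add: sum_pr)
qed

text \<open>
  The centralizer \<open>L\<close> of a suitable \<open>z\<close> of degree zero is abelian, so its dimension is the index of the
  given bracket, and it contains the stabiliser of \<open>killing z\<close> in the contraction.
\<close>

theorem index_infty_le_if_abelian: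
  assumes ab: "lie_abelian br (part 0)"
  shows "lie_index scale br_inf \<le> lie_index scale br"
proof -
  have ab': "br u v = 0" if "u \<in> part 0" "v \<in> part 0" for u v
    using ab that by (simp add: lie_abelian_def)
  obtain z where z: "z \<in> part 0"
    "\<And>x. x \<in> part 0 \<Longrightarrow> dim (UNIV \<inter> geigenspace (br z) 0) \<le> dim (UNIV \<inter> geigenspace (br x) 0)"
    using ex_has_least_nat[of "\<lambda>x. x \<in> part 0" 0 "\<lambda>x. dim (UNIV \<inter> geigenspace (br x) 0)"]
      subspace_0[OF part_subspace] by blast
  have UNIV_sub: "lie_subalgebra scale br UNIV" by (simp add: lie_subalgebra_def)
  define L where "L = geigenspace (br z) 0"
  have L_iff: "v \<in> L \<longleftrightarrow> br z v = 0" for v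
    unfolding L_def using part_0_semisimple[OF ab z(1)] eigenvector_in_gen[of "br z" v 0] by auto
  have L: "lie_subalgebra scale br L" using engel_subalgebra[OF UNIV_sub, of z] by (simp add: L_def)
  have central: "br x v = 0" if x: "x \<in> part 0" and v: "v \<in> L" for x v
  proof -
    have "part 0 \<subseteq> geigenspace (br z) 0"
      using ab'[OF z(1)] by (auto intro!: eigenvector_in_gen)
    hence "UNIV \<inter> geigenspace (br z) 0 \<subseteq> geigenspace (br x) 0"
      by (rule minimal_engel_subalgebra[OF UNIV_sub part_subspace subset_UNIV z(1) _ z(2) x])
    thus ?thesis using part_0_semisimple[OF ab x] v by (auto simp: L_def)
  qed
  have "graded L"
    unfolding graded_def
  proof (intro allI impI ballI)
    fix j v assume j: "j < m" and "v \<in> L"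
    hence "0 = pr j (br z v)" by (simp add: L_iff lin_0[OF pr_lin])
    also have "br z v = br z (\<Sum>i<m. pr i v)" by (simp add: sum_pr)
    also have "pr j \<dots> = (\<Sum>i<m. pr j (br z (pr i v)))"
      by (simp only: br_sum_right lin_sum[OF pr_lin])
    also have "\<dots> = (\<Sum>i<m. if i = j then br z (pr j v) else 0)"
    proof (intro sum.cong refl)
      fix i assume "i \<in> {..<m}"
      thus "pr j (br z (pr i v)) = (if i = j then br z (pr j v) else 0)"
        using pr_part_mod[OF part_br[OF z(1) pr_in[of i v]] j] by simp
    qed
    also have "\<dots> = br z (pr j v)" using j by simp
    finally show "pr j v \<in> L" by (simp add: L_iff)
  qed
  hence solvable: "lie_solvable scale br L"
    by (rule kreknin[OF L]) (use central in auto)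
  have split: "\<exists>w c. y = br z w + c \<and> br z c = 0" for y
    by (rule semisimple_splitting[OF br_lin]) (rule part_0_semisimple[OF ab z(1)])
  \<comment> \<open>The image of \<open>br z\<close> is orthogonal to \<open>L\<close> and spans the whole space together with it.\<close>
  have nondegenerate: "v = 0" if v: "v \<in> L" "\<And>w. w \<in> L \<Longrightarrow> killing v w = 0" for v
  proof (rule killing_nondegenerate)
    fix y
    obtain w c where wc: "y = br z w + c" "br z c = 0" using split by blast
    have "br v z = 0" using v(1) br_anti[of v z] by (simp add: L_iff)
    hence "killing v (br z w) = 0" by (simp add: killing_invariant[symmetric])
    thus "killing v y = 0" using v(2)[of c] wc by (simp add: killing_add_right L_iff)
  qed
  have "lie_abelian br L"
    by (rule solvable_nondegenerate_abelian[OF L solvable]) (rule nondegenerate)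
  hence "dim {v. br z v = 0} \<le> dim {v. br y v = 0}" for y
    by (intro abelian_centralizer_minimal split) (auto simp: lie_abelian_def L_iff)
  note minimal = this
  obtain \<eta> where \<eta>: "functional \<eta>" "lie_index scale br = dim (coadjoint_stabiliser br \<eta>)"
    using lie_index_attained by blast
  obtain y where y: "\<And>v. \<eta> v = killing y v" using killing_represents[OF \<eta>(1)] by blast
  have "coadjoint_stabiliser br \<eta> = {v. br y v = 0}"
  proof -
    have "(\<forall>w. killing y (br v w) = 0) \<longleftrightarrow> br y v = 0" for v
      using killing_nondegenerate[of "br y v"] by (auto simp: killing_invariant[symmetric])
    thus ?thesis by (simp add: coadjoint_stabiliser_def y)
  qed
  hence "dim {v. br z v = 0} \<le> lie_index scale br" using minimal[of y] \<eta>(2) by simp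
  moreover have "dim (coadjoint_stabiliser br_inf (killing z)) \<le> dim {v. br z v = 0}"
    by (rule dim_subset[OF infty_stabiliser_centralizes[OF ab z(1)]])
  moreover have "lie_index scale br_inf \<le> dim (coadjoint_stabiliser br_inf (killing z))"
    by (rule lie_index_le[OF killing_lin])
  ultimately show ?thesis by linarith
qed

theorem infty_regular_iff_abelian: "Infty \<in> P_reg scale br \<theta> \<zeta> m \<longleftrightarrow> lie_abelian br (part 0)"
proof (cases "lie_abelian br (part 0)")
  case True
  thus ?thesis using index_infty_le_if_abelian index_le_index_infty by (simp add: P_reg_def)
next
  case False
  thus ?thesis using index_less_if_nonabelian by (simp add: P_reg_def)
qed

end

theorem corollary3p3:
  fixes scale :: "'k::{alg_closed_field, field_char_0} \<Rightarrow> 'v::ab_group_add \<Rightarrow> 'v"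
    and br :: "'v \<Rightarrow> 'v \<Rightarrow> 'v"
    and Basis :: "'v set"
    and \<theta> :: "'v \<Rightarrow> 'v"
    and \<zeta> :: 'k
    and m :: nat
  assumes "finite_dimensional_vector_space scale Basis"
    and "semisimple_lie_algebra scale br"
    and "lie_automorphism scale br \<theta>"
    and "m \<ge> 2"
    and "has_order \<theta> m"
    and "primitive_root_of_unity m \<zeta>"
  defines "g0 \<equiv> graded_part scale \<theta> \<zeta> 0"
  shows "(Infty \<in> P_reg scale br \<theta> \<zeta> m \<longleftrightarrow> vector_space.dim scale g0 = lie_rank scale br g0) \<and>
         (vector_space.dim scale g0 = lie_rank scale br g0 \<longleftrightarrow> lie_abelian br g0)"
proof -
  interpret FV: finite_dimensional_vector_space scale Basis by (rule assms(1))
  interpret SL: semisimple_lie_algebra scale br by (rule assms(2))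
  interpret periodic_semisimple_lie_algebra scale Basis br \<theta> \<zeta> m
  proof unfold_locales
    show "\<theta> ^^ m = id" using assms(5) by (simp add: has_order_def)
  qed (use assms in auto)
  show ?thesis
    unfolding g0_def using infty_regular_iff_abelian dim_eq_rank_iff_abelian by blast
qed

end
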